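(* Let $X$ and $Y$ be Banach spaces such that $X$ has the metric lifting property and $Y$ has the metric extension property, and let $T : X \to Y$ be a compact linear operator. Then $c_n(T^* ) = c_n(T)$ for all $n$.
   Context: $\mathcal{L}(X,Y)$ denotes the space of bounded linear operators between Banach spaces, with the operator norm; $T^* \in \mathcal{L}(Y^*,X^* )$ is the adjoint of $T$. Gelfand numbers: for Banach spaces $Z, W$, $R \in \mathcal{L}(Z,W)$ and an integer $n \ge 1$, $c_n(R)$ is the infimum of all $\epsilon > 0$ for which there exist an integer $k$ with $0\le k < n$ and functionals $a_1,\dots,a_k \in Z^*$ such that $$\|Rx\| \le \sup_{1\le i\le k} |\langle x, a_i\rangle| + \epsilon \|x\| \quad \text{for all } x \in Z$$ (the supremum over the empty set being $0$). Metric lifting property: a Banach space $X$ has it if for every Banach space $Z$, every closed subspace $F$ of $Z$, every $R \in \mathcal{L}(X, Z/F)$ and every $\epsilon > 0$, there exists $S \in \mathcal{L}(X,Z)$ with $\|S\| \le (1+\epsilon)\|R\|$ and $R = Q_F S$, where $Q_F : Z \to Z/F$ is the canonical quotient map. Metric extension property: a Banach space $Y$ has it if for every Banach space $Z$, every closed subspace $M$ of $Z$ and every $R \in \mathcal{L}(M,Y)$, there exists $S \in \mathcal{L}(Z,Y)$ with $R = S J_M$ and $\|S\| = \|R\|$, where $J_M : M \to Z$ is the canonical inclusion. *)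

theory Defs
  imports "HOL-Analysis.Analysis" "HOL-Algebra.Module" "HOL-Algebra.AbelCoset"
begin

section \<open>Scalars\<close>

text \<open>
  Banach spaces are real or complex. Up to isometric isomorphism, \<open>\<real>\<close> and \<open>\<complex>\<close> are the only
  instances of the following class: the map into \<open>\<complex>\<close> is a norm preserving, hence injective,
  homomorphism whose image is a field that contains \<open>\<real>\<close>.
\<close>

class real_or_complex = real_normed_field +
  assumes isometric_into_complex:
    "\<exists>j :: 'a \<Rightarrow> complex.
       (\<forall>a b. j (a + b) = j a + j b) \<and> (\<forall>a b. j (a * b) = j a * j b) \<and> (\<forall>a. cmod (j a) = norm a)"

instance real :: real_or_complex
  by standard (rule exI[of _ complex_of_real], simp)

instance complex :: real_or_complex
  by standard (rule exI[of _ "\<lambda>z. z"], simp)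

definition scalar_ring :: "'k::real_or_complex ring" where
  "scalar_ring = \<lparr>carrier = UNIV, mult = (*), one = 1, zero = 0, add = (+)\<rparr>"

section \<open>Normed spaces with explicit carriers\<close>

text \<open>
  The lifting and extension properties quantify over all Banach spaces, and the spaces \<open>Z/F\<close> and
  \<open>X\<^sup>*\<close> depend on terms, so that spaces cannot be types here. A space is a module
  of \<^theory>\<open>HOL-Algebra.Module\<close> together with a norm. That record inherits the fields
  \<open>mult\<close> and \<open>one\<close> from rings; they play no role for modules.
\<close>

record ('k, 'v) normed_module = "('k, 'v) module" +
  vnorm :: "'v \<Rightarrow> real"

text \<open>The value outside of the carrier only serves to meet the conventions of \<^locale>\<open>Metric_space\<close>.\<close>

definition vdist :: "('k, 'v) normed_module \<Rightarrow> 'v \<Rightarrow> 'v \<Rightarrow> real" where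
  "vdist V x y = (if x \<in> carrier V \<and> y \<in> carrier V then vnorm V (x \<ominus>\<^bsub>V\<^esub> y) else 0)"

abbreviation norm_topology :: "('k, 'v) normed_module \<Rightarrow> 'v topology" where
  "norm_topology V \<equiv> Metric_space.mtopology (carrier V) (vdist V)"

locale normed_space = Module.module scalar_ring V
  for V :: "('k::real_or_complex, 'v) normed_module" (structure) +
  assumes vnorm_eq_0_iff: "x \<in> carrier V \<Longrightarrow> vnorm V x = 0 \<longleftrightarrow> x = \<zero>"
    and vnorm_smult: "x \<in> carrier V \<Longrightarrow> vnorm V (a \<odot> x) = norm a * vnorm V x"
    and vnorm_triangle: "x \<in> carrier V \<Longrightarrow> y \<in> carrier V \<Longrightarrow> vnorm V (x \<oplus> y) \<le> vnorm V x + vnorm V y"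

locale banach_space = normed_space V
  for V :: "('k::real_or_complex, 'v) normed_module" (structure) +
  assumes complete: "Metric_space.mcomplete (carrier V) (vdist V)"

definition closed_subspace :: "'v set \<Rightarrow> ('k::real_or_complex, 'v) normed_module \<Rightarrow> bool" where
  "closed_subspace F V \<longleftrightarrow> submodule F scalar_ring V \<and> closedin (norm_topology V) F"

text \<open>A subspace \<open>M\<close> of \<open>V\<close> with the norm of \<open>V\<close> is \<open>V\<lparr>carrier := M\<rparr>\<close>.\<close>

definition scalar_space :: "('k::real_or_complex, 'k) normed_module" where
  "scalar_space =
     \<lparr>carrier = UNIV, mult = (*), one = 1, zero = 0, add = (+), smult = (*), vnorm = norm\<rparr>"

definition quotient_map :: "('k, 'v) normed_module \<Rightarrow> 'v set \<Rightarrow> 'v \<Rightarrow> 'v set" where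
  "quotient_map V F x = F +>\<^bsub>V\<^esub> x"

text \<open>
  The scalar multiple is the coset \<open>F + a C\<close>, since \<open>a C\<close> alone is not a coset when \<open>a = 0\<close>.
\<close>

definition quotient_space ::
    "('k, 'v) normed_module \<Rightarrow> 'v set \<Rightarrow> ('k, 'v set) normed_module" where
  "quotient_space V F =
     \<lparr>carrier = a_rcosets\<^bsub>V\<^esub> F, mult = undefined, one = undefined,
      zero = F, add = (\<lambda>C D. C <+>\<^bsub>V\<^esub> D),
      smult = (\<lambda>a C. \<Union>x\<in>C. F +>\<^bsub>V\<^esub> (a \<odot>\<^bsub>V\<^esub> x)),
      vnorm = (\<lambda>C. INF x\<in>C. vnorm V x)\<rparr>"

section \<open>Bounded operators\<close>

text \<open>Operators are extensional (\<open>undefined\<close> off the carrier), so that equality is equality of maps.\<close>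

definition bounded_operators ::
    "('k, 'v) normed_module \<Rightarrow> ('k, 'w) normed_module \<Rightarrow> ('v \<Rightarrow> 'w) set" where
  "bounded_operators V W =
     {R \<in> carrier V \<rightarrow>\<^sub>E carrier W.
        (\<forall>x\<in>carrier V. \<forall>y\<in>carrier V. R (x \<oplus>\<^bsub>V\<^esub> y) = R x \<oplus>\<^bsub>W\<^esub> R y) \<and>
        (\<forall>a. \<forall>x\<in>carrier V. R (a \<odot>\<^bsub>V\<^esub> x) = a \<odot>\<^bsub>W\<^esub> R x) \<and>
        (\<exists>B. \<forall>x\<in>carrier V. vnorm W (R x) \<le> B * vnorm V x)}"

definition op_norm ::
    "('k, 'v) normed_module \<Rightarrow> ('k, 'w) normed_module \<Rightarrow> ('v \<Rightarrow> 'w) \<Rightarrow> real" where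
  "op_norm V W R = (SUP x\<in>{x \<in> carrier V. vnorm V x \<le> 1}. vnorm W (R x))"

definition operator_space ::
    "('k, 'v) normed_module \<Rightarrow> ('k, 'w) normed_module \<Rightarrow> ('k, 'v \<Rightarrow> 'w) normed_module" where
  "operator_space V W =
     \<lparr>carrier = bounded_operators V W, mult = undefined, one = undefined,
      zero = (\<lambda>x\<in>carrier V. \<zero>\<^bsub>W\<^esub>),
      add = (\<lambda>R S. \<lambda>x\<in>carrier V. R x \<oplus>\<^bsub>W\<^esub> S x),
      smult = (\<lambda>a R. \<lambda>x\<in>carrier V. a \<odot>\<^bsub>W\<^esub> R x),
      vnorm = op_norm V W\<rparr>"

definition dual_space ::
    "('k::real_or_complex, 'v) normed_module \<Rightarrow> ('k, 'v \<Rightarrow> 'k) normed_module" where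
  "dual_space V = operator_space V scalar_space"

definition adjoint_op ::
    "('k::real_or_complex, 'v) normed_module \<Rightarrow> ('k, 'w) normed_module \<Rightarrow> ('v \<Rightarrow> 'w)
      \<Rightarrow> ('w \<Rightarrow> 'k) \<Rightarrow> 'v \<Rightarrow> 'k" where
  "adjoint_op V W T = (\<lambda>b\<in>carrier (dual_space W). compose (carrier V) b T)"

definition compact_operator ::
    "('k, 'v) normed_module \<Rightarrow> ('k, 'w) normed_module \<Rightarrow> ('v \<Rightarrow> 'w) \<Rightarrow> bool" where
  "compact_operator V W T \<longleftrightarrow>
     T \<in> bounded_operators V W \<and>
     compactin (norm_topology W)
       (norm_topology W closure_of (T ` {x \<in> carrier V. vnorm V x \<le> 1}))"

section \<open>Gelfand numbers\<close>

text \<open>\<open>c\<^sub>n\<close> is meant for \<open>n \<ge> 1\<close>; for \<open>n = 0\<close> the infimum is over the empty set.\<close>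

definition gelfand_number ::
    "('k::real_or_complex, 'v) normed_module \<Rightarrow> ('k, 'w) normed_module \<Rightarrow> nat \<Rightarrow> ('v \<Rightarrow> 'w) \<Rightarrow> real"
  where
  "gelfand_number V W n R =
     Inf {\<epsilon>. \<epsilon> > 0 \<and>
       (\<exists>k<n. \<exists>a :: nat \<Rightarrow> 'v \<Rightarrow> 'k.
          (\<forall>i\<in>{1..k}. a i \<in> carrier (dual_space V)) \<and>
          (\<forall>x\<in>carrier V. vnorm W (R x) \<le>
             (if k = 0 then 0 else SUP i\<in>{1..k}. norm (a i x)) + \<epsilon> * vnorm V x))}"

section \<open>Metric lifting and extension properties\<close>

text \<open>
  HOL cannot quantify over types inside a formula, so both properties take the type \<open>'u\<close> from
  which the carriers of the test spaces \<open>Z\<close> are drawn, as an argument.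

  If \<open>'u\<close> is large enough, this covers test spaces of any size. For the lifting property of \<open>X\<close> it
  suffices that \<open>'u\<close> has an injective image of \<open>'x \<Rightarrow> 'k\<close>: then \<open>X \<cong> \<ell>\<^sub>1(B)/F\<close>, with \<open>B\<close> the closed
  unit ball of \<open>X\<close>, is among the tests. Let \<open>S : X \<rightarrow> \<ell>\<^sub>1(B)\<close> be a lifting of this isomorphism.
  If \<open>R\<close> maps \<open>X\<close> to any quotient \<open>Z/F'\<close> then, by choice of representatives for the images of unit
  vectors, the induced map \<open>\<ell>\<^sub>1(B) \<rightarrow> X \<rightarrow> Z/F'\<close> lifts to \<open>Z\<close>, and composition with \<open>S\<close> lifts \<open>R\<close>.
  For the extension property of \<open>Y\<close> it suffices that \<open>'u\<close> has an injective image of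
  \<open>('y \<Rightarrow> 'k) \<Rightarrow> 'k\<close>: then \<open>Z = \<ell>\<^sub>\<infinity>(B)\<close>, with \<open>B\<close> the closed unit ball of \<open>Y\<^sup>*\<close> and with the copy
  of \<open>Y\<close> in it as \<open>M\<close>, is among the tests, so that \<open>Y\<close> is the image of a projection of norm at
  most 1, and operators into \<open>\<ell>\<^sub>\<infinity>(B)\<close> extend coordinatewise by the Hahn-Banach theorem.
\<close>

definition metric_lifting_property ::
    "'u itself \<Rightarrow> ('k::real_or_complex, 'x) normed_module \<Rightarrow> bool" where
  "metric_lifting_property _ X \<longleftrightarrow>
     (\<forall>(Z :: ('k, 'u) normed_module) F R \<epsilon>.
        banach_space Z \<longrightarrow> closed_subspace F Z \<longrightarrow>
        R \<in> bounded_operators X (quotient_space Z F) \<longrightarrow> \<epsilon> > 0 \<longrightarrow>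
        (\<exists>S \<in> bounded_operators X Z.
           op_norm X Z S \<le> (1 + \<epsilon>) * op_norm X (quotient_space Z F) R \<and>
           R = compose (carrier X) (quotient_map Z F) S))"

definition metric_extension_property ::
    "'u itself \<Rightarrow> ('k::real_or_complex, 'y) normed_module \<Rightarrow> bool" where
  "metric_extension_property _ Y \<longleftrightarrow>
     (\<forall>(Z :: ('k, 'u) normed_module) M R.
        banach_space Z \<longrightarrow> closed_subspace M Z \<longrightarrow>
        R \<in> bounded_operators (Z\<lparr>carrier := M\<rparr>) Y \<longrightarrow>
        (\<exists>S \<in> bounded_operators Z Y.
           R = restrict S M \<and> op_norm Z Y S = op_norm (Z\<lparr>carrier := M\<rparr>) Y R))"

text \<open>
  A type that is large enough for a space \<open>X\<close> on \<open>'x\<close> and a space \<open>Y\<close> on \<open>'y\<close>: map \<open>g :: 'x \<Rightarrow> 'k\<close>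
  to \<open>\<lambda>f. of_bool (f \<circ> Inl = g)\<close>, and \<open>\<phi> :: ('y \<Rightarrow> 'k) \<Rightarrow> 'k\<close> to \<open>\<lambda>f. \<phi> (f \<circ> Inr)\<close>.
\<close>

type_synonym ('k, 'x, 'y) test_type = "('x + 'y \<Rightarrow> 'k) \<Rightarrow> 'k"

end

theory Submission
  imports Defs
begin

text \<open>
  A number \<open>\<epsilon>\<close> is admissible for the \<open>n\<close>-th Gelfand number of \<open>T\<close> iff \<open>\<parallel>T x\<parallel> \<le> \<epsilon> \<parallel>x\<parallel>\<close> on the common
  kernel of fewer than \<open>n\<close> functionals.

  For \<open>c\<^sub>n(T\<^sup>*) \<le> c\<^sub>n(T)\<close>, extend the restriction of \<open>T\<close> to such a kernel to \<open>S\<close> with \<open>\<parallel>S\<parallel> \<le> \<epsilon>\<close>. The range of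
  \<open>T - S\<close> is spanned by fewer than \<open>n\<close> vectors of \<open>Y\<close>, and \<open>T\<^sup>* b = S\<^sup>* b\<close> for the functionals \<open>b\<close> that
  vanish at them.

  Conversely, let \<open>\<parallel>T\<^sup>* b\<parallel> \<le> \<epsilon> \<parallel>b\<parallel>\<close> on the common kernel of \<open>\<phi>\<^sub>1, \<dots>, \<phi>\<^sub>k \<in> Y\<^sup>*\<^sup>*\<close>. By the Hahn--Banach theorem,
  \<open>T x\<close> has distance at most \<open>\<epsilon> \<parallel>x\<parallel>\<close> from the span of the \<open>\<phi>\<^sub>i\<close> in \<open>Y\<^sup>*\<^sup>*\<close>, hence also from the span \<open>N\<close> of the
  \<open>P \<phi>\<^sub>i\<close> in \<open>Y\<close>, where \<open>P : Y\<^sup>*\<^sup>* \<rightarrow> Y\<close> is a projection of norm at most 1 provided by the extension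
  property. Lift \<open>X \<rightarrow> Y/N\<close> to \<open>S : X \<rightarrow> Y\<close> with \<open>\<parallel>S\<parallel> \<le> (1 + \<delta>) \<epsilon>\<close>. Then \<open>T - S\<close> has its values in \<open>N\<close>, so that
  \<open>T = S\<close> on the common kernel of \<open>k\<close> functionals.
\<close>

section \<open>Scalars\<close>

text \<open>The obstacle in the converse direction is that the given functionals live on
  \<open>Y\<^sup>*\<close> and need not be evaluations at vectors of \<open>Y\<close>, whereas the
  lifting needs a subspace of \<open>Y\<close>. The projection \<open>P\<close> repairs this without
  loss. It fixes \<open>T x\<close>, so a functional \<open>\<psi>\<close> of norm at most
  \<open>\<epsilon> \<parallel>x\<parallel>\<close> for which \<open>T x - \<psi>\<close> lies in
  the span of the \<open>\<phi>\<^sub>i\<close> yields a vector \<open>P \<psi>\<close> that is no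
  longer and for which \<open>T x - P \<psi>\<close> lies in the span of the
  \<open>P \<phi>\<^sub>i\<close>.

  Spans are controlled by one fact of linear algebra: a functional \<open>f\<close> that vanishes on
  the common kernel of \<open>a\<^sub>1, \<dots>, a\<^sub>k\<close> is
  \<open>\<Sum> f(u\<^sub>i) a\<^sub>i\<close>, with vectors \<open>u\<^sub>i\<close> chosen before
  \<open>f\<close>. This uniformity keeps the number \<open>k\<close> the same in both directions.

  Extension preserves norms, while lifting costs the factor \<open>1 + \<delta>\<close>, which the
  infimum absorbs. The test spaces are \<open>X\<close> and the bidual of \<open>Y\<close> for the
  extension property and \<open>Y\<close> for the lifting property; each is copied isometrically
  into the test type.\<close>

lemma scalar_decomposition:
  obtains \<rho> :: "'k::real_or_complex \<Rightarrow> real" where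
    "\<And>a b. \<rho> (a + b) = \<rho> a + \<rho> b" "\<And>r a. \<rho> (of_real r * a) = r * \<rho> a"
    "\<And>a. \<bar>\<rho> a\<bar> \<le> norm a" "\<And>r. \<rho> (of_real r) = r"
    "(\<forall>a. a = of_real (\<rho> a)) \<or>
     (\<exists>\<iota>. \<iota> * \<iota> = -1 \<and> \<rho> \<iota> = 0 \<and> (\<forall>a. a = of_real (\<rho> a) - \<iota> * of_real (\<rho> (\<iota> * a))))"
proof -
  obtain j :: "'k \<Rightarrow> complex" where
    add: "\<And>a b. j (a + b) = j a + j b" and mult: "\<And>a b. j (a * b) = j a * j b"
    and nrm: "\<And>a. cmod (j a) = norm a"
    using isometric_into_complex by blast
  have zero: "j 0 = 0" using nrm[of 0] by simp
  have one: "j 1 = 1"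
  proof -
    have "j 1 * j 1 = j 1" using mult[of 1 1] by (metis mult_1)
    moreover have "j 1 \<noteq> 0" using nrm[of 1] by auto
    ultimately show ?thesis by simp
  qed
  interpret j: additive j by standard (rule add)
  \<comment> \<open>The class provides only an additive and multiplicative isometry. It fixes the
    rationals, hence by continuity and density the reals, and is therefore real linear.\<close>
  have lin: "bounded_linear j"
  proof (rule bounded_linear_intro[where K = 1])
    have "isCont j a" for a
      unfolding continuous_at_eps_delta
      by (metis dist_norm j.diff nrm)
    then have cont: "continuous_on UNIV j" by (simp add: continuous_at_imp_continuous_on)
    have cont1: "continuous_on UNIV (\<lambda>r::real. j (of_real r) - of_real r)"
      by (intro continuous_intros continuous_on_compose2[OF cont]) auto
    have rat: "j (of_real r) - of_real r = 0" if "r \<in> \<rat>" for r :: real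
    proof -
      from that obtain a b where r: "r = of_int a / of_int b" and b: "b \<noteq> 0"
        by (auto elim!: Rats_cases')
      have n: "j (of_nat m) = of_nat m" for m
        by (induction m) (auto simp: add one zero)
      have i: "j (of_int c) = of_int c" for c
        by (cases c) (auto simp: n j.diff j.minus one add)
      have "of_int b * j (of_real r) = of_int a"
        using mult[of "of_int b" "of_real r"] b by (simp add: i r)
      then show ?thesis using b by (simp add: r field_simps)
    qed
    have re: "j (of_real r) = of_real r" for r
    proof -
      have "closed {r::real. j (of_real r) - of_real r = 0}"
        by (intro closed_Collect_eq cont1 continuous_on_const)
      moreover have "\<rat> \<subseteq> {r::real. j (of_real r) - of_real r = 0}" using rat by blast
      ultimately have "closure \<rat> \<subseteq> {r::real. j (of_real r) - of_real r = 0}"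
        by (rule closure_minimal[rotated])
      then show ?thesis by (auto simp: Rats_closure_real)
    qed
    show "j (r *\<^sub>R x) = r *\<^sub>R j x" for r x
      by (simp add: scaleR_conv_of_real mult re)
  qed (auto simp: add nrm)
  then interpret l: bounded_linear j .
  have re: "j (of_real r) = of_real r" for r
    by (simp add: of_real_def l.scaleR one)
  have inj: "a = b" if "j a = j b" for a b
    using that nrm[of "a - b"] by (simp add: j.diff)
  \<comment> \<open>The real part under the embedding. Together with an imaginary unit, if there is
    one, it reduces later arguments over both fields to real ones.\<close>
  define \<rho> where "\<rho> a = Re (j a)" for a
  show ?thesis
  proof (rule that[of \<rho>])
    show "\<rho> (a + b) = \<rho> a + \<rho> b" for a b by (simp add: \<rho>_def add)
    show "\<rho> (of_real r * a) = r * \<rho> a" for r a by (simp add: \<rho>_def mult re)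
    show "\<bar>\<rho> a\<bar> \<le> norm a" for a using abs_Re_le_cmod[of "j a"] by (simp add: \<rho>_def nrm)
    show "\<rho> (of_real r) = r" for r by (simp add: \<rho>_def re)
    show "(\<forall>a. a = of_real (\<rho> a)) \<or>
     (\<exists>\<iota>. \<iota> * \<iota> = -1 \<and> \<rho> \<iota> = 0 \<and> (\<forall>a. a = of_real (\<rho> a) - \<iota> * of_real (\<rho> (\<iota> * a))))"
    proof (cases "\<forall>a. Im (j a) = 0")
      case True
      then show ?thesis
        by (metis \<rho>_def complex_is_Real_iff inj of_real_Re re)
    next
      case False
      then obtain a where a: "Im (j a) \<noteq> 0" by blast
      \<comment> \<open>An element with nonzero imaginary part, shifted by its real part and divided
        by its imaginary part, becomes the imaginary unit.\<close>
      define \<iota> where "\<iota> = of_real (1 / Im (j a)) * (a - of_real (Re (j a)))"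
      have ji: "j \<iota> = \<i>"
      proof -
        have "j \<iota> = of_real (1 / Im (j a)) * (j a - of_real (Re (j a)))"
          by (simp only: \<iota>_def mult re j.diff)
        then show ?thesis using a by (simp add: complex_eq_iff)
      qed
      have "\<iota> * \<iota> = -1"
        by (rule inj) (simp add: mult ji j.minus one)
      moreover have "\<rho> \<iota> = 0" by (simp add: \<rho>_def ji)
      \<comment> \<open>\<open>Re (\<i> z) = - Im z\<close>, so this is the splitting of
        \<open>c\<close> into real and imaginary part.\<close>
      moreover have "c = of_real (\<rho> c) - \<iota> * of_real (\<rho> (\<iota> * c))" for c
        by (rule inj) (simp add: mult ji re j.diff add \<rho>_def complex_eq_iff)
      ultimately show ?thesis by blast
    qed
  qed
qed

text \<open>Completeness is inherited from \<real>: the coordinates \<open>\<rho> (s n)\<close> and,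
  in the complex case, \<open>\<rho> (\<iota> * s n)\<close> are Cauchy sequences of reals. It is
  what makes dual spaces complete.\<close>

lemma Cauchy_convergent_scalar:
  fixes s :: "nat \<Rightarrow> 'k::real_or_complex"
  assumes "Cauchy s"
  shows "convergent s"
proof -
  obtain \<rho> :: "'k \<Rightarrow> real" where add: "\<And>a b. \<rho> (a + b) = \<rho> a + \<rho> b"
    and sc: "\<And>r a. \<rho> (of_real r * a) = r * \<rho> a" and le: "\<And>a. \<bar>\<rho> a\<bar> \<le> norm a"
    and D: "(\<forall>a. a = of_real (\<rho> a)) \<or>
     (\<exists>\<iota>. \<iota> * \<iota> = -1 \<and> \<rho> \<iota> = 0 \<and> (\<forall>a. a = of_real (\<rho> a) - \<iota> * of_real (\<rho> (\<iota> * a))))"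
    by (rule scalar_decomposition) (rule that, assumption+)
  have bl: "bounded_linear \<rho>"
    by (rule bounded_linear_intro[where K = 1]) (auto simp: add sc le scaleR_conv_of_real)
  have conv: "convergent (\<lambda>n. \<rho> (t n))" if "Cauchy t" for t
    using bounded_linear.Cauchy[OF bl that] real_Cauchy_convergent by blast
  from D show ?thesis
  proof
    assume "\<forall>a. a = of_real (\<rho> a)"
    then have "s = (\<lambda>n. of_real (\<rho> (s n)))" by auto
    then show ?thesis using conv[OF assms] by (metis convergent_of_real)
  next
    assume "\<exists>\<iota>. \<iota> * \<iota> = -1 \<and> \<rho> \<iota> = 0 \<and> (\<forall>a. a = of_real (\<rho> a) - \<iota> * of_real (\<rho> (\<iota> * a)))"
    then obtain \<iota> where "\<And>a. a = of_real (\<rho> a) - \<iota> * of_real (\<rho> (\<iota> * a))" by blast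
    then have s: "s = (\<lambda>n. of_real (\<rho> (s n)) - \<iota> * of_real (\<rho> (\<iota> * s n)))" by auto
    have "Cauchy (\<lambda>n. \<iota> * s n)"
      by (rule bounded_linear.Cauchy[OF bounded_linear_mult_right assms])
    then show ?thesis
      by (subst s) (intro convergent_diff convergent_mult convergent_const convergent_of_real conv assms)
  qed
qed

section \<open>Normed spaces\<close>

lemma scalar_ring_simps [simp]:
  "carrier scalar_ring = UNIV" "a \<oplus>\<^bsub>scalar_ring\<^esub> b = a + b" "a \<otimes>\<^bsub>scalar_ring\<^esub> b = a * b"
  "\<one>\<^bsub>scalar_ring\<^esub> = 1" "\<zero>\<^bsub>scalar_ring\<^esub> = 0"
  by (simp_all add: scalar_ring_def)

lemma cring_scalar_ring: "cring (scalar_ring :: 'k::real_or_complex ring)"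
proof (rule cringI)
  show "abelian_group (scalar_ring :: 'k ring)"
  proof (rule abelian_groupI)
    show "\<exists>y\<in>carrier scalar_ring. y \<oplus>\<^bsub>scalar_ring\<^esub> x = \<zero>\<^bsub>scalar_ring\<^esub>" for x :: 'k
      by (rule bexI[of _ "- x"]) auto
  qed auto
  show "Group.comm_monoid (scalar_ring :: 'k ring)"
    by (rule comm_monoidI) auto
qed (auto simp: distrib_right)

lemma a_inv_scalar_ring [simp]: "\<ominus>\<^bsub>scalar_ring\<^esub> a = - a"
proof -
  interpret cring "scalar_ring :: 'a ring" by (rule cring_scalar_ring)
  show ?thesis by (rule minus_equality) auto
qed

text \<open>Additive inverses are supplied by \<open>(-1) \<odot> x\<close>, so a new space need not
  say what \<open>\<ominus>\<close> is; that operation is a definite description in terms of the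
  addition.\<close>

lemma normed_spaceI:
  fixes V :: "('k::real_or_complex, 'v) normed_module" (structure)
  assumes "\<zero> \<in> carrier V"
    and "\<And>x y. x \<in> carrier V \<Longrightarrow> y \<in> carrier V \<Longrightarrow> x \<oplus> y \<in> carrier V"
    and "\<And>a x. x \<in> carrier V \<Longrightarrow> a \<odot> x \<in> carrier V"
    and "\<And>x y z. x \<in> carrier V \<Longrightarrow> y \<in> carrier V \<Longrightarrow> z \<in> carrier V \<Longrightarrow> (x \<oplus> y) \<oplus> z = x \<oplus> (y \<oplus> z)"
    and "\<And>x y. x \<in> carrier V \<Longrightarrow> y \<in> carrier V \<Longrightarrow> x \<oplus> y = y \<oplus> x"
    and "\<And>x. x \<in> carrier V \<Longrightarrow> \<zero> \<oplus> x = x"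
    and "\<And>x. x \<in> carrier V \<Longrightarrow> ((-1) \<odot> x) \<oplus> x = \<zero>"
    and "\<And>a b x. x \<in> carrier V \<Longrightarrow> (a + b) \<odot> x = (a \<odot> x) \<oplus> (b \<odot> x)"
    and "\<And>a x y. x \<in> carrier V \<Longrightarrow> y \<in> carrier V \<Longrightarrow> a \<odot> (x \<oplus> y) = (a \<odot> x) \<oplus> (a \<odot> y)"
    and "\<And>a b x. x \<in> carrier V \<Longrightarrow> (a * b) \<odot> x = a \<odot> (b \<odot> x)"
    and "\<And>x. x \<in> carrier V \<Longrightarrow> 1 \<odot> x = x"
    and "\<And>x. x \<in> carrier V \<Longrightarrow> vnorm V x = 0 \<longleftrightarrow> x = \<zero>"
    and "\<And>a x. x \<in> carrier V \<Longrightarrow> vnorm V (a \<odot> x) = norm a * vnorm V x"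
    and "\<And>x y. x \<in> carrier V \<Longrightarrow> y \<in> carrier V \<Longrightarrow> vnorm V (x \<oplus> y) \<le> vnorm V x + vnorm V y"
  shows "normed_space V"
proof (intro normed_space.intro normed_space_axioms.intro moduleI)
  show "abelian_group V"
  proof (rule abelian_groupI)
    show "\<exists>y\<in>carrier V. y \<oplus> x = \<zero>" if "x \<in> carrier V" for x
      using assms(3,7)[OF that] by blast
  qed (use assms(1,2,4,5,6) in blast)+
qed (simp_all add: cring_scalar_ring assms(3,8-14))

context normed_space
begin

lemma smult_in [simp, intro]: "x \<in> carrier V \<Longrightarrow> a \<odot> x \<in> carrier V"
  using smult_closed by simp

lemma smult_add_left: "x \<in> carrier V \<Longrightarrow> (a + b) \<odot> x = (a \<odot> x) \<oplus> (b \<odot> x)"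
  using smult_l_distr[of a b x] by simp

lemma smult_add_right: "x \<in> carrier V \<Longrightarrow> y \<in> carrier V \<Longrightarrow> a \<odot> (x \<oplus> y) = (a \<odot> x) \<oplus> (a \<odot> y)"
  using smult_r_distr[of a x y] by simp

lemma smult_mult: "x \<in> carrier V \<Longrightarrow> (a * b) \<odot> x = a \<odot> (b \<odot> x)"
  using smult_assoc1[of a b x] by simp

lemma smult_1 [simp]: "x \<in> carrier V \<Longrightarrow> 1 \<odot> x = x"
  using smult_one[of x] by simp

lemma smult_0 [simp]: "x \<in> carrier V \<Longrightarrow> 0 \<odot> x = \<zero>"
  using smult_l_null[of x] by simp

lemma smult_zero [simp]: "a \<odot> \<zero> = \<zero>"
  using smult_r_null[of a] by simp

lemma smult_minus_left: "x \<in> carrier V \<Longrightarrow> (- a) \<odot> x = \<ominus> (a \<odot> x)"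
  using smult_l_minus[of a x] by simp

lemma smult_minus_right: "x \<in> carrier V \<Longrightarrow> a \<odot> (\<ominus> x) = \<ominus> (a \<odot> x)"
  using smult_r_minus[of a x] by simp

lemma smult_minus_one: "x \<in> carrier V \<Longrightarrow> (- 1) \<odot> x = \<ominus> x"
  by (simp add: smult_minus_left)

lemma vnorm_zero [simp]: "vnorm V \<zero> = 0"
  by (simp add: vnorm_eq_0_iff)

lemma vnorm_uminus [simp]: "x \<in> carrier V \<Longrightarrow> vnorm V (\<ominus> x) = vnorm V x"
  using vnorm_smult[of x "-1"] by (simp add: smult_minus_one)

lemma vnorm_nonneg [simp]: "x \<in> carrier V \<Longrightarrow> 0 \<le> vnorm V x"
  using vnorm_triangle[of x "\<ominus> x"] by (simp add: M.r_neg)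

lemma minus_commute_vnorm:
  "x \<in> carrier V \<Longrightarrow> y \<in> carrier V \<Longrightarrow> vnorm V (x \<ominus> y) = vnorm V (y \<ominus> x)"
  using vnorm_uminus[of "x \<ominus> y"] by (simp add: M.minus_eq M.minus_add M.a_ac)

lemma vnorm_minus_le:
  "x \<in> carrier V \<Longrightarrow> y \<in> carrier V \<Longrightarrow> vnorm V (x \<ominus> y) \<le> vnorm V x + vnorm V y"
  using vnorm_triangle[of x "\<ominus> y"] by (simp add: M.minus_eq)

lemma minus_cancel_mid:
  assumes "x \<in> carrier V" "y \<in> carrier V" "z \<in> carrier V"
  shows "(x \<ominus> y) \<oplus> (y \<ominus> z) = x \<ominus> z"
  using assms by (simp add: M.minus_eq M.a_ac M.r_neg1 M.r_neg2)

lemma minus_add_cancel [simp]: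
  assumes "x \<in> carrier V" "y \<in> carrier V"
  shows "(x \<ominus> y) \<oplus> y = x" "y \<oplus> (x \<ominus> y) = x"
  using assms by (simp_all add: M.minus_eq M.a_ac M.r_neg M.r_neg1 M.r_neg2)

lemma minus_self [simp]: "x \<in> carrier V \<Longrightarrow> x \<ominus> x = \<zero>"
  by (simp add: M.minus_eq M.r_neg)

lemma minus_eq_zero_iff:
  "x \<in> carrier V \<Longrightarrow> y \<in> carrier V \<Longrightarrow> x \<ominus> y = \<zero> \<longleftrightarrow> x = y"
  using minus_add_cancel(1)[of x y] by fastforce

sublocale Metric_space "carrier V" "vdist V"
proof
  fix x y z
  show "0 \<le> vdist V x y" by (simp add: vdist_def)
  show "vdist V x y = vdist V y x" by (simp add: vdist_def minus_commute_vnorm)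
  show "vdist V x y = 0 \<longleftrightarrow> x = y" if "x \<in> carrier V" "y \<in> carrier V"
    using that by (simp add: vdist_def vnorm_eq_0_iff minus_eq_zero_iff)
  show "vdist V x z \<le> vdist V x y + vdist V y z"
    if "x \<in> carrier V" "y \<in> carrier V" "z \<in> carrier V"
    using that vnorm_triangle[of "x \<ominus> y" "y \<ominus> z"] by (simp add: vdist_def minus_cancel_mid)
qed

section \<open>Sequential forms of convergence, closedness and completeness\<close>

lemma limitin_vnorm:
  assumes "range \<sigma> \<subseteq> carrier V"
  shows "limitin mtopology \<sigma> l sequentially \<longleftrightarrow>
    l \<in> carrier V \<and> (\<lambda>n. vnorm V (\<sigma> n \<ominus> l)) \<longlonglongrightarrow> 0"
proof -
  have "\<sigma> n \<in> carrier V" for n using assms by auto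
  then show ?thesis by (auto simp: limitin_metric_dist_null vdist_def)
qed

lemma closed_subspaceI:
  assumes "F \<subseteq> carrier V" "\<zero> \<in> F" "\<And>x y. x \<in> F \<Longrightarrow> y \<in> F \<Longrightarrow> x \<oplus> y \<in> F"
    and smul: "\<And>a x. x \<in> F \<Longrightarrow> a \<odot> x \<in> F"
    and "\<And>\<sigma> l. (\<And>n. \<sigma> n \<in> F) \<Longrightarrow> l \<in> carrier V \<Longrightarrow> (\<lambda>n. vnorm V (\<sigma> n \<ominus> l)) \<longlonglongrightarrow> 0 \<Longrightarrow> l \<in> F"
  shows "closed_subspace F V"
  unfolding closed_subspace_def metric_closedin_iff_sequentially_closed
proof (intro conjI allI impI)
  show "submodule F scalar_ring V"
  proof (rule submoduleI)
    show "\<ominus> x \<in> F" if "x \<in> F" for x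
      using smul[OF that, of "-1"] assms(1) that by (simp add: smult_minus_one subset_iff)
  qed (use assms(1-4) in blast)+
  show "l \<in> F" if "range \<sigma> \<subseteq> F \<and> limitin mtopology \<sigma> l sequentially" for \<sigma> l
    using that assms(1,5) limitin_vnorm[of \<sigma> l] by (metis range_subsetD subset_trans)
qed (rule assms)

lemma closed_subspaceD:
  assumes "closed_subspace F V"
  shows "F \<subseteq> carrier V" "\<zero> \<in> F" "\<And>x y. x \<in> F \<Longrightarrow> y \<in> F \<Longrightarrow> x \<oplus> y \<in> F"
    "\<And>a x. x \<in> F \<Longrightarrow> a \<odot> x \<in> F" "\<And>x. x \<in> F \<Longrightarrow> \<ominus> x \<in> F"
    "\<And>\<sigma> l. (\<And>n. \<sigma> n \<in> F) \<Longrightarrow> l \<in> carrier V \<Longrightarrow> (\<lambda>n. vnorm V (\<sigma> n \<ominus> l)) \<longlonglongrightarrow> 0 \<Longrightarrow> l \<in> F"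
proof -
  have F: "submodule F scalar_ring V" "closedin mtopology F"
    using assms by (auto simp: closed_subspace_def)
  show sub: "F \<subseteq> carrier V" using submoduleE(1)[OF F(1)] .
  show smul: "\<And>a x. x \<in> F \<Longrightarrow> a \<odot> x \<in> F" using submoduleE(4)[OF F(1)] by simp
  show "\<zero> \<in> F" using submoduleE(2)[OF F(1)] smul[of _ 0] sub by (metis ex_in_conv smult_0 subsetD)
  show "\<And>x y. x \<in> F \<Longrightarrow> y \<in> F \<Longrightarrow> x \<oplus> y \<in> F" "\<And>x. x \<in> F \<Longrightarrow> \<ominus> x \<in> F"
    using submoduleE(3,5)[OF F(1)] by blast+
  show "l \<in> F" if "\<And>n. \<sigma> n \<in> F" "l \<in> carrier V" "(\<lambda>n. vnorm V (\<sigma> n \<ominus> l)) \<longlonglongrightarrow> 0" for \<sigma> l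
  proof -
    have "range \<sigma> \<subseteq> F" using that(1) by auto
    moreover have "limitin mtopology \<sigma> l sequentially"
      using that limitin_vnorm[of \<sigma> l] sub by auto
    ultimately show ?thesis
      using F(2) unfolding metric_closedin_iff_sequentially_closed by blast
  qed
qed

lemma mcomplete_vnorm:
  "mcomplete \<longleftrightarrow>
    (\<forall>\<sigma>. (\<forall>n. \<sigma> n \<in> carrier V) \<and> (\<forall>e>0. \<exists>N. \<forall>m\<ge>N. \<forall>n\<ge>N. vnorm V (\<sigma> m \<ominus> \<sigma> n) < e) \<longrightarrow>
      (\<exists>l\<in>carrier V. (\<lambda>n. vnorm V (\<sigma> n \<ominus> l)) \<longlonglongrightarrow> 0))"
proof -
  have A: "MCauchy \<sigma> \<longleftrightarrow> (\<forall>n. \<sigma> n \<in> carrier V) \<and>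
      (\<forall>e>0. \<exists>N. \<forall>m\<ge>N. \<forall>n\<ge>N. vnorm V (\<sigma> m \<ominus> \<sigma> n) < e)" for \<sigma>
  proof (cases "\<forall>n. \<sigma> n \<in> carrier V")
    case True
    then show ?thesis by (fastforce simp: MCauchy_def vdist_def)
  qed (auto simp: MCauchy_def)
  have B: "(\<exists>l. limitin mtopology \<sigma> l sequentially) \<longleftrightarrow>
      (\<exists>l\<in>carrier V. (\<lambda>n. vnorm V (\<sigma> n \<ominus> l)) \<longlonglongrightarrow> 0)" if "\<forall>n. \<sigma> n \<in> carrier V" for \<sigma>
    using that limitin_vnorm[of \<sigma>] by blast
  show ?thesis
    unfolding mcomplete_def A by (intro all_cong1 imp_cong refl) (rule B, blast)
qed

end

section \<open>Bounded operators and dual spaces\<close>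

lemma bounded_operatorsD:
  assumes "R \<in> bounded_operators V W"
  shows "\<And>x. x \<in> carrier V \<Longrightarrow> R x \<in> carrier W" "R \<in> extensional (carrier V)"
    "\<And>x y. x \<in> carrier V \<Longrightarrow> y \<in> carrier V \<Longrightarrow> R (x \<oplus>\<^bsub>V\<^esub> y) = R x \<oplus>\<^bsub>W\<^esub> R y"
    "\<And>a x. x \<in> carrier V \<Longrightarrow> R (a \<odot>\<^bsub>V\<^esub> x) = a \<odot>\<^bsub>W\<^esub> R x"
    "\<exists>B. \<forall>x\<in>carrier V. vnorm W (R x) \<le> B * vnorm V x"
  using assms by (auto simp: bounded_operators_def PiE_def)

lemma bounded_operatorsI:
  assumes "\<And>x. x \<in> carrier V \<Longrightarrow> R x \<in> carrier W" "R \<in> extensional (carrier V)"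
    "\<And>x y. x \<in> carrier V \<Longrightarrow> y \<in> carrier V \<Longrightarrow> R (x \<oplus>\<^bsub>V\<^esub> y) = R x \<oplus>\<^bsub>W\<^esub> R y"
    "\<And>a x. x \<in> carrier V \<Longrightarrow> R (a \<odot>\<^bsub>V\<^esub> x) = a \<odot>\<^bsub>W\<^esub> R x"
    "\<And>x. x \<in> carrier V \<Longrightarrow> vnorm W (R x) \<le> B * vnorm V x"
  shows "R \<in> bounded_operators V W"
  using assms(1-4) exI[of "\<lambda>B. \<forall>x\<in>carrier V. vnorm W (R x) \<le> B * vnorm V x" B] assms(5)
  by (simp add: bounded_operators_def PiE_def)

text \<open>Bare records suffice here, because the bound is needed for subspaces
  \<open>Z\<lparr>carrier := M\<rparr>\<close> and for operators into quotients, neither of which is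
  shown to be a normed space. The vector \<open>z\<close> makes the unit ball nonempty, so that the
  supremum is meaningful.\<close>

lemma op_norm_le:
  assumes "z \<in> carrier V" "vnorm V z \<le> 1" "0 \<le> C"
    and le: "\<And>x. x \<in> carrier V \<Longrightarrow> vnorm W (R x) \<le> C * vnorm V x"
  shows "op_norm V W R \<le> C"
  unfolding op_norm_def
proof (rule cSUP_least)
  fix x assume x: "x \<in> {x \<in> carrier V. vnorm V x \<le> 1}"
  then have "vnorm W (R x) \<le> C * vnorm V x" using le by simp
  also have "\<dots> \<le> C * 1" using x assms(3) by (intro mult_left_mono) auto
  finally show "vnorm W (R x) \<le> C" by simp
qed (use assms in auto)

locale bounded_op = V: normed_space V + W: normed_space W
  for V :: "('k::real_or_complex, 'v) normed_module" and W :: "('k, 'w) normed_module" +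
  fixes R :: "'v \<Rightarrow> 'w"
  assumes bounded: "R \<in> bounded_operators V W"
begin

lemma closed [simp, intro]: "x \<in> carrier V \<Longrightarrow> R x \<in> carrier W"
  and add: "x \<in> carrier V \<Longrightarrow> y \<in> carrier V \<Longrightarrow> R (x \<oplus>\<^bsub>V\<^esub> y) = R x \<oplus>\<^bsub>W\<^esub> R y"
  and smult: "x \<in> carrier V \<Longrightarrow> R (a \<odot>\<^bsub>V\<^esub> x) = a \<odot>\<^bsub>W\<^esub> R x"
  and ext: "R \<in> extensional (carrier V)"
  using bounded_operatorsD[OF bounded] by blast+

lemma zero: "R \<zero>\<^bsub>V\<^esub> = \<zero>\<^bsub>W\<^esub>"
  using smult[of "\<zero>\<^bsub>V\<^esub>" 0] by simp

lemma uminus: "x \<in> carrier V \<Longrightarrow> R (\<ominus>\<^bsub>V\<^esub> x) = \<ominus>\<^bsub>W\<^esub> R x"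
  using smult[of x "-1"] by (simp add: V.smult_minus_one W.smult_minus_one)

lemma diff: "x \<in> carrier V \<Longrightarrow> y \<in> carrier V \<Longrightarrow> R (x \<ominus>\<^bsub>V\<^esub> y) = R x \<ominus>\<^bsub>W\<^esub> R y"
  by (simp add: V.M.minus_eq W.M.minus_eq add uminus)

lemma norm_bound:
  assumes x: "x \<in> carrier V"
  shows "vnorm W (R x) \<le> op_norm V W R * vnorm V x"
proof (cases "vnorm V x = 0")
  case True
  then show ?thesis using x by (simp add: V.vnorm_eq_0_iff zero)
next
  case False
  then have pos: "vnorm V x > 0" using x by (simp add: order_less_le)
  obtain B where B: "\<And>x. x \<in> carrier V \<Longrightarrow> vnorm W (R x) \<le> B * vnorm V x"
    using bounded_operatorsD(5)[OF bounded] by blast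
  define c :: 'k where "c = of_real (1 / vnorm V x)"
  have nc: "norm c = 1 / vnorm V x" using pos by (simp add: c_def norm_divide)
  have "vnorm W (R (c \<odot>\<^bsub>V\<^esub> x)) \<le> op_norm V W R"
    unfolding op_norm_def
  proof (rule cSUP_upper)
    show "c \<odot>\<^bsub>V\<^esub> x \<in> {x \<in> carrier V. vnorm V x \<le> 1}"
      using x pos by (simp add: V.vnorm_smult nc)
    show "bdd_above ((\<lambda>x. vnorm W (R x)) ` {x \<in> carrier V. vnorm V x \<le> 1})"
    proof (rule bdd_aboveI2)
      fix y assume y: "y \<in> {x \<in> carrier V. vnorm V x \<le> 1}"
      then have "vnorm W (R y) \<le> B * vnorm V y" using B by simp
      \<comment> \<open>\<open>B\<close> may be negative when all norms are 0, hence the absolute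
        value.\<close>
      also have "\<dots> \<le> \<bar>B\<bar> * 1" using y by (intro mult_mono) auto
      finally show "vnorm W (R y) \<le> \<bar>B\<bar>" by simp
    qed
  qed
  then show ?thesis using x pos by (simp add: smult W.vnorm_smult nc field_simps)
qed

lemma op_norm_nonneg: "0 \<le> op_norm V W R"
proof -
  have "0 \<le> vnorm W (R \<zero>\<^bsub>V\<^esub>)" by simp
  also have "\<dots> \<le> op_norm V W R"
    unfolding op_norm_def
  proof (rule cSUP_upper)
    show "bdd_above ((\<lambda>x. vnorm W (R x)) ` {x \<in> carrier V. vnorm V x \<le> 1})"
    proof (rule bdd_aboveI2)
      fix y assume y: "y \<in> {x \<in> carrier V. vnorm V x \<le> 1}"
      then have "vnorm W (R y) \<le> op_norm V W R * vnorm V y" using norm_bound by simp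
      also have "\<dots> \<le> \<bar>op_norm V W R\<bar> * 1" using y by (intro mult_mono) auto
      finally show "vnorm W (R y) \<le> \<bar>op_norm V W R\<bar>" by simp
    qed
  qed simp
  finally show ?thesis .
qed

lemma op_norm_leI:
  assumes "0 \<le> C" "\<And>x. x \<in> carrier V \<Longrightarrow> vnorm W (R x) \<le> C * vnorm V x"
  shows "op_norm V W R \<le> C"
  using op_norm_le[of "\<zero>\<^bsub>V\<^esub>" V C W R] assms by simp

end

lemma scalar_space_simps [simp]:
  "carrier scalar_space = UNIV" "a \<oplus>\<^bsub>scalar_space\<^esub> b = a + b" "a \<odot>\<^bsub>scalar_space\<^esub> b = a * b"
  "\<zero>\<^bsub>scalar_space\<^esub> = 0" "vnorm scalar_space = norm"
  by (simp_all add: scalar_space_def)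

lemma normed_space_scalar: "normed_space (scalar_space :: ('k::real_or_complex, 'k) normed_module)"
  by (rule normed_spaceI) (auto simp: distrib_left distrib_right norm_mult norm_triangle_ineq)

interpretation scalar_space: normed_space "scalar_space :: ('k::real_or_complex, 'k) normed_module"
  by (rule normed_space_scalar)

lemma scalar_space_minus [simp]:
  "\<ominus>\<^bsub>scalar_space\<^esub> a = - a" "a \<ominus>\<^bsub>scalar_space\<^esub> b = a - b"
  using scalar_space.smult_minus_one[of a] scalar_space.smult_minus_one[of b]
  by (simp_all add: a_minus_def)

lemma dual_simps [simp]:
  "carrier (dual_space V) = bounded_operators V scalar_space"
  "vnorm (dual_space V) = op_norm V scalar_space"
  "\<zero>\<^bsub>dual_space V\<^esub> = (\<lambda>x\<in>carrier V. 0)"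
  "f \<oplus>\<^bsub>dual_space V\<^esub> g = (\<lambda>x\<in>carrier V. f x + g x)"
  "a \<odot>\<^bsub>dual_space V\<^esub> f = (\<lambda>x\<in>carrier V. a * f x)"
  by (simp_all add: dual_space_def operator_space_def)

locale functional = bounded_op V scalar_space f
  for V :: "('k::real_or_complex, 'v) normed_module" and f

lemma functionalI:
  "normed_space V \<Longrightarrow> f \<in> bounded_operators V scalar_space \<Longrightarrow> functional V f"
  by (intro functional.intro bounded_op.intro bounded_op_axioms.intro normed_space_scalar)

lemma bounded_opI:
  "normed_space V \<Longrightarrow> normed_space W \<Longrightarrow> R \<in> bounded_operators V W \<Longrightarrow> bounded_op V W R"
  by (intro bounded_op.intro bounded_op_axioms.intro)

context functional
begin

lemmas linear = add[simplified] smult[simplified] zero[simplified] diff[simplified]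

lemmas bound = norm_bound[simplified]

lemma leI:
  assumes "0 \<le> C" "\<And>x. x \<in> carrier V \<Longrightarrow> norm (f x) \<le> C * vnorm V x"
  shows "op_norm V scalar_space f \<le> C"
  using op_norm_leI assms by simp

end

section \<open>Norm and completeness of the dual space\<close>

context normed_space
begin

lemma dual_add:
  assumes f: "f \<in> bounded_operators V scalar_space" and g: "g \<in> bounded_operators V scalar_space"
  shows "(\<lambda>x\<in>carrier V. f x + g x) \<in> bounded_operators V scalar_space"
    "op_norm V scalar_space (\<lambda>x\<in>carrier V. f x + g x)
      \<le> op_norm V scalar_space f + op_norm V scalar_space g"
proof -
  interpret f: functional V f by (rule functionalI[OF normed_space_axioms f])
  interpret g: functional V g by (rule functionalI[OF normed_space_axioms g])
  have le: "norm (f x + g x) \<le> (op_norm V scalar_space f + op_norm V scalar_space g) * vnorm V x"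
    if "x \<in> carrier V" for x
    using norm_triangle_le[OF add_mono[OF f.bound[OF that] g.bound[OF that]]]
    by (simp add: distrib_right)
  show *: "(\<lambda>x\<in>carrier V. f x + g x) \<in> bounded_operators V scalar_space"
    by (rule bounded_operatorsI) (auto simp: f.linear g.linear distrib_left intro: le)
  interpret h: functional V "\<lambda>x\<in>carrier V. f x + g x"
    by (rule functionalI[OF normed_space_axioms *])
  show "op_norm V scalar_space (\<lambda>x\<in>carrier V. f x + g x)
      \<le> op_norm V scalar_space f + op_norm V scalar_space g"
    by (rule h.leI) (auto simp: f.op_norm_nonneg g.op_norm_nonneg intro: le)
qed

lemma dual_smult:
  assumes f: "f \<in> bounded_operators V scalar_space"
  shows "(\<lambda>x\<in>carrier V. a * f x) \<in> bounded_operators V scalar_space"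
    "op_norm V scalar_space (\<lambda>x\<in>carrier V. a * f x) = norm a * op_norm V scalar_space f"
proof -
  have 1: "(\<lambda>x\<in>carrier V. a * f x) \<in> bounded_operators V scalar_space \<and>
    op_norm V scalar_space (\<lambda>x\<in>carrier V. a * f x) \<le> norm a * op_norm V scalar_space f"
    if f: "f \<in> bounded_operators V scalar_space" for a f
  proof -
    interpret f: functional V f by (rule functionalI[OF normed_space_axioms f])
    have le: "norm (a * f x) \<le> (norm a * op_norm V scalar_space f) * vnorm V x"
      if "x \<in> carrier V" for x
      using mult_left_mono[OF f.bound[OF that] norm_ge_zero[of a]] by (simp add: norm_mult mult.assoc)
    have *: "(\<lambda>x\<in>carrier V. a * f x) \<in> bounded_operators V scalar_space"
      by (rule bounded_operatorsI) (auto simp: f.linear distrib_left intro: le)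
    interpret h: functional V "\<lambda>x\<in>carrier V. a * f x"
      by (rule functionalI[OF normed_space_axioms *])
    have "op_norm V scalar_space (\<lambda>x\<in>carrier V. a * f x) \<le> norm a * op_norm V scalar_space f"
      by (rule h.leI) (auto simp: f.op_norm_nonneg intro: le)
    with * show ?thesis by simp
  qed
  show m: "(\<lambda>x\<in>carrier V. a * f x) \<in> bounded_operators V scalar_space"
    using 1[OF f] by blast
  show "op_norm V scalar_space (\<lambda>x\<in>carrier V. a * f x) = norm a * op_norm V scalar_space f"
  proof (cases "a = 0")
    case True
    interpret f: functional V f by (rule functionalI[OF normed_space_axioms f])
    interpret h: functional V "\<lambda>x\<in>carrier V. a * f x"
      by (rule functionalI[OF normed_space_axioms m])
    show ?thesis using 1[OF f, of a] h.op_norm_nonneg True by simp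
  next
    case False
    interpret f: functional V f by (rule functionalI[OF normed_space_axioms f])
    \<comment> \<open>The reverse inequality is the one already shown, applied to
      \<open>inverse a\<close> and the functional \<open>a f\<close>; extensionality of
      \<open>f\<close> makes the product return exactly \<open>f\<close>.\<close>
    have "(\<lambda>x\<in>carrier V. inverse a * (\<lambda>x\<in>carrier V. a * f x) x) = f"
      using False f.ext by (auto simp: fun_eq_iff extensional_def)
    then have "op_norm V scalar_space f
        \<le> norm (inverse a) * op_norm V scalar_space (\<lambda>x\<in>carrier V. a * f x)"
      using 1[OF m, of "inverse a"] by simp
    then show ?thesis
      using 1[OF f, of a] False by (intro antisym) (auto simp: norm_divide field_simps)
  qed
qed

lemma normed_space_dual: "normed_space (dual_space V)"
proof (rule normed_spaceI)
  show "\<zero>\<^bsub>dual_space V\<^esub> \<in> carrier (dual_space V)"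
    by (auto intro!: bounded_operatorsI[where B = 0])
  fix f assume f: "f \<in> carrier (dual_space V)"
  then interpret f: functional V f
    by (intro functionalI[OF normed_space_axioms]) simp
  show "vnorm (dual_space V) f = 0 \<longleftrightarrow> f = \<zero>\<^bsub>dual_space V\<^esub>"
  proof
    assume "vnorm (dual_space V) f = 0"
    then have "f x = 0" if "x \<in> carrier V" for x using f.bound[OF that] by simp
    then show "f = \<zero>\<^bsub>dual_space V\<^esub>" using f.ext by (auto simp: extensional_def)
  next
    assume "f = \<zero>\<^bsub>dual_space V\<^esub>"
    then have "op_norm V scalar_space f \<le> 0" by (intro f.leI) auto
    then show "vnorm (dual_space V) f = 0" using f.op_norm_nonneg by simp
  qed
  show "\<zero>\<^bsub>dual_space V\<^esub> \<oplus>\<^bsub>dual_space V\<^esub> f = f"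
    "1 \<odot>\<^bsub>dual_space V\<^esub> f = f"
    using f.ext by (auto simp: extensional_def)
qed (auto simp: dual_add dual_smult fun_eq_iff distrib_left distrib_right)

lemma dual_minus:
  assumes f: "f \<in> bounded_operators V scalar_space" and g: "g \<in> bounded_operators V scalar_space"
  shows "f \<ominus>\<^bsub>dual_space V\<^esub> g = (\<lambda>x\<in>carrier V. f x - g x)"
proof -
  interpret D: normed_space "dual_space V" by (rule normed_space_dual)
  show ?thesis
    using D.smult_minus_one[of g, symmetric] f g by (auto simp: a_minus_def)
qed

text \<open>The bidual of \<open>Y\<close> serves as a test space and must therefore be complete.
  Cauchy sequences of functionals converge pointwise because the scalars are complete, and the limit
  is one in operator norm because the Cauchy estimates are uniform relative to
  \<open>vnorm V x\<close>.\<close>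

lemma banach_space_dual: "banach_space (dual_space V)"
proof -
  interpret D: normed_space "dual_space V" by (rule normed_space_dual)
  have "D.mcomplete"
    unfolding D.mcomplete_vnorm
  proof (intro allI impI, elim conjE)
    fix \<sigma> :: "nat \<Rightarrow> 'v \<Rightarrow> 'k" assume s: "\<forall>n. \<sigma> n \<in> carrier (dual_space V)"
      and C: "\<forall>e>0. \<exists>N. \<forall>m\<ge>N. \<forall>n\<ge>N. vnorm (dual_space V) (\<sigma> m \<ominus>\<^bsub>dual_space V\<^esub> \<sigma> n) < e"
    have f: "functional V (\<sigma> n)" for n
      using s by (intro functionalI[OF normed_space_axioms]) simp
    have fd: "functional V (\<sigma> m \<ominus>\<^bsub>dual_space V\<^esub> \<sigma> n)" for m n
      using D.minus_closed[of "\<sigma> m" "\<sigma> n"] s by (intro functionalI[OF normed_space_axioms]) simp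
    have dle: "norm (\<sigma> m x - \<sigma> n x) \<le> e * vnorm V x"
      if "vnorm (dual_space V) (\<sigma> m \<ominus>\<^bsub>dual_space V\<^esub> \<sigma> n) \<le> e" "x \<in> carrier V" for e m n x
    proof -
      have "norm (\<sigma> m x - \<sigma> n x) \<le> vnorm (dual_space V) (\<sigma> m \<ominus>\<^bsub>dual_space V\<^esub> \<sigma> n) * vnorm V x"
        using functional.bound[OF fd[of m n] that(2)] s that(2) by (simp add: dual_minus)
      also have "\<dots> \<le> e * vnorm V x" using that by (intro mult_right_mono) auto
      finally show ?thesis .
    qed
    have "convergent (\<lambda>n. \<sigma> n x)" if x: "x \<in> carrier V" for x
    proof (rule Cauchy_convergent_scalar, rule CauchyI)
      fix e :: real assume e: "e > 0"
      \<comment> \<open>The summand 1 covers \<open>x = \<zero>\<close> and makes the final estimate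
        strict.\<close>
      define d where "d = e / (vnorm V x + 1)"
      have "d > 0" using e x by (simp add: d_def add_nonneg_pos)
      with C obtain N where N: "\<And>m n. m \<ge> N \<Longrightarrow> n \<ge> N \<Longrightarrow>
          vnorm (dual_space V) (\<sigma> m \<ominus>\<^bsub>dual_space V\<^esub> \<sigma> n) < d" by blast
      have "norm (\<sigma> m x - \<sigma> n x) < e" if "m \<ge> N" "n \<ge> N" for m n
      proof -
        have "norm (\<sigma> m x - \<sigma> n x) \<le> d * vnorm V x"
          using dle[OF less_imp_le[OF N[OF that]] x] .
        also have "\<dots> < d * (vnorm V x + 1)" using \<open>d > 0\<close> by simp
        also have "\<dots> = e" using vnorm_nonneg[OF x] by (simp add: d_def)
        finally show ?thesis .
      qed
      then show "\<exists>N. \<forall>m\<ge>N. \<forall>n\<ge>N. norm (\<sigma> m x - \<sigma> n x) < e" by blast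
    qed
    then obtain g where g: "\<And>x. x \<in> carrier V \<Longrightarrow> (\<lambda>n. \<sigma> n x) \<longlonglongrightarrow> g x"
      unfolding convergent_def by metis
    define l where "l = restrict g (carrier V)"
    \<comment> \<open>Let \<open>m\<close> tend to infinity in the Cauchy estimate. This gives both
      the boundedness of \<open>l\<close> and the convergence in norm.\<close>
    have close: "\<exists>N. \<forall>n\<ge>N. \<forall>x\<in>carrier V. norm (\<sigma> n x - l x) \<le> e * vnorm V x" if "e > 0" for e
    proof -
      from C that obtain N where N: "\<And>m n. m \<ge> N \<Longrightarrow> n \<ge> N \<Longrightarrow>
          vnorm (dual_space V) (\<sigma> m \<ominus>\<^bsub>dual_space V\<^esub> \<sigma> n) < e" by blast
      have "norm (\<sigma> n x - l x) \<le> e * vnorm V x" if "n \<ge> N" "x \<in> carrier V" for n x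
      proof (rule LIMSEQ_le_const2)
        show "(\<lambda>m. norm (\<sigma> n x - \<sigma> m x)) \<longlonglongrightarrow> norm (\<sigma> n x - l x)"
          using g[OF that(2)] that(2) by (simp add: l_def) (intro tendsto_intros)
        show "\<exists>N. \<forall>m\<ge>N. norm (\<sigma> n x - \<sigma> m x) \<le> e * vnorm V x"
          using dle[OF less_imp_le[OF N[OF that(1)]] that(2)] by blast
      qed
      then show ?thesis by blast
    qed
    obtain N where N: "\<And>x. x \<in> carrier V \<Longrightarrow> norm (\<sigma> N x - l x) \<le> 1 * vnorm V x"
      using close[of 1] by auto
    have l: "l \<in> bounded_operators V scalar_space"
    proof (rule bounded_operatorsI)
      fix x assume x: "x \<in> carrier V"
      have "norm (l x) \<le> norm (\<sigma> N x) + norm (\<sigma> N x - l x)"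
        by (metis norm_minus_commute norm_triangle_sub)
      also have "\<dots> \<le> op_norm V scalar_space (\<sigma> N) * vnorm V x + 1 * vnorm V x"
        by (intro add_mono functional.bound[OF f] N x)
      finally show "vnorm scalar_space (l x) \<le> (op_norm V scalar_space (\<sigma> N) + 1) * vnorm V x"
        by (simp add: distrib_right)
      show "l (a \<odot> x) = a \<odot>\<^bsub>scalar_space\<^esub> l x" for a
      proof (rule LIMSEQ_unique)
        show "(\<lambda>n. \<sigma> n (a \<odot> x)) \<longlonglongrightarrow> l (a \<odot> x)" using g[of "a \<odot> x"] x by (simp add: l_def)
        show "(\<lambda>n. \<sigma> n (a \<odot> x)) \<longlonglongrightarrow> a \<odot>\<^bsub>scalar_space\<^esub> l x"
          using tendsto_mult_left[OF g[OF x], of a] x by (simp add: l_def functional.linear[OF f])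
      qed
      fix y assume y: "y \<in> carrier V"
      show "l (x \<oplus> y) = l x \<oplus>\<^bsub>scalar_space\<^esub> l y"
      proof (rule LIMSEQ_unique)
        show "(\<lambda>n. \<sigma> n (x \<oplus> y)) \<longlonglongrightarrow> l (x \<oplus> y)" using g[of "x \<oplus> y"] x y by (simp add: l_def)
        show "(\<lambda>n. \<sigma> n (x \<oplus> y)) \<longlonglongrightarrow> l x \<oplus>\<^bsub>scalar_space\<^esub> l y"
          using tendsto_add[OF g[OF x] g[OF y]] x y by (simp add: l_def functional.linear[OF f])
      qed
    qed (auto simp: l_def)
    moreover have "(\<lambda>n. vnorm (dual_space V) (\<sigma> n \<ominus>\<^bsub>dual_space V\<^esub> l)) \<longlonglongrightarrow> 0"
    proof (rule LIMSEQ_I)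
      fix r :: real assume r: "r > 0"
      then obtain N where N: "\<And>n x. n \<ge> N \<Longrightarrow> x \<in> carrier V \<Longrightarrow> norm (\<sigma> n x - l x) \<le> r / 2 * vnorm V x"
        using close[of "r / 2"] by auto
      have "norm (vnorm (dual_space V) (\<sigma> n \<ominus>\<^bsub>dual_space V\<^esub> l) - 0) < r" if "n \<ge> N" for n
      proof -
        have "\<sigma> n \<ominus>\<^bsub>dual_space V\<^esub> l \<in> carrier (dual_space V)"
          using s l by (intro D.minus_closed) auto
        then interpret d: functional V "\<sigma> n \<ominus>\<^bsub>dual_space V\<^esub> l"
          by (intro functionalI[OF normed_space_axioms]) simp
        have "op_norm V scalar_space (\<sigma> n \<ominus>\<^bsub>dual_space V\<^esub> l) \<le> r / 2"
          using N[OF that] r s l by (intro d.leI) (auto simp: dual_minus)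
        then show ?thesis using d.op_norm_nonneg r by simp
      qed
      then show "\<exists>N. \<forall>n\<ge>N. norm (vnorm (dual_space V) (\<sigma> n \<ominus>\<^bsub>dual_space V\<^esub> l) - 0) < r" by blast
    qed
    ultimately show "\<exists>l\<in>carrier (dual_space V).
        (\<lambda>n. vnorm (dual_space V) (\<sigma> n \<ominus>\<^bsub>dual_space V\<^esub> l)) \<longlonglongrightarrow> 0"
      by auto
  qed
  then show ?thesis
    by (intro banach_space.intro banach_space_axioms.intro normed_space_dual)
qed

end

section \<open>The Hahn--Banach theorem\<close>

text \<open>A bound that holds for all pairs passes to the two infima independently. The sublinear
  functionals constructed below are pointwise infima, and this gives their subadditivity.\<close>

lemma le_cINF_add:
  fixes z :: real
  assumes "A \<noteq> {}" "B \<noteq> {}" "\<And>a b. a \<in> A \<Longrightarrow> b \<in> B \<Longrightarrow> z \<le> F a + G b"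
  shows "z \<le> (INF a\<in>A. F a) + (INF b\<in>B. G b)"
proof -
  have "z - F a \<le> (INF b\<in>B. G b)" if "a \<in> A" for a
    using assms(2) by (rule cINF_greatest) (use assms(3)[OF that] in \<open>auto simp: algebra_simps\<close>)
  then have "z - (INF b\<in>B. G b) \<le> (INF a\<in>A. F a)"
    using assms(1) by (intro cINF_greatest) (auto simp: algebra_simps)
  then show ?thesis by simp
qed

section \<open>Sublinear functionals and their linear minorants\<close>

context normed_space
begin

text \<open>Only real multiples occur, over either field. Homogeneity is demanded as an inequality,
  which is easy to verify for infima and improves itself to an equality by passing to
  \<open>1 / r\<close>. Extensionality makes the pointwise order antisymmetric, as Zorn's lemma
  requires.\<close>

definition sublinear :: "('v \<Rightarrow> real) \<Rightarrow> bool" where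
  "sublinear q \<longleftrightarrow> q \<in> extensional (carrier V) \<and>
    (\<forall>x\<in>carrier V. \<forall>y\<in>carrier V. q (x \<oplus> y) \<le> q x + q y) \<and>
    (\<forall>r>0. \<forall>x\<in>carrier V. q (of_real r \<odot> x) \<le> r * q x)"

lemma sublinearD:
  assumes "sublinear q"
  shows "q \<in> extensional (carrier V)"
    "\<And>x y. x \<in> carrier V \<Longrightarrow> y \<in> carrier V \<Longrightarrow> q (x \<oplus> y) \<le> q x + q y"
    "\<And>r x. r > 0 \<Longrightarrow> x \<in> carrier V \<Longrightarrow> q (of_real r \<odot> x) \<le> r * q x"
  using assms by (auto simp: sublinear_def)

lemma sublinear_smult:
  assumes q: "sublinear q" and "r > 0" and x: "x \<in> carrier V"
  shows "q (of_real r \<odot> x) = r * q x"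
proof (rule antisym)
  have "of_real (1 / r) \<odot> (of_real r \<odot> x) = x"
    using x \<open>r > 0\<close> by (simp flip: smult_mult)
  then have "q x \<le> (1 / r) * q (of_real r \<odot> x)"
    using sublinearD(3)[OF q, of "1 / r" "of_real r \<odot> x"] x \<open>r > 0\<close> by simp
  then show "r * q x \<le> q (of_real r \<odot> x)" using \<open>r > 0\<close> by (simp add: field_simps)
qed (rule sublinearD(3)[OF q \<open>r > 0\<close> x])

lemma sublinear_zero:
  assumes q: "sublinear q"
  shows "q \<zero> = 0"
  using sublinear_smult[OF q, of 2 "\<zero>"] by simp

lemma sublinear_uminus:
  assumes q: "sublinear q" and x: "x \<in> carrier V"
  shows "- q (\<ominus> x) \<le> q x"
  using sublinearD(2)[OF q x, of "\<ominus> x"] sublinear_zero[OF q] x by (simp add: M.r_neg)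

text \<open>Zorn's lemma for the reversed pointwise order \<open>P\<close>. A nonempty chain is
  bounded by its pointwise infimum, which is finite because
  \<open>- p (\<ominus> x) \<le> - q (\<ominus> x) \<le> q x\<close> for each sublinear
  \<open>q\<close> below \<open>p\<close>.\<close>

lemma minimal_sublinear:
  assumes p: "sublinear p"
  obtains q where "sublinear q" "\<And>x. x \<in> carrier V \<Longrightarrow> q x \<le> p x"
    "\<And>q'. sublinear q' \<Longrightarrow> (\<And>x. x \<in> carrier V \<Longrightarrow> q' x \<le> q x) \<Longrightarrow> q' = q"
proof -
  define A where "A = {q. sublinear q \<and> (\<forall>x\<in>carrier V. q x \<le> p x)}"
  define P where "P a b \<longleftrightarrow> (\<forall>x\<in>carrier V. b x \<le> a x)" for a b :: "'v \<Rightarrow> real"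
  have "\<exists>m\<in>A. \<forall>a\<in>A. P m a \<longrightarrow> a = m"
  proof (rule predicate_Zorn)
    have "a = b" if "a \<in> A" "b \<in> A" "P a b" "P b a" for a b
      using that by (intro extensionalityI[where A = "carrier V"])
        (auto simp: A_def P_def sublinear_def intro: antisym)
    moreover have "P a c" if "P a b" "P b c" for a b c
      using that unfolding P_def by (meson order_trans)
    moreover have "P a a" for a by (simp add: P_def)
    ultimately show "partial_order_on A (relation_of P A)"
      by (intro partial_order_on_relation_ofI) blast+
    fix Ch assume "Ch \<in> Chains (relation_of P A)"
    then have ch: "Ch \<subseteq> A" "\<And>a b. a \<in> Ch \<Longrightarrow> b \<in> Ch \<Longrightarrow> P a b \<or> P b a"
      by (auto simp: Chains_def relation_of_def)
    show "\<exists>u\<in>A. \<forall>a\<in>Ch. P a u"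
    proof (cases "Ch = {}")
      case True
      then show ?thesis using p by (auto simp: A_def)
    next
      case False
      define u where "u = (\<lambda>x\<in>carrier V. INF q\<in>Ch. q x)"
      have lower: "- p (\<ominus> x) \<le> q x" if "q \<in> Ch" "x \<in> carrier V" for q x
      proof -
        have "sublinear q" "q (\<ominus> x) \<le> p (\<ominus> x)" using that ch(1) by (auto simp: A_def)
        then show ?thesis using sublinear_uminus[of q x] that(2) by linarith
      qed
      have bdd: "bdd_below ((\<lambda>q. q x) ` Ch)" if "x \<in> carrier V" for x
        using lower that by (intro bdd_belowI2) auto
      have u_le: "u x \<le> q x" if "q \<in> Ch" "x \<in> carrier V" for q x
        using cINF_lower[OF bdd that(1)] that by (simp add: u_def)
      have "sublinear u"
        unfolding sublinear_def
      proof (intro conjI ballI allI impI)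
        show "u \<in> extensional (carrier V)" by (simp add: u_def)
        fix x assume x: "x \<in> carrier V"
        show "u (x \<oplus> y) \<le> u x + u y" if y: "y \<in> carrier V" for y
        proof -
          have "u (x \<oplus> y) \<le> a x + b y" if ab: "a \<in> Ch" "b \<in> Ch" for a b
          proof -
            \<comment> \<open>The smaller of \<open>a\<close> and \<open>b\<close>: comparability in
              the chain lets one functional serve both points.\<close>
            obtain c where c: "c \<in> Ch" "c x \<le> a x" "c y \<le> b y"
              using ch(2)[OF ab] ab x y unfolding P_def by blast
            have "u (x \<oplus> y) \<le> c x + c y"
              using u_le[OF c(1), of "x \<oplus> y"] sublinearD(2)[of c x y] c(1) ch(1) x y
              by (fastforce simp: A_def)
            with c show ?thesis by linarith
          qed
          then show ?thesis using x y le_cINF_add[OF False False] by (simp add: u_def)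
        qed
        show "u (of_real r \<odot> x) \<le> r * u x" if r: "r > 0" for r
        proof -
          have "u (of_real r \<odot> x) / r \<le> (INF q\<in>Ch. q x)"
          proof (rule cINF_greatest[OF False])
            fix q assume q: "q \<in> Ch"
            then have "u (of_real r \<odot> x) \<le> r * q x"
              using u_le[OF q, of "of_real r \<odot> x"] sublinearD(3)[of q r x] ch(1) x r
              by (fastforce simp: A_def)
            then show "u (of_real r \<odot> x) / r \<le> q x" using r by (simp add: field_simps)
          qed
          then show ?thesis using r x by (simp add: u_def field_simps)
        qed
      qed
      moreover have "u x \<le> p x" if x: "x \<in> carrier V" for x
      proof -
        obtain q where "q \<in> Ch" using False by blast
        then show ?thesis using u_le[OF _ x] ch(1) x by (force simp: A_def)
      qed
      ultimately show ?thesis using u_le by (auto simp: A_def P_def)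
    qed
  qed
  then obtain q where q: "q \<in> A" "\<And>a. a \<in> A \<Longrightarrow> P q a \<Longrightarrow> a = q" by blast
  show ?thesis
  proof (rule that[of q])
    fix q' assume q': "sublinear q'" and le: "\<And>x. x \<in> carrier V \<Longrightarrow> q' x \<le> q x"
    have "q' x \<le> p x" if "x \<in> carrier V" for x
      using le[OF that] q(1) that by (fastforce simp: A_def)
    then show "q' = q" using q' le by (intro q(2)) (auto simp: A_def P_def)
  qed (use q(1) in \<open>auto simp: A_def\<close>)
qed

text \<open>A minimal sublinear \<open>q\<close> is odd: the infimum of \<open>q (x + t z) - t q z\<close> over \<open>t \<ge> 0\<close> is
  sublinear in \<open>x\<close> and below \<open>q\<close>, and its value at \<open>- z\<close> is at most \<open>- q z\<close>.\<close>

lemma sublinear_dominates_linear: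
  assumes p: "sublinear p"
  obtains g where "\<And>x. x \<in> carrier V \<Longrightarrow> g x \<le> p x"
    "\<And>x y. x \<in> carrier V \<Longrightarrow> y \<in> carrier V \<Longrightarrow> g (x \<oplus> y) = g x + g y"
    "\<And>r x. x \<in> carrier V \<Longrightarrow> g (of_real r \<odot> x) = r * g x"
proof -
  obtain q where q: "sublinear q" "\<And>x. x \<in> carrier V \<Longrightarrow> q x \<le> p x"
    "\<And>q'. sublinear q' \<Longrightarrow> (\<And>x. x \<in> carrier V \<Longrightarrow> q' x \<le> q x) \<Longrightarrow> q' = q"
    using minimal_sublinear[OF p] by blast
  note sub = sublinearD(2)[OF q(1)]
  have odd: "q (\<ominus> z) = - q z" if z: "z \<in> carrier V" for z
  proof (rule antisym)
    define G where "G x t = q (x \<oplus> (of_real t \<odot> z)) - t * q z" for x and t :: real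
    define q' where "q' = (\<lambda>x\<in>carrier V. INF t\<in>{0..}. G x t)"
    have qz: "q (of_real t \<odot> z) = t * q z" if "t \<ge> 0" for t
    proof (cases "t = 0")
      case True
      then show ?thesis using z sublinear_zero[OF q(1)] by simp
    qed (use sublinear_smult[OF q(1) _ z] that in auto)
    \<comment> \<open>Finiteness of the infimum:
      \<open>t q z = q (t z) \<le> q (x + t z) + q (- x)\<close>.\<close>
    have lower: "- q (\<ominus> x) \<le> G x t" if "x \<in> carrier V" "t \<ge> 0" for x t
    proof -
      have "(x \<oplus> (of_real t \<odot> z)) \<oplus> (\<ominus> x) = of_real t \<odot> z"
        using that z by (simp add: M.a_ac M.r_neg1 M.r_neg2)
      then show ?thesis
        using sub[of "x \<oplus> (of_real t \<odot> z)" "\<ominus> x"] that z qz[OF that(2)] by (simp add: G_def)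
    qed
    have q'_le: "q' x \<le> G x t" if "x \<in> carrier V" "t \<ge> 0" for x t
      using that lower by (auto simp: q'_def intro!: cINF_lower bdd_belowI2[where m = "- q (\<ominus> x)"])
    have "sublinear q'"
      unfolding sublinear_def
    proof (intro conjI ballI allI impI)
      show "q' \<in> extensional (carrier V)" by (simp add: q'_def)
      fix x assume x: "x \<in> carrier V"
      show "q' (x \<oplus> y) \<le> q' x + q' y" if y: "y \<in> carrier V" for y
      proof -
        have *: "q' (x \<oplus> y) \<le> G x s + G y t" if "s \<in> {0..}" "t \<in> {0..}" for s t
        proof -
          \<comment> \<open>The parameters add up under sums and are scaled by \<open>r\<close>
            under multiples, so that the infimum inherits sublinearity from
            \<open>q\<close>.\<close>
          have "(x \<oplus> (of_real s \<odot> z)) \<oplus> (y \<oplus> (of_real t \<odot> z)) = (x \<oplus> y) \<oplus> (of_real (s + t) \<odot> z)"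
            using x y z by (simp add: M.a_ac smult_add_left)
          then have "G (x \<oplus> y) (s + t) \<le> G x s + G y t"
            using sub[of "x \<oplus> (of_real s \<odot> z)" "y \<oplus> (of_real t \<odot> z)"] x y z
            by (simp add: G_def distrib_right)
          then show ?thesis using q'_le[of "x \<oplus> y" "s + t"] that x y by simp
        qed
        have "q' (x \<oplus> y) \<le> (INF s\<in>{0..}. G x s) + (INF t\<in>{0..}. G y t)"
          by (rule le_cINF_add) (auto intro: *)
        then show ?thesis using x y by (simp add: q'_def)
      qed
      show "q' (of_real r \<odot> x) \<le> r * q' x" if r: "r > 0" for r
      proof -
        have "q' (of_real r \<odot> x) / r \<le> (INF t\<in>{0..}. G x t)"
        proof (rule cINF_greatest)
          fix t :: real assume t: "t \<in> {0..}"
          have "(of_real r \<odot> x) \<oplus> (of_real (r * t) \<odot> z) = of_real r \<odot> (x \<oplus> (of_real t \<odot> z))"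
            using x z by (simp add: smult_add_right smult_mult)
          then have "G (of_real r \<odot> x) (r * t) \<le> r * G x t"
            using sublinear_smult[OF q(1) r, of "x \<oplus> (of_real t \<odot> z)"] x z
            by (simp add: G_def algebra_simps)
          then have "q' (of_real r \<odot> x) \<le> r * G x t"
            using q'_le[of "of_real r \<odot> x" "r * t"] x r t by simp
          then show "q' (of_real r \<odot> x) / r \<le> G x t" using r by (simp add: field_simps)
        qed simp
        then show ?thesis using r x by (simp add: q'_def field_simps)
      qed
    qed
    moreover have "q' x \<le> q x" if "x \<in> carrier V" for x
      using q'_le[OF that, of 0] that z by (simp add: G_def)
    ultimately have "q' = q" by (rule q(3))
    then show "q (\<ominus> z) \<le> - q z"
      using q'_le[of "\<ominus> z" 1] z sublinear_zero[OF q(1)] by (simp add: G_def M.l_neg)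
    show "- q z \<le> q (\<ominus> z)"
      using sublinear_uminus[OF q(1) z] by simp
  qed
  show ?thesis
  proof (rule that[of q])
    fix x y assume x: "x \<in> carrier V" and y: "y \<in> carrier V"
    \<comment> \<open>Oddness turns \<open>q x \<le> q (x + y) + q (- y)\<close> into
      superadditivity.\<close>
    have "(x \<oplus> y) \<oplus> (\<ominus> y) = x" using x y by (simp add: M.a_ac M.r_neg)
    then show "q (x \<oplus> y) = q x + q y"
      using sub[OF x y] sub[of "x \<oplus> y" "\<ominus> y"] odd[OF y] x y by simp
  next
    fix r :: real and x assume x: "x \<in> carrier V"
    consider "r > 0" | "r = 0" | "- r > 0" by linarith
    then show "q (of_real r \<odot> x) = r * q x"
    proof cases
      case 3
      have "q (of_real (- r) \<odot> x) = (- r) * q x" by (rule sublinear_smult[OF q(1) 3 x])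
      moreover have "of_real r \<odot> x = \<ominus> (of_real (- r) \<odot> x)"
        using x by (simp add: smult_minus_left)
      ultimately show ?thesis using odd[of "of_real (- r) \<odot> x"] x by simp
    qed (use x sublinear_smult[OF q(1)] sublinear_zero[OF q(1)] in auto)
  qed (rule q(2))
qed

text \<open>The functional \<open>p\<close>, the infimal convolution of
  \<open>\<rho> \<circ> f\<close> on \<open>M\<close> with \<open>K\<close> times the norm, is
  sublinear and lies below both. A linear minorant \<open>g\<close> of \<open>p\<close> therefore
  extends \<open>\<rho> \<circ> f\<close> and is dominated by \<open>K\<close> times the norm; the
  scalar functional is then rebuilt from its real part \<open>g\<close>.\<close>

theorem hahn_banach:
  assumes M: "M \<subseteq> carrier V" "\<zero> \<in> M" "\<And>x y. x \<in> M \<Longrightarrow> y \<in> M \<Longrightarrow> x \<oplus> y \<in> M"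
      "\<And>a x. x \<in> M \<Longrightarrow> a \<odot> x \<in> M"
    and f: "\<And>x y. x \<in> M \<Longrightarrow> y \<in> M \<Longrightarrow> f (x \<oplus> y) = f x + f y"
      "\<And>a x. x \<in> M \<Longrightarrow> f (a \<odot> x) = a * f x"
      "\<And>x. x \<in> M \<Longrightarrow> norm (f x) \<le> K * vnorm V x"
    and K: "0 \<le> K"
  obtains F where "F \<in> bounded_operators V scalar_space" "\<And>x. x \<in> M \<Longrightarrow> F x = f x"
    "\<And>x. x \<in> carrier V \<Longrightarrow> norm (F x) \<le> K * vnorm V x"
proof -
  obtain \<rho> :: "'k \<Rightarrow> real" where add: "\<And>a b. \<rho> (a + b) = \<rho> a + \<rho> b"
    and sc: "\<And>r a. \<rho> (of_real r * a) = r * \<rho> a" and le: "\<And>a. \<bar>\<rho> a\<bar> \<le> norm a"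
    and re: "\<And>r. \<rho> (of_real r) = r"
    and D: "(\<forall>a. a = of_real (\<rho> a)) \<or>
     (\<exists>\<iota>. \<iota> * \<iota> = -1 \<and> \<rho> \<iota> = 0 \<and> (\<forall>a. a = of_real (\<rho> a) - \<iota> * of_real (\<rho> (\<iota> * a))))"
    by (rule scalar_decomposition) (rule that, assumption+)
  define G where "G x m = \<rho> (f m) + K * vnorm V (x \<ominus> m)" for x m
  define p where "p = (\<lambda>x\<in>carrier V. INF m\<in>M. G x m)"
  have Mne: "M \<noteq> {}" using M(2) by blast
  \<comment> \<open>Finiteness of the infimum; here the bound of \<open>f\<close> by
    \<open>K\<close> enters.\<close>
  have lower: "- K * vnorm V x \<le> G x m" if "x \<in> carrier V" "m \<in> M" for x m
  proof -
    have m: "m \<in> carrier V" using M(1) that by blast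
    have "vnorm V m \<le> vnorm V (x \<ominus> m) + vnorm V x"
      using vnorm_triangle[of "m \<ominus> x" x] that m minus_commute_vnorm[of m x] by simp
    then have "K * vnorm V m \<le> K * vnorm V (x \<ominus> m) + K * vnorm V x"
      using mult_left_mono[OF _ K] by (simp flip: distrib_left)
    moreover have "- (K * vnorm V m) \<le> \<rho> (f m)" using le[of "f m"] f(3)[OF that(2)] by linarith
    ultimately show ?thesis by (simp add: G_def)
  qed
  have p_le: "p x \<le> G x m" if "x \<in> carrier V" "m \<in> M" for x m
    using that lower by (auto simp: p_def intro!: cINF_lower bdd_belowI2[where m = "- K * vnorm V x"])
  have "sublinear p"
    unfolding sublinear_def
  proof (intro conjI ballI allI impI)
    show "p \<in> extensional (carrier V)" by (simp add: p_def)
    fix x assume x: "x \<in> carrier V"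
    show "p (x \<oplus> y) \<le> p x + p y" if y: "y \<in> carrier V" for y
    proof -
      have "p (x \<oplus> y) \<le> G x m + G y m'" if mm: "m \<in> M" "m' \<in> M" for m m'
      proof -
        have m: "m \<in> carrier V" "m' \<in> carrier V" using M(1) mm by blast+
        have "(x \<ominus> m) \<oplus> (y \<ominus> m') = (x \<oplus> y) \<ominus> (m \<oplus> m')"
          using x y m by (simp add: M.minus_eq M.minus_add M.a_ac)
        then have "K * vnorm V ((x \<oplus> y) \<ominus> (m \<oplus> m')) \<le> K * (vnorm V (x \<ominus> m) + vnorm V (y \<ominus> m'))"
          using vnorm_triangle[of "x \<ominus> m" "y \<ominus> m'"] x y m by (intro mult_left_mono[OF _ K]) simp
        then have "G (x \<oplus> y) (m \<oplus> m') \<le> G x m + G y m'"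
          by (simp add: G_def f(1)[OF mm] add distrib_left)
        then show ?thesis using p_le[of "x \<oplus> y" "m \<oplus> m'"] x y M(3)[OF mm] by simp
      qed
      then show ?thesis using x y le_cINF_add[OF Mne Mne] by (simp add: p_def)
    qed
    show "p (of_real r \<odot> x) \<le> r * p x" if r: "r > 0" for r
    proof -
      have "p (of_real r \<odot> x) / r \<le> (INF m\<in>M. G x m)"
      proof (rule cINF_greatest[OF Mne])
        fix m assume m: "m \<in> M"
        then have mc: "m \<in> carrier V" using M(1) by blast
        have "(of_real r \<odot> x) \<ominus> (of_real r \<odot> m) = of_real r \<odot> (x \<ominus> m)"
          using x mc by (simp add: M.minus_eq smult_add_right smult_minus_right)
        then have "G (of_real r \<odot> x) (of_real r \<odot> m) = r * G x m"
          using r x mc by (simp add: G_def f(2)[OF m] sc vnorm_smult algebra_simps)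
        then have "p (of_real r \<odot> x) \<le> r * G x m"
          using p_le[of "of_real r \<odot> x" "of_real r \<odot> m"] x M(4)[OF m] by simp
        then show "p (of_real r \<odot> x) / r \<le> G x m" using r by (simp add: field_simps)
      qed
      then show ?thesis using r x by (simp add: p_def field_simps)
    qed
  qed
  then obtain g where g: "\<And>x. x \<in> carrier V \<Longrightarrow> g x \<le> p x"
    "\<And>x y. x \<in> carrier V \<Longrightarrow> y \<in> carrier V \<Longrightarrow> g (x \<oplus> y) = g x + g y"
    "\<And>r x. x \<in> carrier V \<Longrightarrow> g (of_real r \<odot> x) = r * g x"
    using sublinear_dominates_linear by blast
  have gK: "g x \<le> K * vnorm V x" if "x \<in> carrier V" for x
  proof -
    have "f \<zero> = 0" using f(2)[OF M(2), of 0] by simp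
    moreover have "\<rho> 0 = 0" using re[of 0] by simp
    ultimately show ?thesis
      using g(1)[OF that] p_le[OF that M(2)] that minus_add_cancel(1)[of x "\<zero>"] by (simp add: G_def)
  qed
  have gneg: "g (\<ominus> x) = - g x" if "x \<in> carrier V" for x
    using g(3)[OF that, of "-1"] that by (simp add: smult_minus_one)
  \<comment> \<open>\<open>g \<le> \<rho> \<circ> f\<close> holds at \<open>m\<close> and at
    \<open>- m\<close>, and both sides are odd on \<open>M\<close>, so that the inequality is an
    equality.\<close>
  have gM: "g m = \<rho> (f m)" if "m \<in> M" for m
  proof -
    have *: "g m \<le> \<rho> (f m)" if "m \<in> M" for m
      using g(1)[of m] p_le[of m m] that M(1) by (auto simp: G_def)
    have mc: "m \<in> carrier V" using that M(1) by blast
    have "\<ominus> m \<in> M" using M(4)[OF that, of "-1"] mc by (simp add: smult_minus_one)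
    then have "g (\<ominus> m) \<le> \<rho> (f (\<ominus> m))" by (rule *)
    moreover have "\<rho> (f (\<ominus> m)) = - \<rho> (f m)"
      using f(2)[OF that, of "-1"] sc[of "-1" "f m"] mc by (simp add: smult_minus_one)
    ultimately show ?thesis using *[OF that] gneg[OF mc] by linarith
  qed
  have "\<exists>F. (\<forall>x\<in>carrier V. \<forall>y\<in>carrier V. F (x \<oplus> y) = F x + F y) \<and>
      (\<forall>a. \<forall>x\<in>carrier V. F (a \<odot> x) = a * F x) \<and>
      (\<forall>x\<in>carrier V. \<rho> (F x) = g x) \<and> (\<forall>m\<in>M. F m = f m)"
    using D
  proof
    assume *: "\<forall>a. a = of_real (\<rho> a)"
    have "of_real (g (a \<odot> x)) = a * of_real (g x)" if "x \<in> carrier V" for a x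
      using g(3)[OF that, of "\<rho> a"] * by (metis of_real_mult)
    then show ?thesis
      using * gM by (intro exI[of _ "\<lambda>x. of_real (g x)"]) (auto simp: g(2) re)
  next
    assume "\<exists>\<iota>. \<iota> * \<iota> = -1 \<and> \<rho> \<iota> = 0 \<and> (\<forall>a. a = of_real (\<rho> a) - \<iota> * of_real (\<rho> (\<iota> * a)))"
    then obtain \<iota> where i: "\<iota> * \<iota> = -1" "\<rho> \<iota> = 0"
      and dec: "\<And>a. a = of_real (\<rho> a) - \<iota> * of_real (\<rho> (\<iota> * a))" by blast
    \<comment> \<open>This is the decomposition of the scalar \<open>F x\<close>, in which
      \<open>\<rho> (F x)\<close> is to be \<open>g x\<close> and
      \<open>\<rho> (\<iota> F x)\<close> is to be \<open>g (\<iota> x)\<close>.\<close>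
    define F where "F x = of_real (g x) - \<iota> * of_real (g (\<iota> \<odot> x))" for x
    have Fadd: "F (x \<oplus> y) = F x + F y" if "x \<in> carrier V" "y \<in> carrier V" for x y
      using that by (simp add: F_def g(2) smult_add_right algebra_simps)
    have Freal: "F (of_real r \<odot> x) = of_real r * F x" if "x \<in> carrier V" for r x
    proof -
      have "\<iota> \<odot> (of_real r \<odot> x) = of_real r \<odot> (\<iota> \<odot> x)"
        using that by (simp flip: smult_mult add: mult.commute)
      then show ?thesis using that by (simp add: F_def g(3) algebra_simps)
    qed
    have Fi: "F (\<iota> \<odot> x) = \<iota> * F x" if "x \<in> carrier V" for x
    proof -
      have "\<iota> \<odot> (\<iota> \<odot> x) = \<ominus> x" using that i(1) by (simp flip: smult_mult add: smult_minus_one)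
      then have "F (\<iota> \<odot> x) = of_real (g (\<iota> \<odot> x)) + \<iota> * of_real (g x)"
        using that gneg by (simp add: F_def)
      also have "\<dots> = \<iota> * of_real (g x) - (\<iota> * \<iota>) * of_real (g (\<iota> \<odot> x))" using i(1) by simp
      finally show ?thesis by (simp add: F_def algebra_simps)
    qed
    have "F (a \<odot> x) = a * F x" if x: "x \<in> carrier V" for a x
    proof -
      define r s where "r = \<rho> a" and "s = - \<rho> (\<iota> * a)"
      have a: "a = of_real r + of_real s * \<iota>"
        by (rule trans[OF dec]) (simp add: r_def s_def)
      have "F (a \<odot> x) = F (of_real r \<odot> x) + F (of_real s \<odot> (\<iota> \<odot> x))"
        using x by (simp add: a smult_add_left smult_mult Fadd)
      then show ?thesis using x by (simp add: a Freal Fi algebra_simps)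
    qed
    moreover have "\<rho> (F x) = g x" for x
    proof -
      have "F x = of_real (g x) + of_real (- g (\<iota> \<odot> x)) * \<iota>" by (simp add: F_def)
      then show ?thesis by (simp only: add sc re i(2))
    qed
    moreover have "F m = f m" if "m \<in> M" for m
      using dec[of "f m"] gM[OF that] gM[OF M(4)[OF that, of \<iota>]] f(2)[OF that, of \<iota>]
      by (simp add: F_def)
    ultimately show ?thesis using Fadd by blast
  qed
  then obtain F where F: "\<And>x y. x \<in> carrier V \<Longrightarrow> y \<in> carrier V \<Longrightarrow> F (x \<oplus> y) = F x + F y"
    "\<And>a x. x \<in> carrier V \<Longrightarrow> F (a \<odot> x) = a * F x"
    "\<And>x. x \<in> carrier V \<Longrightarrow> \<rho> (F x) = g x" "\<And>m. m \<in> M \<Longrightarrow> F m = f m" by blast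
  have FK: "norm (F x) \<le> K * vnorm V x" if x: "x \<in> carrier V" for x
  proof (cases "F x = 0")
    case True
    then show ?thesis using K x by simp
  next
    case False
    \<comment> \<open>A rotation that makes the value at \<open>a x\<close> a nonnegative real, so
      that the real bound for \<open>g\<close> becomes a bound for
      \<open>norm (F x)\<close>.\<close>
    define a where "a = of_real (norm (F x)) / F x"
    have na: "norm a = 1" using False by (simp add: a_def norm_divide)
    have "F (a \<odot> x) = of_real (norm (F x))" using F(2)[OF x] False by (simp add: a_def)
    then have "norm (F x) = g (a \<odot> x)" using F(3)[of "a \<odot> x"] x re by simp
    also have "\<dots> \<le> K * vnorm V (a \<odot> x)" using x by (intro gK) simp
    finally show ?thesis using x by (simp add: vnorm_smult na)
  qed
  show ?thesis
  proof (rule that[of "restrict F (carrier V)"])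
    show "restrict F (carrier V) \<in> bounded_operators V scalar_space"
      by (rule bounded_operatorsI[where B = K]) (auto simp: F FK)
  qed (use F(4) FK M(1) in auto)
qed

text \<open>Hahn--Banach on the line through \<open>x\<close>. The bound is \<open>\<le> 1\<close>
  and not \<open>= 1\<close> because the trivial space has no functional of norm 1.\<close>

lemma norming_functional:
  assumes x: "x \<in> carrier V"
  obtains b where "b \<in> bounded_operators V scalar_space" "b x = of_real (vnorm V x)"
    "op_norm V scalar_space b \<le> 1"
proof -
  define M where "M = (\<lambda>c. c \<odot> x) ` UNIV"
  \<comment> \<open>The coefficient of \<open>m\<close> is unique unless \<open>x = \<zero>\<close>;
    in that case the factor \<open>vnorm V x = 0\<close> makes the choice immaterial.\<close>
  define f where "f m = (SOME c. m = c \<odot> x) * of_real (vnorm V x)" for m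
  have f: "f (c \<odot> x) = c * of_real (vnorm V x)" for c
  proof (cases "x = \<zero>")
    case False
    have "c = d" if "c \<odot> x = d \<odot> x" for d
    proof -
      have "(c - d) \<odot> x = \<zero>"
        using that x smult_add_left[OF x, of c "- d"]
        by (simp add: smult_minus_left M.r_neg)
      then have "norm (c - d) * vnorm V x = 0" using vnorm_smult[OF x, of "c - d"] by simp
      then show ?thesis using False x by (simp add: vnorm_eq_0_iff)
    qed
    then have "(SOME d. c \<odot> x = d \<odot> x) = c" by (intro some_equality) auto
    then show ?thesis by (simp add: f_def)
  qed (simp add: f_def)
  have M1: "M \<subseteq> carrier V" using x by (auto simp: M_def)
  have M2: "\<zero> \<in> M" using x by (auto simp: M_def image_iff intro!: exI[of _ 0])
  have M3: "m \<oplus> m' \<in> M \<and> f (m \<oplus> m') = f m + f m'" if "m \<in> M" "m' \<in> M" for m m'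
  proof -
    from that obtain c d where [simp]: "m = c \<odot> x" "m' = d \<odot> x" by (auto simp: M_def)
    have "m \<oplus> m' = (c + d) \<odot> x" using x by (simp add: smult_add_left)
    then show ?thesis by (auto simp add: f M_def distrib_right)
  qed
  have M4: "a \<odot> m \<in> M \<and> f (a \<odot> m) = a * f m" if "m \<in> M" for a m
  proof -
    from that obtain c where [simp]: "m = c \<odot> x" by (auto simp: M_def)
    have "a \<odot> m = (a * c) \<odot> x" using x by (simp add: smult_mult)
    then show ?thesis by (auto simp add: f M_def)
  qed
  have M5: "norm (f m) \<le> 1 * vnorm V m" if "m \<in> M" for m
    using that x by (auto simp: M_def f vnorm_smult norm_mult)
  obtain F where F: "F \<in> bounded_operators V scalar_space" "\<And>x. x \<in> M \<Longrightarrow> F x = f x"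
    "\<And>x. x \<in> carrier V \<Longrightarrow> norm (F x) \<le> 1 * vnorm V x"
    by (rule hahn_banach[OF M1 M2 conjunct1[OF M3] conjunct1[OF M4] conjunct2[OF M3] conjunct2[OF M4] M5
          zero_le_one]) (assumption | rule that)+
  interpret F: functional V F by (rule functionalI[OF normed_space_axioms F(1)])
  show ?thesis
  proof (rule that[OF F(1)])
    have "x \<in> M" using x by (auto simp: M_def image_iff intro!: exI[of _ 1])
    then show "F x = of_real (vnorm V x)" using F(2) f[of 1] x by simp
    show "op_norm V scalar_space F \<le> 1" using F(3) by (intro F.leI) auto
  qed
qed

end

section \<open>Common kernels of finitely many functionals\<close>

text \<open>Indices run from 1 as in the Gelfand numbers; \<open>k = 0\<close> gives the whole
  space, which is the base of the inductions below.\<close>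

definition common_kernel :: "('k::real_or_complex, 'v) normed_module \<Rightarrow> nat \<Rightarrow> (nat \<Rightarrow> 'v \<Rightarrow> 'k) \<Rightarrow> 'v set"
  where "common_kernel V k a = {x \<in> carrier V. \<forall>i\<in>{1..k}. a i x = 0}"

context normed_space
begin

lemma common_kernel_Suc:
  "common_kernel V (Suc k) a = {x \<in> common_kernel V k a. a (Suc k) x = 0}"
  by (auto simp: common_kernel_def atLeastAtMostSuc_conv)

lemma closed_subspace_common_kernel:
  assumes a: "\<And>i. i \<in> {1..k} \<Longrightarrow> a i \<in> bounded_operators V scalar_space"
  shows "closed_subspace (common_kernel V k a) V"
proof (rule closed_subspaceI)
  note fa = functionalI[OF normed_space_axioms a]
  show "common_kernel V k a \<subseteq> carrier V" by (auto simp: common_kernel_def)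
  show "\<zero> \<in> common_kernel V k a"
    using functional.linear(3)[OF fa] by (auto simp: common_kernel_def)
  show "x \<oplus> y \<in> common_kernel V k a" if "x \<in> common_kernel V k a" "y \<in> common_kernel V k a" for x y
    using that functional.linear(1)[OF fa] by (auto simp: common_kernel_def)
  show "c \<odot> x \<in> common_kernel V k a" if "x \<in> common_kernel V k a" for c x
    using that functional.linear(2)[OF fa] by (auto simp: common_kernel_def)
  show "l \<in> common_kernel V k a"
    if s: "\<And>n. \<sigma> n \<in> common_kernel V k a" and l: "l \<in> carrier V"
      and lim: "(\<lambda>n. vnorm V (\<sigma> n \<ominus> l)) \<longlonglongrightarrow> 0" for \<sigma> l
  proof -
    have "a i l = 0" if i: "i \<in> {1..k}" for i
    proof -
      have "norm (a i l) \<le> op_norm V scalar_space (a i) * vnorm V (\<sigma> n \<ominus> l)" for n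
        using functional.bound[OF fa[OF i], of "\<sigma> n \<ominus> l"] s[of n] l i
        by (simp add: functional.linear(4)[OF fa[OF i]] common_kernel_def)
      moreover have "(\<lambda>n. op_norm V scalar_space (a i) * vnorm V (\<sigma> n \<ominus> l)) \<longlonglongrightarrow> op_norm V scalar_space (a i) * 0"
        by (rule tendsto_mult_left[OF lim])
      ultimately have "norm (a i l) \<le> 0"
        by (intro LIMSEQ_le_const) auto
      then show ?thesis by simp
    qed
    then show ?thesis using l by (simp add: common_kernel_def)
  qed
qed

text \<open>The dichotomy behind the inductions over \<open>k\<close>: either the next functional
  adds nothing, or a normalised vector \<open>u\<close> of the previous kernel allows its value to
  be corrected without disturbing the earlier functionals.\<close>

lemma common_kernel_cases:
  assumes a: "\<And>i. i \<in> {1..Suc k} \<Longrightarrow> a i \<in> bounded_operators V scalar_space"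
  obtains "common_kernel V (Suc k) a = common_kernel V k a"
  | u where "u \<in> common_kernel V k a" "a (Suc k) u = 1"
proof (cases "\<forall>x\<in>common_kernel V k a. a (Suc k) x = 0")
  case True
  then show ?thesis using that(1) by (auto simp: common_kernel_Suc)
next
  case False
  then obtain x where x: "x \<in> common_kernel V k a" "a (Suc k) x \<noteq> 0" by blast
  interpret f: functional V "a (Suc k)" by (rule functionalI[OF normed_space_axioms a]) simp
  have "x \<in> carrier V" using x by (simp add: common_kernel_def)
  then have "a (Suc k) (inverse (a (Suc k) x) \<odot> x) = 1" using x(2) by (simp add: f.linear)
  moreover have "inverse (a (Suc k) x) \<odot> x \<in> common_kernel V k a"
    using x(1) a by (intro closed_subspaceD(4)[OF closed_subspace_common_kernel]) auto
  ultimately show ?thesis using that(2) by blast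
qed

text \<open>The quotient by the common kernel is finite-dimensional, so that the sum of the
  \<open>norm (a i x)\<close> dominates the distance to the kernel up to a constant. Elimination of
  one functional at a time proves this directly and updates the constant.\<close>

lemma common_kernel_approx:
  assumes "\<And>i. i \<in> {1..k} \<Longrightarrow> a i \<in> bounded_operators V scalar_space"
  shows "\<exists>C\<ge>0. \<forall>x\<in>carrier V. \<exists>y\<in>common_kernel V k a.
    vnorm V (x \<ominus> y) \<le> C * (\<Sum>i\<in>{1..k}. norm (a i x))"
  using assms
proof (induction k)
  case 0
  show ?case
  proof (intro exI[of _ 0] conjI ballI)
    show "\<exists>y\<in>common_kernel V 0 a. vnorm V (x \<ominus> y) \<le> 0 * (\<Sum>i\<in>{1..0}. norm (a i x))"
      if "x \<in> carrier V" for x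
      using that by (intro bexI[of _ x]) (auto simp: common_kernel_def)
  qed simp
next
  case (Suc k)
  then obtain C where C: "C \<ge> 0" "\<And>x. x \<in> carrier V \<Longrightarrow>
      \<exists>y\<in>common_kernel V k a. vnorm V (x \<ominus> y) \<le> C * (\<Sum>i\<in>{1..k}. norm (a i x))"
    by fastforce
  interpret f: functional V "a (Suc k)"
    by (rule functionalI[OF normed_space_axioms Suc.prems]) simp
  have sum: "(\<Sum>i\<in>{1..Suc k}. norm (a i x)) = (\<Sum>i\<in>{1..k}. norm (a i x)) + norm (a (Suc k) x)" for x
    by simp
  from Suc.prems consider "common_kernel V (Suc k) a = common_kernel V k a"
    | u where "u \<in> common_kernel V k a" "a (Suc k) u = 1"
    using common_kernel_cases by blast
  then show ?case
  proof cases
    case 1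
    have "C * (\<Sum>i\<in>{1..k}. norm (a i x)) \<le> C * (\<Sum>i\<in>{1..Suc k}. norm (a i x))" for x
      unfolding sum using C(1) by (intro mult_left_mono) auto
    moreover have "\<exists>y\<in>common_kernel V (Suc k) a. vnorm V (x \<ominus> y) \<le> C * (\<Sum>i\<in>{1..k}. norm (a i x))"
      if "x \<in> carrier V" for x
      using C(2)[OF that] 1 by simp
    ultimately show ?thesis using C(1) by (intro exI[of _ C]) (fast intro: order_trans)
  next
    case (2 u)
    define N where "N = op_norm V scalar_space (a (Suc k))"
    have N: "N \<ge> 0" by (simp add: N_def f.op_norm_nonneg)
    have u: "u \<in> carrier V" using 2 by (simp add: common_kernel_def)
    \<comment> \<open>The constant collects
      \<open>C s + (t + N C s) \<parallel>u\<parallel>\<close>, the bound for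
      \<open>\<parallel>x - z\<parallel>\<close> below, where \<open>s\<close> is the old sum and
      \<open>t\<close> the new summand.\<close>
    define D where "D = C + (1 + N * C) * vnorm V u"
    have "\<exists>y\<in>common_kernel V (Suc k) a. vnorm V (x \<ominus> y) \<le> D * (\<Sum>i\<in>{1..Suc k}. norm (a i x))"
      if x: "x \<in> carrier V" for x
    proof -
      define s where "s = (\<Sum>i\<in>{1..k}. norm (a i x))"
      define t where "t = norm (a (Suc k) x)"
      have st: "s \<ge> 0" "t \<ge> 0" by (auto simp: s_def t_def sum_nonneg)
      obtain y where y: "y \<in> common_kernel V k a" "vnorm V (x \<ominus> y) \<le> C * s"
        using C(2)[OF x] unfolding s_def by blast
      then have yc: "y \<in> carrier V" by (simp add: common_kernel_def)
      define c where "c = a (Suc k) y"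
      \<comment> \<open>\<open>u\<close> lies in the kernel of the first \<open>k\<close>
        functionals and \<open>a (Suc k) u = 1\<close>, so this correction of \<open>y\<close> kills
        the last functional and leaves the others zero.\<close>
      define z where "z = y \<ominus> (c \<odot> u)"
      have ker: "closed_subspace (common_kernel V k a) V"
        using Suc.prems by (intro closed_subspace_common_kernel) auto
      have "z \<in> common_kernel V k a"
        unfolding z_def M.minus_eq
        using closed_subspaceD(3,4,5)[OF ker] y(1) 2(1) by simp
      moreover have "a (Suc k) z = 0" using yc u by (simp add: z_def f.linear 2 c_def)
      ultimately have z: "z \<in> common_kernel V (Suc k) a" by (simp add: common_kernel_Suc)
      have "norm c \<le> t + norm (a (Suc k) (x \<ominus> y))"
        unfolding t_def c_def using x yc norm_triangle_sub[of "a (Suc k) y" "a (Suc k) x"]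
        by (simp add: f.linear norm_minus_commute)
      also have "\<dots> \<le> t + N * (C * s)"
        using f.bound[of "x \<ominus> y"] mult_left_mono[OF y(2) N] x yc by (simp add: N_def)
      finally have c: "norm c \<le> t + N * (C * s)" .
      have "x \<ominus> z = (x \<ominus> y) \<oplus> (c \<odot> u)"
        using x yc u by (simp add: z_def M.minus_eq M.minus_add M.a_ac)
      then have "vnorm V (x \<ominus> z) \<le> vnorm V (x \<ominus> y) + norm c * vnorm V u"
        using vnorm_triangle[of "x \<ominus> y" "c \<odot> u"] x yc u by (simp add: vnorm_smult)
      also have "\<dots> \<le> C * s + (t + N * (C * s)) * vnorm V u"
        using y(2) c u by (intro add_mono mult_right_mono) auto
      also have "\<dots> \<le> D * (s + t)"
        using C(1) N st vnorm_nonneg[OF u] by (simp add: D_def algebra_simps)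
      finally show ?thesis using z by (auto simp: sum s_def t_def)
    qed
    moreover have "D \<ge> 0" using C(1) N u by (simp add: D_def)
    ultimately show ?thesis by blast
  qed
qed

text \<open>Neither boundedness nor extensionality is demanded, so that differences such as
  \<open>b (T x) - b (S x)\<close> qualify as they stand.\<close>

definition linear_functional :: "('v \<Rightarrow> 'k) \<Rightarrow> bool" where
  "linear_functional f \<longleftrightarrow>
    (\<forall>x\<in>carrier V. \<forall>y\<in>carrier V. f (x \<oplus> y) = f x + f y) \<and>
    (\<forall>c. \<forall>x\<in>carrier V. f (c \<odot> x) = c * f x)"

text \<open>Gaussian elimination: for independent \<open>a i\<close> the construction yields a dual
  system, \<open>a i (u j)\<close> being 1 for \<open>i = j\<close> and 0 otherwise, and a redundant
  functional gets the vector \<open>\<zero>\<close>. The \<open>u i\<close> are quantified before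
  \<open>f\<close>, so that the same vectors serve all functionals.\<close>

lemma common_kernel_span_ex:
  assumes "\<And>i. i \<in> {1..k} \<Longrightarrow> a i \<in> bounded_operators V scalar_space"
  shows "\<exists>u. (\<forall>i\<in>{1..k}. u i \<in> carrier V) \<and>
    (\<forall>f. linear_functional f \<longrightarrow>
         (\<forall>x\<in>common_kernel V k a. f x = 0) \<longrightarrow>
         (\<forall>x\<in>carrier V. f x = (\<Sum>i\<in>{1..k}. f (u i) * a i x)))"
  using assms
proof (induction k)
  case 0
  show ?case by (auto simp: common_kernel_def)
next
  case (Suc k)
  have "a i \<in> bounded_operators V scalar_space" if "i \<in> {1..k}" for i
    using Suc.prems that by auto
  from Suc.IH[OF this] have "\<exists>u. (\<forall>i\<in>{1..k}. u i \<in> carrier V) \<and> (\<forall>f. linear_functional f \<longrightarrow>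
         (\<forall>x\<in>common_kernel V k a. f x = 0) \<longrightarrow>
         (\<forall>x\<in>carrier V. f x = (\<Sum>i\<in>{1..k}. f (u i) * a i x)))"
    .
  then obtain u where u: "\<forall>i\<in>{1..k}. u i \<in> carrier V"
    and span0: "\<forall>f. linear_functional f \<longrightarrow> (\<forall>x\<in>common_kernel V k a. f x = 0) \<longrightarrow>
         (\<forall>x\<in>carrier V. f x = (\<Sum>i\<in>{1..k}. f (u i) * a i x))"
    by (elim exE conjE) (rule that)
  note u = u[rule_format]
  have span: "f x = (\<Sum>i\<in>{1..k}. f (u i) * a i x)"
    if "linear_functional f" "\<And>x. x \<in> common_kernel V k a \<Longrightarrow> f x = 0" "x \<in> carrier V" for f x
    using span0[rule_format, OF that] .
  interpret g: functional V "a (Suc k)"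
    by (rule functionalI[OF normed_space_axioms Suc.prems]) simp
  have "\<exists>v. (\<forall>i\<in>{1..Suc k}. v i \<in> carrier V) \<and> (\<forall>f. linear_functional f \<longrightarrow>
         (\<forall>x\<in>common_kernel V (Suc k) a. f x = 0) \<longrightarrow>
         (\<forall>x\<in>carrier V. f x = (\<Sum>i\<in>{1..Suc k}. f (v i) * a i x)))"
  proof -
    from Suc.prems consider "common_kernel V (Suc k) a = common_kernel V k a"
      | w where "w \<in> common_kernel V k a" "a (Suc k) w = 1"
      using common_kernel_cases by blast
    then show ?thesis
    proof cases
      case 1
      have "f x = (\<Sum>i\<in>{1..Suc k}. f ((u(Suc k := \<zero>)) i) * a i x)"
        if f: "linear_functional f" "\<forall>x\<in>common_kernel V (Suc k) a. f x = 0" and x: "x \<in> carrier V" for f x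
      proof -
        have "f \<zero> = 0" using f(1) unfolding linear_functional_def by (metis M.zero_closed mult_zero_left smult_zero)
        moreover have "(\<Sum>i\<in>{1..k}. f ((u(Suc k := \<zero>)) i) * a i x) = (\<Sum>i\<in>{1..k}. f (u i) * a i x)"
          by (intro sum.cong) auto
        ultimately show ?thesis using span[OF f(1) _ x] f(2) 1 by simp
      qed
      then show ?thesis using u by (intro exI[of _ "u(Suc k := \<zero>)"]) (auto simp: le_Suc_eq)
    next
      case (2 w)
      have w: "w \<in> carrier V" using 2 by (simp add: common_kernel_def)
      \<comment> \<open>Subtracting the multiple of \<open>w\<close> makes \<open>a (Suc k)\<close>
        vanish at each earlier vector; the values of the earlier functionals do not change, since
        \<open>w\<close> lies in their kernel.\<close>
      define v where "v i = (if i = Suc k then w else u i \<ominus> (a (Suc k) (u i) \<odot> w))" for i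
      have "f x = (\<Sum>i\<in>{1..Suc k}. f (v i) * a i x)"
        if f: "linear_functional f" "\<forall>x\<in>common_kernel V (Suc k) a. f x = 0" and x: "x \<in> carrier V" for f x
      proof -
        have fdiff: "f (y \<ominus> (c \<odot> w)) = f y - c * f w" if "y \<in> carrier V" for y c
        proof -
          have "y \<ominus> (c \<odot> w) = y \<oplus> ((- c) \<odot> w)" using w by (simp add: M.minus_eq smult_minus_left)
          then show ?thesis using f(1) that w by (simp add: linear_functional_def)
        qed
        \<comment> \<open>\<open>f'\<close> vanishes on the kernel of the first \<open>k\<close>
          functionals, so that the induction hypothesis applies to it, and its coefficients
          \<open>f' (u i)\<close> are the desired \<open>f (v i)\<close>.\<close>
        define f' where "f' y = f y - f w * a (Suc k) y" for y
        have "linear_functional f'" using f(1) unfolding linear_functional_def by (simp add: f'_def g.linear algebra_simps)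
        moreover have "f' y = 0" if y: "y \<in> common_kernel V k a" for y
        proof -
          have yc: "y \<in> carrier V" using y by (simp add: common_kernel_def)
          have ker: "closed_subspace (common_kernel V k a) V"
            using Suc.prems by (intro closed_subspace_common_kernel) auto
          have "y \<ominus> (a (Suc k) y \<odot> w) \<in> common_kernel V k a"
            unfolding M.minus_eq using closed_subspaceD(3,4,5)[OF ker] y 2(1) by simp
          then have "y \<ominus> (a (Suc k) y \<odot> w) \<in> common_kernel V (Suc k) a"
            using yc w by (simp add: common_kernel_Suc g.linear 2)
          then have "f (y \<ominus> (a (Suc k) y \<odot> w)) = 0" using f(2) by blast
          then show ?thesis using fdiff[OF yc] by (simp add: f'_def mult.commute)
        qed
        ultimately have "f' x = (\<Sum>i\<in>{1..k}. f' (u i) * a i x)" using span x by blast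
        moreover have "f' (u i) = f (v i)" if "i \<in> {1..k}" for i
          using that u[OF that] fdiff by (auto simp: f'_def v_def mult.commute)
        ultimately have "f' x = (\<Sum>i\<in>{1..k}. f (v i) * a i x)" by simp
        then show ?thesis by (simp add: f'_def v_def algebra_simps)
      qed
      moreover have "v i \<in> carrier V" if "i \<in> {1..Suc k}" for i
        using that u w by (auto simp: v_def)
      ultimately show ?thesis by blast
    qed
  qed
  then show ?case .
qed

lemma common_kernel_span:
  fixes k :: nat
  assumes "\<And>i. i \<in> {1..k} \<Longrightarrow> a i \<in> bounded_operators V scalar_space"
  obtains u where "\<And>i. i \<in> {1..k} \<Longrightarrow> u i \<in> carrier V"
    "\<And>f x. linear_functional f \<Longrightarrow> \<forall>x\<in>common_kernel V k a. f x = 0 \<Longrightarrow>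
      x \<in> carrier V \<Longrightarrow> f x = (\<Sum>i\<in>{1..k}. f (u i) * a i x)"
proof -
  have "\<exists>u. (\<forall>i\<in>{1..k}. u i \<in> carrier V) \<and>
    (\<forall>f. linear_functional f \<longrightarrow> (\<forall>x\<in>common_kernel V k a. f x = 0) \<longrightarrow>
         (\<forall>x\<in>carrier V. f x = (\<Sum>i\<in>{1..k}. f (u i) * a i x)))"
    by (rule common_kernel_span_ex) (rule assms)
  then obtain u where "\<forall>i\<in>{1..k}. u i \<in> carrier V"
    and "\<forall>f. linear_functional f \<longrightarrow> (\<forall>x\<in>common_kernel V k a. f x = 0) \<longrightarrow>
         (\<forall>x\<in>carrier V. f x = (\<Sum>i\<in>{1..k}. f (u i) * a i x))"
    by (elim exE conjE) (rule that)
  then show ?thesis by (intro that[of u]) simp_all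
qed

text \<open>\<open>F\<close> is linear for the operations of the record \<open>dual_space V\<close>,
  whereas the combination is given pointwise. Removing one summand at a time, inside the dual space,
  bridges the two.\<close>

lemma dual_functional_vanishes_on_span:
  fixes k :: nat
  assumes F: "F \<in> bounded_operators (dual_space V) scalar_space"
    and "\<And>i. i \<in> {1..k} \<Longrightarrow> \<phi> i \<in> bounded_operators V scalar_space \<and> F (\<phi> i) = 0"
    and "\<xi> \<in> bounded_operators V scalar_space"
    and "\<And>x. x \<in> carrier V \<Longrightarrow> \<xi> x = (\<Sum>i\<in>{1..k}. c i * \<phi> i x)"
  shows "F \<xi> = 0"
  using assms(2-)
proof (induction k arbitrary: \<xi>)
  case 0
  interpret F: functional "dual_space V" F by (rule functionalI[OF normed_space_dual F])
  have "\<xi> = \<zero>\<^bsub>dual_space V\<^esub>"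
    using 0 bounded_operatorsD(2)[OF 0(2)] by (auto simp: fun_eq_iff extensional_def)
  then have "F \<xi> = F \<zero>\<^bsub>dual_space V\<^esub>" by (rule arg_cong)
  also have "\<dots> = 0" using F.zero by (simp only: scalar_space_simps)
  finally show ?case .
next
  case (Suc k)
  interpret F: functional "dual_space V" F by (rule functionalI[OF normed_space_dual F])
  have phi: "\<phi> (Suc k) \<in> bounded_operators V scalar_space" "F (\<phi> (Suc k)) = 0"
    using Suc.prems(1)[of "Suc k"] by auto
  define \<psi> where "\<psi> = c (Suc k) \<odot>\<^bsub>dual_space V\<^esub> \<phi> (Suc k)"
  have psi: "\<psi> \<in> bounded_operators V scalar_space" "F \<psi> = 0"
    using dual_smult[OF phi(1)] F.linear(2)[of "\<phi> (Suc k)" "c (Suc k)"] phi by (auto simp: \<psi>_def)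
  have d: "\<xi> \<ominus>\<^bsub>dual_space V\<^esub> \<psi> \<in> bounded_operators V scalar_space"
    using F.V.minus_closed[of \<xi> \<psi>] Suc.prems(2) psi(1) by simp
  have "F (\<xi> \<ominus>\<^bsub>dual_space V\<^esub> \<psi>) = 0"
  proof (rule Suc.IH)
    show "(\<xi> \<ominus>\<^bsub>dual_space V\<^esub> \<psi>) x = (\<Sum>i\<in>{1..k}. c i * \<phi> i x)" if "x \<in> carrier V" for x
      unfolding dual_minus[OF Suc.prems(2) psi(1)]
      using that Suc.prems(3)[OF that] by (simp add: \<psi>_def)
  qed (use Suc.prems(1) d in auto)
  then show ?case using F.linear(4)[of \<xi> \<psi>] Suc.prems(2) psi by simp
qed

end

lemma (in functional) linear_functional: "V.linear_functional f"
  by (simp add: V.linear_functional_def linear)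

text \<open>The functionals enter the definition of the Gelfand numbers only through their common kernel,
  since they can be multiplied by large constants.\<close>

lemma gelfand_number_common_kernel:
  fixes V :: "('k::real_or_complex, 'v) normed_module"
  assumes V: "normed_space V" and W: "normed_space W" and R: "R \<in> bounded_operators V W"
  shows "gelfand_number V W n R =
    Inf {\<epsilon>. \<epsilon> > 0 \<and> (\<exists>k<n. \<exists>a. (\<forall>i\<in>{1..k}. a i \<in> bounded_operators V scalar_space) \<and>
      (\<forall>x\<in>common_kernel V k a. vnorm W (R x) \<le> \<epsilon> * vnorm V x))}"
proof -
  interpret R: bounded_op V W R by (rule bounded_opI[OF V W R])
  have "(\<exists>a. (\<forall>i\<in>{1..k}. a i \<in> carrier (dual_space V)) \<and>
          (\<forall>x\<in>carrier V. vnorm W (R x) \<le>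
             (if k = 0 then 0 else SUP i\<in>{1..k}. norm (a i x)) + \<epsilon> * vnorm V x)) \<longleftrightarrow>
        (\<exists>a. (\<forall>i\<in>{1..k}. a i \<in> bounded_operators V scalar_space) \<and>
          (\<forall>x\<in>common_kernel V k a. vnorm W (R x) \<le> \<epsilon> * vnorm V x))" (is "?l \<longleftrightarrow> ?r")
    if "\<epsilon> > 0" for \<epsilon> and k :: nat
  proof
    assume ?l
    then obtain a where a: "\<forall>i\<in>{1..k}. a i \<in> carrier (dual_space V)"
      and le: "\<And>x. x \<in> carrier V \<Longrightarrow> vnorm W (R x) \<le>
             (if k = 0 then 0 else SUP i\<in>{1..k}. norm (a i x)) + \<epsilon> * vnorm V x" by blast
    have "vnorm W (R x) \<le> \<epsilon> * vnorm V x" if "x \<in> common_kernel V k a" for x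
    proof -
      have "(\<lambda>i. norm (a i x)) ` {1..k} \<subseteq> {0}" using that by (auto simp: common_kernel_def)
      then have "(\<lambda>i. norm (a i x)) ` {1..k} = {0}" if "k \<noteq> 0"
        using that by (simp add: subset_singleton_iff)
      then show ?thesis using le[of x] that by (auto simp: common_kernel_def split: if_splits)
    qed
    then show ?r using a by auto
  next
    assume ?r
    then obtain a where a: "\<And>i. i \<in> {1..k} \<Longrightarrow> a i \<in> bounded_operators V scalar_space"
      and le: "\<And>x. x \<in> common_kernel V k a \<Longrightarrow> vnorm W (R x) \<le> \<epsilon> * vnorm V x" by blast
    show ?l
    proof (cases "k = 0")
      case True
      then show ?thesis using le by (auto simp: common_kernel_def)
    next
      case False
      obtain C where C: "C \<ge> 0" "\<And>x. x \<in> carrier V \<Longrightarrow>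
          \<exists>y\<in>common_kernel V k a. vnorm V (x \<ominus>\<^bsub>V\<^esub> y) \<le> C * (\<Sum>i\<in>{1..k}. norm (a i x))"
        using R.V.common_kernel_approx[of k a] a by blast
      define N where "N = op_norm V W R"
      have N: "N \<ge> 0" by (simp add: N_def R.op_norm_nonneg)
      \<comment> \<open>With \<open>y\<close> in the kernel close to \<open>x\<close>,
        \<open>\<parallel>R x\<parallel> \<le> N \<parallel>x - y\<parallel> + \<epsilon>
        (\<parallel>x\<parallel> + \<parallel>x - y\<parallel>)\<close>, so that
        \<open>N + \<epsilon>\<close> times the distance bounds the excess over
        \<open>\<epsilon> \<parallel>x\<parallel>\<close>.\<close>
      define D where "D = (N + \<epsilon>) * C"
      have D: "D \<ge> 0" using N C \<open>\<epsilon> > 0\<close> by (simp add: D_def)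
      \<comment> \<open>The factor \<open>k\<close> compensates for the passage from a sum of
        \<open>k\<close> terms to a supremum.\<close>
      define a' where "a' i = (\<lambda>x\<in>carrier V. of_real (D * k) * a i x)" for i
      have "vnorm W (R x) \<le> (SUP i\<in>{1..k}. norm (a' i x)) + \<epsilon> * vnorm V x" if x: "x \<in> carrier V" for x
      proof -
        define S where "S = (SUP i\<in>{1..k}. norm (a' i x))"
        have "D * (\<Sum>i\<in>{1..k}. norm (a i x)) = (\<Sum>i\<in>{1..k}. D * norm (a i x))"
          by (rule sum_distrib_left)
        also have "\<dots> \<le> of_nat (card {1..k}) * (S / k)"
        proof (rule sum_bounded_above)
          fix i assume i: "i \<in> {1..k}"
          have "norm (a' i x) \<le> S" unfolding S_def using i by (intro cSUP_upper) auto
          then show "D * norm (a i x) \<le> S / k"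
            using False x D by (simp add: a'_def norm_mult field_simps)
        qed
        also have "\<dots> = S" using False by simp
        finally have DS: "D * (\<Sum>i\<in>{1..k}. norm (a i x)) \<le> S" .
        obtain y where y: "y \<in> common_kernel V k a"
          "vnorm V (x \<ominus>\<^bsub>V\<^esub> y) \<le> C * (\<Sum>i\<in>{1..k}. norm (a i x))" using C(2)[OF x] by blast
        have yc: "y \<in> carrier V" using y by (simp add: common_kernel_def)
        have "vnorm W (R x) \<le> vnorm W (R (x \<ominus>\<^bsub>V\<^esub> y)) + vnorm W (R y)"
          using R.W.vnorm_triangle[of "R (x \<ominus>\<^bsub>V\<^esub> y)" "R y"] R.add[of "x \<ominus>\<^bsub>V\<^esub> y" y] x yc by simp
        also have "\<dots> \<le> N * vnorm V (x \<ominus>\<^bsub>V\<^esub> y) + \<epsilon> * vnorm V y"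
          unfolding N_def using x yc le[OF y(1)] by (intro add_mono R.norm_bound) auto
        also have "vnorm V y \<le> vnorm V x + vnorm V (x \<ominus>\<^bsub>V\<^esub> y)"
          using R.V.vnorm_triangle[of "y \<ominus>\<^bsub>V\<^esub> x" x] x yc by (simp add: R.V.minus_commute_vnorm[of y x])
        also have "N * vnorm V (x \<ominus>\<^bsub>V\<^esub> y) + \<epsilon> * (vnorm V x + vnorm V (x \<ominus>\<^bsub>V\<^esub> y))
            = (N + \<epsilon>) * vnorm V (x \<ominus>\<^bsub>V\<^esub> y) + \<epsilon> * vnorm V x" by (simp add: algebra_simps)
        also have "(N + \<epsilon>) * vnorm V (x \<ominus>\<^bsub>V\<^esub> y) \<le> D * (\<Sum>i\<in>{1..k}. norm (a i x))"
          unfolding D_def mult.assoc using y(2) N \<open>\<epsilon> > 0\<close> by (intro mult_left_mono) auto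
        finally show ?thesis using DS \<open>\<epsilon> > 0\<close> by (simp add: S_def)
      qed
      moreover have "a' i \<in> carrier (dual_space V)" if "i \<in> {1..k}" for i
        using R.V.dual_smult(1)[OF a[OF that]] by (simp add: a'_def)
      ultimately show ?thesis using False by (intro exI[of _ a']) auto
    qed
  qed
  then show ?thesis unfolding gelfand_number_def by (intro arg_cong[where f = Inf] Collect_cong) blast
qed

section \<open>The bidual\<close>

definition evaluation :: "('k::real_or_complex, 'v) normed_module \<Rightarrow> 'v \<Rightarrow> ('v \<Rightarrow> 'k) \<Rightarrow> 'k" where
  "evaluation V x = (\<lambda>b\<in>bounded_operators V scalar_space. b x)"

context normed_space
begin

lemma evaluation_bounded:
  assumes x: "x \<in> carrier V"
  shows "evaluation V x \<in> bounded_operators (dual_space V) scalar_space"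
proof (rule bounded_operatorsI[where B = "vnorm V x"])
  fix b assume "b \<in> carrier (dual_space V)"
  then interpret b: functional V b by (intro functionalI[OF normed_space_axioms]) simp
  show "vnorm scalar_space (evaluation V x b) \<le> vnorm V x * vnorm (dual_space V) b"
    using b.bound[OF x] b.bounded by (simp add: evaluation_def mult.commute)
qed (use x in \<open>auto simp: evaluation_def dual_add dual_smult\<close>)

text \<open>A norming functional of \<open>x\<close> gives the lower bound; this is where the
  isometry of the embedding into the bidual rests on Hahn--Banach.\<close>

lemma op_norm_evaluation:
  assumes x: "x \<in> carrier V"
  shows "op_norm (dual_space V) scalar_space (evaluation V x) = vnorm V x"
proof (rule antisym)
  interpret e: functional "dual_space V" "evaluation V x"
    by (rule functionalI[OF normed_space_dual evaluation_bounded[OF x]])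
  show "op_norm (dual_space V) scalar_space (evaluation V x) \<le> vnorm V x"
  proof (rule e.leI)
    fix b assume b: "b \<in> carrier (dual_space V)"
    then interpret b: functional V b by (intro functionalI[OF normed_space_axioms]) simp
    show "norm (evaluation V x b) \<le> vnorm V x * vnorm (dual_space V) b"
      using b.bound[OF x] b.bounded by (simp add: evaluation_def mult.commute)
  qed (use x in simp)
  obtain b where b: "b \<in> bounded_operators V scalar_space" "b x = of_real (vnorm V x)"
    "op_norm V scalar_space b \<le> 1" using norming_functional[OF x] by blast
  have "vnorm V x = norm (evaluation V x b)" using b x by (simp add: evaluation_def)
  also have "\<dots> \<le> op_norm (dual_space V) scalar_space (evaluation V x) * op_norm V scalar_space b"
    using e.bound[of b] b(1) by simp
  also have "\<dots> \<le> op_norm (dual_space V) scalar_space (evaluation V x) * 1"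
    using b(3) e.op_norm_nonneg by (rule mult_left_mono)
  finally show "vnorm V x \<le> op_norm (dual_space V) scalar_space (evaluation V x)" by simp
qed

lemma evaluation_add:
  assumes "x \<in> carrier V" "y \<in> carrier V"
  shows "evaluation V (x \<oplus> y) = evaluation V x \<oplus>\<^bsub>dual_space (dual_space V)\<^esub> evaluation V y"
  using assms bounded_operatorsD(3)[of _ V scalar_space]
  by (auto simp: evaluation_def fun_eq_iff)

lemma evaluation_smult:
  assumes "x \<in> carrier V"
  shows "evaluation V (c \<odot> x) = c \<odot>\<^bsub>dual_space (dual_space V)\<^esub> evaluation V x"
  using assms bounded_operatorsD(4)[of _ V scalar_space]
  by (auto simp: evaluation_def fun_eq_iff)

lemma evaluation_op:
  "bounded_op V (dual_space (dual_space V)) (restrict (evaluation V) (carrier V))"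
proof (rule bounded_opI[OF normed_space_axioms normed_space.normed_space_dual[OF normed_space_dual]])
  show "restrict (evaluation V) (carrier V) \<in> bounded_operators V (dual_space (dual_space V))"
    using evaluation_bounded
    by (intro bounded_operatorsI[where B = 1])
      (auto simp: evaluation_add evaluation_smult op_norm_evaluation simp del: dual_simps(4,5))
qed

lemma evaluation_inj:
  assumes x: "x \<in> carrier V" and zero: "\<And>b. b \<in> bounded_operators V scalar_space \<Longrightarrow> b x = 0"
  shows "x = \<zero>"
proof -
  obtain b where b: "b \<in> bounded_operators V scalar_space" "b x = of_real (vnorm V x)"
    using norming_functional[OF x] by blast
  then have "vnorm V x = 0" using zero[OF b(1)] by simp
  then show ?thesis using x by (simp add: vnorm_eq_0_iff)
qed

end

section \<open>Transport of test spaces\<close>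

text \<open>An isometric copy of \<open>V\<close> on the type \<open>'u\<close>. The metric
  properties speak about test spaces on one fixed type, and \<open>h\<close> moves a given space
  there. The operations go back through \<open>inv_into\<close>, which is meaningful when
  \<open>h\<close> is injective on the carrier.\<close>

definition transport ::
    "('v \<Rightarrow> 'u) \<Rightarrow> ('k::real_or_complex, 'v) normed_module \<Rightarrow> ('k, 'u) normed_module" where
  "transport h V =
     \<lparr>carrier = h ` carrier V, mult = undefined, one = undefined, zero = h \<zero>\<^bsub>V\<^esub>,
      add = (\<lambda>u v. h (inv_into (carrier V) h u \<oplus>\<^bsub>V\<^esub> inv_into (carrier V) h v)),
      smult = (\<lambda>a u. h (a \<odot>\<^bsub>V\<^esub> inv_into (carrier V) h u)),
      vnorm = (\<lambda>u. vnorm V (inv_into (carrier V) h u))\<rparr>"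

locale transported = normed_space V for V :: "('k::real_or_complex, 'v) normed_module" (structure) +
  fixes h :: "'v \<Rightarrow> 'u"
  assumes inj: "inj_on h (carrier V)"
begin

lemma transport_simps [simp]:
  "carrier (transport h V) = h ` carrier V"
  "\<zero>\<^bsub>transport h V\<^esub> = h \<zero>"
  "x \<in> carrier V \<Longrightarrow> y \<in> carrier V \<Longrightarrow> h x \<oplus>\<^bsub>transport h V\<^esub> h y = h (x \<oplus> y)"
  "x \<in> carrier V \<Longrightarrow> a \<odot>\<^bsub>transport h V\<^esub> h x = h (a \<odot> x)"
  "x \<in> carrier V \<Longrightarrow> vnorm (transport h V) (h x) = vnorm V x"
  using inj by (simp_all add: transport_def)

sublocale T: normed_space "transport h V"
proof (rule normed_spaceI)
  show "vnorm (transport h V) u = 0 \<longleftrightarrow> u = \<zero>\<^bsub>transport h V\<^esub>" if "u \<in> carrier (transport h V)" for u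
    using that inj by (auto simp: vnorm_eq_0_iff inj_on_eq_iff)
qed (auto simp: M.a_ac smult_add_left smult_add_right smult_mult smult_minus_one M.l_neg M.r_neg vnorm_smult
    vnorm_triangle)

lemma iso: "bounded_op V (transport h V) (restrict h (carrier V))"
  by (intro bounded_opI normed_space_axioms T.normed_space_axioms bounded_operatorsI[where B = 1]) auto

lemma transport_diff:
  "x \<in> carrier V \<Longrightarrow> y \<in> carrier V \<Longrightarrow> h x \<ominus>\<^bsub>transport h V\<^esub> h y = h (x \<ominus> y)"
  using bounded_op.diff[OF iso, of x y] by simp

lemma closed_subspace_transport:
  assumes F: "closed_subspace F V"
  shows "closed_subspace (h ` F) (transport h V)"
proof (rule T.closed_subspaceI)
  note FD = closed_subspaceD[OF F]
  have c: "x \<in> carrier V" if "x \<in> F" for x using FD(1) that by blast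
  show "h ` F \<subseteq> carrier (transport h V)" using c by auto
  show "\<zero>\<^bsub>transport h V\<^esub> \<in> h ` F" using FD(2) by simp
  show "u \<oplus>\<^bsub>transport h V\<^esub> v \<in> h ` F" if "u \<in> h ` F" "v \<in> h ` F" for u v
    using that c FD(3) by auto
  show "a \<odot>\<^bsub>transport h V\<^esub> u \<in> h ` F" if "u \<in> h ` F" for a u
    using that c FD(4) by auto
  fix \<sigma> l assume s: "\<And>n. \<sigma> n \<in> h ` F" and l: "l \<in> carrier (transport h V)"
    and lim: "(\<lambda>n. vnorm (transport h V) (\<sigma> n \<ominus>\<^bsub>transport h V\<^esub> l)) \<longlonglongrightarrow> 0"
  have "\<exists>x. x \<in> F \<and> \<sigma> n = h x" for n using s[of n] by blast
  then obtain \<tau> where t: "\<And>n. \<tau> n \<in> F" "\<And>n. \<sigma> n = h (\<tau> n)" by metis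
  obtain x where x: "x \<in> carrier V" "l = h x" using l by auto
  have "(\<lambda>n. vnorm V (\<tau> n \<ominus> x)) \<longlonglongrightarrow> 0"
    using lim c[OF t(1)] x by (simp add: t(2) transport_diff)
  then show "l \<in> h ` F" using FD(6)[of \<tau> x] t(1) x by blast
qed

lemma banach_space_transport:
  assumes "banach_space V"
  shows "banach_space (transport h V)"
proof -
  have "T.mcomplete"
    unfolding T.mcomplete_vnorm
  proof (intro allI impI, elim conjE)
    fix \<sigma> assume s: "\<forall>n. \<sigma> n \<in> carrier (transport h V)"
      and C: "\<forall>e>0. \<exists>N::nat. \<forall>m\<ge>N. \<forall>n\<ge>N. vnorm (transport h V) (\<sigma> m \<ominus>\<^bsub>transport h V\<^esub> \<sigma> n) < e"
    have "\<exists>x. x \<in> carrier V \<and> \<sigma> n = h x" for n using s by auto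
    then obtain \<tau> where t: "\<And>n. \<tau> n \<in> carrier V" "\<And>n. \<sigma> n = h (\<tau> n)" by metis
    have "\<forall>e>0. \<exists>N. \<forall>m\<ge>N. \<forall>n\<ge>N. vnorm V (\<tau> m \<ominus> \<tau> n) < e"
      using C t(1) by (simp add: t(2) transport_diff)
    moreover have "mcomplete" using assms by (simp add: banach_space_def banach_space_axioms_def)
    ultimately obtain l where "l \<in> carrier V" "(\<lambda>n. vnorm V (\<tau> n \<ominus> l)) \<longlonglongrightarrow> 0"
      using t(1) unfolding mcomplete_vnorm by blast
    then show "\<exists>l\<in>carrier (transport h V).
        (\<lambda>n. vnorm (transport h V) (\<sigma> n \<ominus>\<^bsub>transport h V\<^esub> l)) \<longlonglongrightarrow> 0"
      using t by (auto simp: transport_diff)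
  qed
  then show ?thesis
    by (intro banach_space.intro banach_space_axioms.intro T.normed_space_axioms)
qed

end

text \<open>The form in which the property is used: the test space may live on any type from which
  its carrier is injected into \<open>'u\<close>, and the norm equation becomes a pointwise bound by
  a given \<open>K\<close>.\<close>

lemma metric_extension_propertyD:
  fixes Y :: "('k::real_or_complex, 'y) normed_module" and Z :: "('k, 'z) normed_module" and h :: "'z \<Rightarrow> 'u"
  assumes ext: "metric_extension_property TYPE('u) Y" and Y: "normed_space Y" and Z: "banach_space Z"
    and h: "inj_on h (carrier Z)" and M: "closed_subspace M Z"
    and R: "R \<in> bounded_operators (Z\<lparr>carrier := M\<rparr>) Y"
    and K: "0 \<le> K" "\<And>x. x \<in> M \<Longrightarrow> vnorm Y (R x) \<le> K * vnorm Z x"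
  obtains S where "S \<in> bounded_operators Z Y" "\<And>x. x \<in> M \<Longrightarrow> S x = R x"
    "\<And>x. x \<in> carrier Z \<Longrightarrow> vnorm Y (S x) \<le> K * vnorm Z x"
proof -
  interpret Z: banach_space Z by (rule Z)
  interpret Y: normed_space Y by (rule Y)
  interpret h: transported Z h by unfold_locales (rule h)
  note MD = Z.closed_subspaceD[OF M]
  note RD = bounded_operatorsD[OF R, simplified]
  have c: "x \<in> carrier Z" if "x \<in> M" for x using MD(1) that by blast
  define R1 where "R1 = (\<lambda>u\<in>h ` M. R (inv_into (carrier Z) h u))"
  have R1: "R1 (h x) = R x" if "x \<in> M" for x
    using that c[OF that] h by (simp add: R1_def)
  have bd: "R1 \<in> bounded_operators ((transport h Z)\<lparr>carrier := h ` M\<rparr>) Y"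
  proof (rule bounded_operatorsI[where B = K])
    show "R1 \<in> extensional (carrier ((transport h Z)\<lparr>carrier := h ` M\<rparr>))"
      unfolding R1_def by simp
    fix u assume "u \<in> carrier ((transport h Z)\<lparr>carrier := h ` M\<rparr>)"
    then obtain x where x: "x \<in> M" "u = h x" by auto
    show "R1 u \<in> carrier Y" using x by (simp add: R1 RD(1))
    show "vnorm Y (R1 u) \<le> K * vnorm ((transport h Z)\<lparr>carrier := h ` M\<rparr>) u"
      using x by (simp add: R1 K(2) c)
    show "R1 (a \<odot>\<^bsub>(transport h Z)\<lparr>carrier := h ` M\<rparr>\<^esub> u) = a \<odot>\<^bsub>Y\<^esub> R1 u" for a
      using x by (simp add: R1 RD(4) MD(4) c)
    fix v assume "v \<in> carrier ((transport h Z)\<lparr>carrier := h ` M\<rparr>)"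
    then obtain y where y: "y \<in> M" "v = h y" by auto
    show "R1 (u \<oplus>\<^bsub>(transport h Z)\<lparr>carrier := h ` M\<rparr>\<^esub> v) = R1 u \<oplus>\<^bsub>Y\<^esub> R1 v"
      using x y by (simp add: R1 RD(3) MD(3) c)
  qed
  have "op_norm ((transport h Z)\<lparr>carrier := h ` M\<rparr>) Y R1 \<le> K"
  proof (rule op_norm_le[where z = "h \<zero>\<^bsub>Z\<^esub>"])
    show "vnorm Y (R1 u) \<le> K * vnorm ((transport h Z)\<lparr>carrier := h ` M\<rparr>) u"
      if "u \<in> carrier ((transport h Z)\<lparr>carrier := h ` M\<rparr>)" for u
      using that by (auto simp: R1 K(2) c)
  qed (auto simp: MD K)
  moreover obtain S where S: "S \<in> bounded_operators (transport h Z) Y" "R1 = restrict S (h ` M)"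
    "op_norm (transport h Z) Y S = op_norm ((transport h Z)\<lparr>carrier := h ` M\<rparr>) Y R1"
    using ext h.banach_space_transport[OF Z] h.closed_subspace_transport[OF M] bd
    unfolding metric_extension_property_def by blast
  ultimately have le: "op_norm (transport h Z) Y S \<le> K" by simp
  interpret S: bounded_op "transport h Z" Y S
    by (rule bounded_opI[OF h.T.normed_space_axioms Y S(1)])
  have bound: "vnorm Y (S (h x)) \<le> K * vnorm Z x" if "x \<in> carrier Z" for x
  proof -
    have "vnorm Y (S (h x)) \<le> op_norm (transport h Z) Y S * vnorm (transport h Z) (h x)"
      using that by (intro S.norm_bound) simp
    also have "\<dots> \<le> K * vnorm Z x" using le that by (simp add: mult_right_mono)
    finally show ?thesis .
  qed
  show ?thesis
  proof (rule that[of "\<lambda>x\<in>carrier Z. S (h x)"])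
    show "(\<lambda>x\<in>carrier Z. S (h x)) \<in> bounded_operators Z Y"
    proof (rule bounded_operatorsI[where B = K])
      fix x assume x: "x \<in> carrier Z"
      show "(\<lambda>x\<in>carrier Z. S (h x)) (a \<odot>\<^bsub>Z\<^esub> x) = a \<odot>\<^bsub>Y\<^esub> (\<lambda>x\<in>carrier Z. S (h x)) x" for a
        using S.smult[of "h x" a] x by simp
      fix y assume y: "y \<in> carrier Z"
      show "(\<lambda>x\<in>carrier Z. S (h x)) (x \<oplus>\<^bsub>Z\<^esub> y) =
          (\<lambda>x\<in>carrier Z. S (h x)) x \<oplus>\<^bsub>Y\<^esub> (\<lambda>x\<in>carrier Z. S (h x)) y"
        using S.add[of "h x" "h y"] x y by simp
    qed (auto simp: bound)
    show "(\<lambda>x\<in>carrier Z. S (h x)) x = R x" if "x \<in> M" for x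
      using R1[OF that] that c[OF that] by (simp add: S(2))
  qed (simp add: bound)
qed

section \<open>Cosets modulo a closed subspace\<close>

context normed_space
begin

text \<open>These facts stand in for a proof that the quotient is a normed space: the lifting
  property asks for a bounded operator into it, and afterwards only an equality of cosets has to be
  evaluated.\<close>

lemma quotient_map_linear:
  assumes F: "closed_subspace F V"
  shows "x \<in> carrier V \<Longrightarrow> quotient_map V F x \<in> carrier (quotient_space V F)"
    and "x \<in> carrier V \<Longrightarrow> y \<in> carrier V \<Longrightarrow>
      quotient_map V F (x \<oplus> y) = quotient_map V F x \<oplus>\<^bsub>quotient_space V F\<^esub> quotient_map V F y"
    and "x \<in> carrier V \<Longrightarrow>
      quotient_map V F (a \<odot> x) = a \<odot>\<^bsub>quotient_space V F\<^esub> quotient_map V F x"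
    and "x \<in> carrier V \<Longrightarrow> y \<in> carrier V \<Longrightarrow>
      quotient_map V F x = quotient_map V F y \<Longrightarrow> x \<ominus> y \<in> F"
    and "x \<in> carrier V \<Longrightarrow> y \<in> F \<Longrightarrow> vnorm (quotient_space V F) (quotient_map V F x) \<le> vnorm V (x \<ominus> y)"
proof -
  note FD = closed_subspaceD[OF F]
  have sub: "submodule F scalar_ring V" using F by (simp add: closed_subspace_def)
  then have sg: "subgroup F (add_monoid V)" by (rule submodule.axioms)
  interpret S: abelian_subgroup F V
    by (intro abelian_subgroupI3 additive_subgroup.intro sg M.abelian_group_axioms)
  have c: "z \<in> carrier V" if "z \<in> F" for z using FD(1) that by blast
  have coset: "F +> z = {f \<oplus> z | f. f \<in> F}" for z by (auto simp: a_r_coset_def')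
  show "quotient_map V F x \<in> carrier (quotient_space V F)" if "x \<in> carrier V" for x
    using M.a_rcosetsI[OF FD(1) that] by (simp add: quotient_map_def quotient_space_def)
  show "quotient_map V F (x \<oplus> y) = quotient_map V F x \<oplus>\<^bsub>quotient_space V F\<^esub> quotient_map V F y"
    if "x \<in> carrier V" "y \<in> carrier V" for x y
    using S.a_rcos_sum[OF that] by (simp add: quotient_map_def quotient_space_def)
  show "quotient_map V F (a \<odot> x) = a \<odot>\<^bsub>quotient_space V F\<^esub> quotient_map V F x"
    if x: "x \<in> carrier V" for x
  proof -
    \<comment> \<open>The scalar multiple of a coset is a union over its elements; each of them
      contributes the same coset, so that the union collapses.\<close>
    have eq: "F +> (a \<odot> z) = F +> (a \<odot> x)" if z: "z \<in> F +> x" for z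
    proof -
      obtain f where f: "f \<in> F" "z = f \<oplus> x" using z coset by auto
      then have "a \<odot> z = (a \<odot> f) \<oplus> (a \<odot> x)" using c x by (simp add: smult_add_right)
      then have "a \<odot> z \<in> F +> (a \<odot> x)" using FD(4)[OF f(1)] coset by auto
      then show ?thesis using M.a_repr_independence[OF _ _ sg] x by simp
    qed
    have "F +> x \<noteq> {}" using FD(2) unfolding coset by blast
    moreover have "(\<Union>z\<in>F +> x. F +> (a \<odot> z)) = (\<Union>z\<in>F +> x. F +> (a \<odot> x))"
      by (rule SUP_cong[OF refl eq])
    ultimately have "(\<Union>z\<in>F +> x. F +> (a \<odot> z)) = F +> (a \<odot> x)" by simp
    then show ?thesis by (simp add: quotient_map_def quotient_space_def)
  qed
  show "x \<ominus> y \<in> F"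
    if x: "x \<in> carrier V" and y: "y \<in> carrier V" and eq: "quotient_map V F x = quotient_map V F y" for x y
  proof -
    have "x \<in> F +> y" using S.a_rcos_self[OF x] eq by (simp add: quotient_map_def)
    then obtain f where f: "f \<in> F" "x = f \<oplus> y" unfolding coset by blast
    then have "x \<ominus> y = f" using c y by (simp add: M.minus_eq M.a_ac M.r_neg)
    then show ?thesis using f by simp
  qed
  show "vnorm (quotient_space V F) (quotient_map V F x) \<le> vnorm V (x \<ominus> y)"
    if x: "x \<in> carrier V" and y: "y \<in> F" for x y
  proof -
    have "x \<ominus> y \<in> F +> x"
    proof -
      have "x \<ominus> y = (\<ominus> y) \<oplus> x" using x c[OF y] by (simp add: M.minus_eq M.a_comm)
      then show ?thesis using FD(5)[OF y] unfolding coset by blast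
    qed
    moreover have "bdd_below (vnorm V ` (F +> x))"
      using M.a_r_coset_subset_G[OF FD(1) x] by (intro bdd_belowI2[where m = 0] vnorm_nonneg) blast
    ultimately show ?thesis
      by (simp add: quotient_map_def quotient_space_def cINF_lower)
  qed
qed

end

text \<open>The property is applied to \<open>R\<close> followed by the quotient map. The norm of
  this composition is at most \<open>K\<close>, since the distance of \<open>R x\<close> from
  \<open>F\<close> is at most \<open>K\<close> times the norm of \<open>x\<close>. Equality of the
  two maps into the quotient puts \<open>R x \<ominus> S x\<close> into \<open>F\<close>.\<close>

lemma metric_lifting_propertyD:
  fixes X :: "('k::real_or_complex, 'x) normed_module" and Z :: "('k, 'z) normed_module" and h :: "'z \<Rightarrow> 'u"
  assumes lift: "metric_lifting_property TYPE('u) X" and X: "normed_space X" and Z: "banach_space Z"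
    and h: "inj_on h (carrier Z)" and F: "closed_subspace F Z" and R: "R \<in> bounded_operators X Z"
    and K: "0 \<le> K" "\<And>x. x \<in> carrier X \<Longrightarrow> \<exists>y\<in>F. vnorm Z (R x \<ominus>\<^bsub>Z\<^esub> y) \<le> K * vnorm X x"
    and \<epsilon>: "0 < \<epsilon>"
  obtains S where "S \<in> bounded_operators X Z" "\<And>x. x \<in> carrier X \<Longrightarrow> R x \<ominus>\<^bsub>Z\<^esub> S x \<in> F"
    "\<And>x. x \<in> carrier X \<Longrightarrow> vnorm Z (S x) \<le> (1 + \<epsilon>) * K * vnorm X x"
proof -
  interpret Z: banach_space Z by (rule Z)
  interpret X: normed_space X by (rule X)
  interpret h: transported Z h by unfold_locales (rule h)
  interpret R: bounded_op X Z R by (rule bounded_opI[OF X Z.normed_space_axioms R])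
  note FD = Z.closed_subspaceD[OF F]
  have F1: "closed_subspace (h ` F) (transport h Z)" by (rule h.closed_subspace_transport[OF F])
  note Q = h.T.quotient_map_linear[OF F1]
  define Q1 where "Q1 = (\<lambda>x\<in>carrier X. quotient_map (transport h Z) (h ` F) (h (R x)))"
  have le: "vnorm (quotient_space (transport h Z) (h ` F)) (Q1 x) \<le> K * vnorm X x"
    if x: "x \<in> carrier X" for x
  proof -
    obtain y where y: "y \<in> F" "vnorm Z (R x \<ominus>\<^bsub>Z\<^esub> y) \<le> K * vnorm X x" using K(2)[OF x] by blast
    have yc: "y \<in> carrier Z" using FD(1) y(1) by blast
    have "vnorm (quotient_space (transport h Z) (h ` F)) (Q1 x)
        \<le> vnorm (transport h Z) (h (R x) \<ominus>\<^bsub>transport h Z\<^esub> h y)"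
      using Q(5)[of "h (R x)" "h y"] x y(1) by (simp add: Q1_def)
    then show ?thesis using y(2) x yc by (simp add: h.transport_diff)
  qed
  have "Q1 \<in> bounded_operators X (quotient_space (transport h Z) (h ` F))"
  proof (rule bounded_operatorsI[OF _ _ _ _ le])
    fix x assume x: "x \<in> carrier X"
    show "Q1 x \<in> carrier (quotient_space (transport h Z) (h ` F))"
      using Q(1)[of "h (R x)"] x by (simp add: Q1_def)
    show "Q1 (a \<odot>\<^bsub>X\<^esub> x) = a \<odot>\<^bsub>quotient_space (transport h Z) (h ` F)\<^esub> Q1 x" for a
      using Q(3)[of "h (R x)" a] x by (simp add: Q1_def R.smult)
    fix y assume y: "y \<in> carrier X"
    show "Q1 (x \<oplus>\<^bsub>X\<^esub> y) = Q1 x \<oplus>\<^bsub>quotient_space (transport h Z) (h ` F)\<^esub> Q1 y"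
      using Q(2)[of "h (R x)" "h (R y)"] x y by (simp add: Q1_def R.add)
  next
    show "Q1 \<in> extensional (carrier X)" unfolding Q1_def by (rule restrict_extensional)
  qed
  then obtain S where S: "S \<in> bounded_operators X (transport h Z)"
    "op_norm X (transport h Z) S \<le> (1 + \<epsilon>) * op_norm X (quotient_space (transport h Z) (h ` F)) Q1"
    "Q1 = compose (carrier X) (quotient_map (transport h Z) (h ` F)) S"
    using lift h.banach_space_transport[OF Z] F1 \<epsilon>
    unfolding metric_lifting_property_def by blast
  interpret S: bounded_op X "transport h Z" S
    by (rule bounded_opI[OF X h.T.normed_space_axioms S(1)])
  have "op_norm X (quotient_space (transport h Z) (h ` F)) Q1 \<le> K"
    using le K(1) by (intro op_norm_le[where z = "\<zero>\<^bsub>X\<^esub>"]) auto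
  then have "(1 + \<epsilon>) * op_norm X (quotient_space (transport h Z) (h ` F)) Q1 \<le> (1 + \<epsilon>) * K"
    using \<epsilon> by (intro mult_left_mono) auto
  with S(2) have opS: "op_norm X (transport h Z) S \<le> (1 + \<epsilon>) * K" by linarith
  define S' where "S' = (\<lambda>x\<in>carrier X. inv_into (carrier Z) h (S x))"
  have S': "S' x \<in> carrier Z" "h (S' x) = S x" if "x \<in> carrier X" for x
    using S.closed[OF that] that by (auto simp: S'_def h)
  have bound: "vnorm Z (S' x) \<le> (1 + \<epsilon>) * K * vnorm X x" if x: "x \<in> carrier X" for x
  proof -
    have "vnorm Z (S' x) = vnorm (transport h Z) (S x)"
      using h.transport_simps(5)[OF S'(1)[OF x]] S'(2)[OF x] by simp
    also have "\<dots> \<le> op_norm X (transport h Z) S * vnorm X x" by (rule S.norm_bound[OF x])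
    also have "\<dots> \<le> (1 + \<epsilon>) * K * vnorm X x" using opS x by (intro mult_right_mono) auto
    finally show ?thesis .
  qed
  have eqI: "u = v" if "h u = h v" "u \<in> carrier Z" "v \<in> carrier Z" for u v
    using h that by (auto dest: inj_onD)
  show ?thesis
  proof (rule that[of S'])
    show "S' \<in> bounded_operators X Z"
    proof (rule bounded_operatorsI[OF _ _ _ _ bound])
      show "S' (x \<oplus>\<^bsub>X\<^esub> y) = S' x \<oplus>\<^bsub>Z\<^esub> S' y" if "x \<in> carrier X" "y \<in> carrier X" for x y
        using that S' S.add h.transport_simps(3)[of "S' x" "S' y"] by (intro eqI) simp_all
      show "S' (a \<odot>\<^bsub>X\<^esub> x) = a \<odot>\<^bsub>Z\<^esub> S' x" if "x \<in> carrier X" for a x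
        using that S' S.smult h.transport_simps(4)[of "S' x" a] by (intro eqI) simp_all
      show "S' \<in> extensional (carrier X)" unfolding S'_def by (rule restrict_extensional)
    qed (simp_all add: S'(1))
    fix x assume x: "x \<in> carrier X"
    have "quotient_map (transport h Z) (h ` F) (h (R x)) = quotient_map (transport h Z) (h ` F) (h (S' x))"
      using fun_cong[OF S(3), of x] x S'(2)[OF x] by (simp add: Q1_def compose_def)
    then have "h (R x) \<ominus>\<^bsub>transport h Z\<^esub> h (S' x) \<in> h ` F"
      using Q(4)[of "h (R x)" "h (S' x)"] x S'(1)[OF x] by simp
    then obtain y where y: "y \<in> F" "h (R x \<ominus>\<^bsub>Z\<^esub> S' x) = h y"
      using x S'(1)[OF x] by (auto simp: h.transport_diff)
    moreover have "y \<in> carrier Z" using FD(1) y(1) by blast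
    ultimately have "R x \<ominus>\<^bsub>Z\<^esub> S' x = y" using x S'(1)[OF x] by (intro eqI) simp_all
    then show "R x \<ominus>\<^bsub>Z\<^esub> S' x \<in> F" using y(1) by simp
  qed (rule bound)
qed

section \<open>Gelfand numbers of the adjoint\<close>

text \<open>Applied not only to \<open>T\<close>: adjoints also provide the functionals
  \<open>b \<circ> P\<close> on the bidual and \<open>b i \<circ> A\<close> on \<open>X\<close>
  below.\<close>

lemma adjoint_bounded:
  assumes X: "normed_space X" and Y: "normed_space Y" and T: "T \<in> bounded_operators X Y"
  shows "adjoint_op X Y T \<in> bounded_operators (dual_space Y) (dual_space X)"
    and "b \<in> bounded_operators Y scalar_space \<Longrightarrow>
      adjoint_op X Y T b = (\<lambda>x\<in>carrier X. b (T x))"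
proof -
  interpret T: bounded_op X Y T by (rule bounded_opI[OF X Y T])
  show ad: "adjoint_op X Y T b = (\<lambda>x\<in>carrier X. b (T x))"
    if "b \<in> bounded_operators Y scalar_space" for b
    using that by (simp add: adjoint_op_def compose_def)
  have le: "norm (b (T x)) \<le> op_norm Y scalar_space b * op_norm X Y T * vnorm X x"
    if "b \<in> bounded_operators Y scalar_space" "x \<in> carrier X" for b x
  proof -
    interpret b: functional Y b by (rule functionalI[OF Y that(1)])
    have "norm (b (T x)) \<le> op_norm Y scalar_space b * vnorm Y (T x)"
      using that(2) by (intro b.bound) simp
    also have "\<dots> \<le> op_norm Y scalar_space b * (op_norm X Y T * vnorm X x)"
      by (intro mult_left_mono T.norm_bound that(2) b.op_norm_nonneg)
    finally show ?thesis by (simp add: mult.assoc)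
  qed
  have mem: "(\<lambda>x\<in>carrier X. b (T x)) \<in> bounded_operators X scalar_space"
    if b: "b \<in> bounded_operators Y scalar_space" for b
  proof -
    interpret b: functional Y b by (rule functionalI[OF Y b])
    show ?thesis
      by (rule bounded_operatorsI[where B = "op_norm Y scalar_space b * op_norm X Y T"])
        (auto simp: T.add T.smult b.linear le[OF b])
  qed
  show "adjoint_op X Y T \<in> bounded_operators (dual_space Y) (dual_space X)"
  proof (rule bounded_operatorsI[where B = "op_norm X Y T"])
    fix b assume "b \<in> carrier (dual_space Y)"
    then have b: "b \<in> bounded_operators Y scalar_space" by simp
    interpret b: functional Y b by (rule functionalI[OF Y b])
    interpret c: functional X "\<lambda>x\<in>carrier X. b (T x)" by (rule functionalI[OF X mem[OF b]])
    show "adjoint_op X Y T b \<in> carrier (dual_space X)" using mem[OF b] by (simp add: ad[OF b])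
    have "op_norm X scalar_space (\<lambda>x\<in>carrier X. b (T x)) \<le> op_norm Y scalar_space b * op_norm X Y T"
      using le[OF b] by (intro c.leI mult_nonneg_nonneg b.op_norm_nonneg T.op_norm_nonneg) simp
    then show "vnorm (dual_space X) (adjoint_op X Y T b) \<le> op_norm X Y T * vnorm (dual_space Y) b"
      by (simp add: ad[OF b] mult.commute)
    show "adjoint_op X Y T (c \<odot>\<^bsub>dual_space Y\<^esub> b) = c \<odot>\<^bsub>dual_space X\<^esub> adjoint_op X Y T b" for c
      using T.W.dual_smult(1)[OF b] by (simp add: ad b fun_eq_iff)
    fix b' assume "b' \<in> carrier (dual_space Y)"
    then have b': "b' \<in> bounded_operators Y scalar_space" by simp
    show "adjoint_op X Y T (b \<oplus>\<^bsub>dual_space Y\<^esub> b')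
        = adjoint_op X Y T b \<oplus>\<^bsub>dual_space X\<^esub> adjoint_op X Y T b'"
      using T.W.dual_add(1)[OF b b'] by (simp add: ad b b' fun_eq_iff)
  qed (simp add: adjoint_op_def)
qed

text \<open>If \<open>S\<close> extends the restriction of \<open>T\<close> to the common kernel of the \<open>a i\<close> then \<open>T - S\<close> has its
  values in the span of the vectors \<open>(T - S) (u i)\<close>.\<close>

lemma adjoint_bound_of_extension:
  fixes X :: "('k::real_or_complex, 'x) normed_module" and Y :: "('k, 'y) normed_module"
    and h :: "'x \<Rightarrow> 'u"
  assumes X: "banach_space X" and Y: "normed_space Y" and T: "T \<in> bounded_operators X Y"
    and ext: "metric_extension_property TYPE('u) Y" and h: "inj_on h (carrier X)"
    and a: "\<And>i. i \<in> {1..k} \<Longrightarrow> a i \<in> bounded_operators X scalar_space"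
    and \<epsilon>: "0 \<le> \<epsilon>" "\<And>x. x \<in> common_kernel X k a \<Longrightarrow> vnorm Y (T x) \<le> \<epsilon> * vnorm X x"
  shows "\<exists>\<phi>. (\<forall>i\<in>{1..k}. \<phi> i \<in> bounded_operators (dual_space Y) scalar_space) \<and>
    (\<forall>b\<in>common_kernel (dual_space Y) k \<phi>.
      vnorm (dual_space X) (adjoint_op X Y T b) \<le> \<epsilon> * vnorm (dual_space Y) b)"
proof -
  interpret X: banach_space X by (rule X)
  interpret Y: normed_space Y by (rule Y)
  interpret T: bounded_op X Y T by (rule bounded_opI[OF X.normed_space_axioms Y T])
  define M where "M = common_kernel X k a"
  have M: "closed_subspace M X" unfolding M_def by (rule X.closed_subspace_common_kernel[OF a])
  note MD = X.closed_subspaceD[OF M]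
  have c: "x \<in> carrier X" if "x \<in> M" for x using MD(1) that by blast
  have R: "restrict T M \<in> bounded_operators (X\<lparr>carrier := M\<rparr>) Y"
  proof (rule bounded_operatorsI[where B = \<epsilon>])
    fix x assume "x \<in> carrier (X\<lparr>carrier := M\<rparr>)"
    then have x: "x \<in> M" by simp
    show "restrict T M x \<in> carrier Y" using x c by simp
    show "vnorm Y (restrict T M x) \<le> \<epsilon> * vnorm (X\<lparr>carrier := M\<rparr>) x"
      using \<epsilon>(2)[of x] x by (simp add: M_def)
    show "restrict T M (b \<odot>\<^bsub>X\<lparr>carrier := M\<rparr>\<^esub> x) = b \<odot>\<^bsub>Y\<^esub> restrict T M x" for b
      using x MD(4)[OF x] by (simp add: T.smult c)
    fix y assume "y \<in> carrier (X\<lparr>carrier := M\<rparr>)"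
    then have y: "y \<in> M" by simp
    show "restrict T M (x \<oplus>\<^bsub>X\<lparr>carrier := M\<rparr>\<^esub> y) = restrict T M x \<oplus>\<^bsub>Y\<^esub> restrict T M y"
      using x y MD(3)[OF x y] by (simp add: T.add c)
  qed simp
  \<comment> \<open>\<open>X\<close> itself is the test space, with the common kernel as its
    subspace.\<close>
  obtain S where S: "S \<in> bounded_operators X Y" "\<And>x. x \<in> M \<Longrightarrow> S x = restrict T M x"
    "\<And>x. x \<in> carrier X \<Longrightarrow> vnorm Y (S x) \<le> \<epsilon> * vnorm X x"
    by (rule metric_extension_propertyD[OF ext Y X h M R \<epsilon>(1)])
      (auto simp: \<epsilon>(2)[folded M_def] intro: that)
  interpret S: bounded_op X Y S by (rule bounded_opI[OF X.normed_space_axioms Y S(1)])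
  obtain u where u: "\<And>i. i \<in> {1..k} \<Longrightarrow> u i \<in> carrier X"
    and span: "\<And>f x. X.linear_functional f \<Longrightarrow> \<forall>x\<in>common_kernel X k a. f x = 0 \<Longrightarrow>
      x \<in> carrier X \<Longrightarrow> f x = (\<Sum>i\<in>{1..k}. f (u i) * a i x)"
    by (rule X.common_kernel_span[OF a]) (assumption | rule that)+
  \<comment> \<open>The choice is possible before any \<open>b\<close> is given, because the
    \<open>u i\<close> depend on the \<open>a i\<close> only.\<close>
  define \<phi> where "\<phi> i = evaluation Y (T (u i) \<ominus>\<^bsub>Y\<^esub> S (u i))" for i
  have phi: "\<phi> i \<in> bounded_operators (dual_space Y) scalar_space" if "i \<in> {1..k}" for i
    using u that unfolding \<phi>_def by (intro Y.evaluation_bounded Y.M.minus_closed) auto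
  have "vnorm (dual_space X) (adjoint_op X Y T b) \<le> \<epsilon> * vnorm (dual_space Y) b"
    if bk: "b \<in> common_kernel (dual_space Y) k \<phi>" for b
  proof -
    have b: "b \<in> bounded_operators Y scalar_space" using bk by (simp add: common_kernel_def)
    interpret b: functional Y b by (rule functionalI[OF Y b])
    \<comment> \<open>\<open>f\<close> vanishes on \<open>M\<close>, so it is a combination of the
      \<open>a i\<close>; its coefficients \<open>f (u i) = \<phi> i b\<close> are all zero.\<close>
    define f where "f x = b (T x) - b (S x)" for x
    have "f (u i) = 0" if "i \<in> {1..k}" for i
    proof -
      have "b (T (u i) \<ominus>\<^bsub>Y\<^esub> S (u i)) = 0"
        using bk that b by (auto simp: common_kernel_def \<phi>_def evaluation_def)
      then show ?thesis using u that by (simp add: f_def b.linear)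
    qed
    moreover have "f x = (\<Sum>i\<in>{1..k}. f (u i) * a i x)" if "x \<in> carrier X" for x
    proof (rule span[OF _ _ that])
      show "\<forall>x\<in>common_kernel X k a. f x = 0"
        using S(2) by (simp add: f_def M_def)
      show "X.linear_functional f"
        by (simp add: X.linear_functional_def f_def T.add S.add T.smult S.smult b.linear algebra_simps)
    qed
    ultimately have eq: "b (T x) = b (S x)" if "x \<in> carrier X" for x
      using that by (simp add: f_def)
    have ad: "adjoint_op X Y T b = (\<lambda>x\<in>carrier X. b (T x))"
      by (rule adjoint_bounded(2)[OF X.normed_space_axioms Y T b])
    have "adjoint_op X Y T b \<in> bounded_operators X scalar_space"
      using bounded_operatorsD(1)[OF adjoint_bounded(1)[OF X.normed_space_axioms Y T], of b] b by simp
    then interpret t: functional X "adjoint_op X Y T b"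
      by (intro functionalI[OF X.normed_space_axioms])
    have "op_norm X scalar_space (adjoint_op X Y T b) \<le> \<epsilon> * op_norm Y scalar_space b"
    proof (rule t.leI)
      fix x assume x: "x \<in> carrier X"
      have "norm (b (S x)) \<le> op_norm Y scalar_space b * vnorm Y (S x)"
        using x by (intro b.bound) simp
      also have "\<dots> \<le> op_norm Y scalar_space b * (\<epsilon> * vnorm X x)"
        by (intro mult_left_mono S(3) x b.op_norm_nonneg)
      finally show "norm (adjoint_op X Y T b x) \<le> \<epsilon> * op_norm Y scalar_space b * vnorm X x"
        using x by (simp add: ad eq algebra_simps)
    qed (simp add: \<epsilon>(1) b.op_norm_nonneg)
    then show ?thesis by simp
  qed
  with phi show ?thesis by blast
qed

text \<open>\<open>Y\<close> is complete and embeds isometrically by \<open>J\<close>, so that its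
  image \<open>M\<close> is a closed subspace of the bidual. The inverse of \<open>J\<close> on
  \<open>M\<close> has norm at most 1, and its extension to the bidual is \<open>P\<close>.\<close>

lemma bidual_projection:
  fixes Y :: "('k::real_or_complex, 'y) normed_module" and h :: "(('y \<Rightarrow> 'k) \<Rightarrow> 'k) \<Rightarrow> 'u"
  assumes Y: "banach_space Y" and ext: "metric_extension_property TYPE('u) Y"
    and h: "inj_on h (carrier (dual_space (dual_space Y)))"
  obtains P where "P \<in> bounded_operators (dual_space (dual_space Y)) Y"
    "\<And>y. y \<in> carrier Y \<Longrightarrow> P (evaluation Y y) = y"
    "\<And>\<phi>. \<phi> \<in> carrier (dual_space (dual_space Y)) \<Longrightarrow>
      vnorm Y (P \<phi>) \<le> vnorm (dual_space (dual_space Y)) \<phi>"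
proof -
  interpret Y: banach_space Y by (rule Y)
  let ?B = "dual_space (dual_space Y)"
  define J where "J = restrict (evaluation Y) (carrier Y)"
  interpret J: bounded_op Y ?B J unfolding J_def by (rule Y.evaluation_op)
  have Jnorm: "vnorm ?B (J y) = vnorm Y y" if "y \<in> carrier Y" for y
    using that by (simp add: J_def Y.op_norm_evaluation)
  have inj: "x = y" if "J x = J y" "x \<in> carrier Y" "y \<in> carrier Y" for x y
  proof -
    have "vnorm Y (x \<ominus>\<^bsub>Y\<^esub> y) = vnorm ?B (J x \<ominus>\<^bsub>?B\<^esub> J y)"
      using that(2,3) by (simp only: Jnorm[symmetric] J.diff Y.M.minus_closed)
    also have "\<dots> = 0" using that J.closed[OF that(2)] J.W.minus_self[of "J y"] J.W.vnorm_zero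
      by (simp only: J.closed)
    finally show ?thesis using that by (simp add: Y.vnorm_eq_0_iff Y.minus_eq_zero_iff)
  qed
  define M where "M = J ` carrier Y"
  have M: "closed_subspace M ?B"
  proof (rule J.W.closed_subspaceI)
    show "M \<subseteq> carrier ?B" using J.closed by (auto simp only: M_def)
    show "\<zero>\<^bsub>?B\<^esub> \<in> M" unfolding M_def J.zero[symmetric] by simp
    show "u \<oplus>\<^bsub>?B\<^esub> v \<in> M" if uv: "u \<in> M" "v \<in> M" for u v
    proof -
      obtain x y where "x \<in> carrier Y" "y \<in> carrier Y" "u = J x" "v = J y" using uv unfolding M_def by blast
      then show ?thesis unfolding M_def by (metis J.add Y.M.add.m_closed imageI)
    qed
    show "a \<odot>\<^bsub>?B\<^esub> u \<in> M" if u: "u \<in> M" for a u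
    proof -
      obtain x where "x \<in> carrier Y" "u = J x" using u unfolding M_def by blast
      then show ?thesis unfolding M_def by (metis J.smult Y.smult_in imageI)
    qed
    fix \<sigma> l assume s: "\<And>n. \<sigma> n \<in> M" and l: "l \<in> carrier ?B"
      and lim: "(\<lambda>n. vnorm ?B (\<sigma> n \<ominus>\<^bsub>?B\<^esub> l)) \<longlonglongrightarrow> 0"
    have "\<exists>y. y \<in> carrier Y \<and> \<sigma> n = J y" for n using s[of n] unfolding M_def by blast
    then obtain \<tau> where t: "\<And>n. \<tau> n \<in> carrier Y" "\<And>n. \<sigma> n = J (\<tau> n)" by metis
    \<comment> \<open>Since \<open>J\<close> is isometric, convergence of the
      \<open>J (\<tau> n)\<close> makes \<open>\<tau>\<close> a Cauchy sequence in \<open>Y\<close>;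
      its limit \<open>y\<close> will satisfy \<open>J y = l\<close>.\<close>
    have tri: "vnorm Y (\<tau> m \<ominus>\<^bsub>Y\<^esub> x) \<le> vnorm ?B (\<sigma> m \<ominus>\<^bsub>?B\<^esub> l) + vnorm ?B (J x \<ominus>\<^bsub>?B\<^esub> l)"
      if x: "x \<in> carrier Y" for m x
    proof -
      have "vnorm Y (\<tau> m \<ominus>\<^bsub>Y\<^esub> x) = vnorm ?B (J (\<tau> m) \<ominus>\<^bsub>?B\<^esub> J x)"
        using t(1)[of m] x by (simp only: Jnorm[symmetric] J.diff Y.M.minus_closed)
      also have "J (\<tau> m) \<ominus>\<^bsub>?B\<^esub> J x = (J (\<tau> m) \<ominus>\<^bsub>?B\<^esub> l) \<oplus>\<^bsub>?B\<^esub> (l \<ominus>\<^bsub>?B\<^esub> J x)"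
        by (rule J.W.minus_cancel_mid[symmetric]) (use t(1) x l J.closed in blast)+
      also have "vnorm ?B \<dots> \<le> vnorm ?B (J (\<tau> m) \<ominus>\<^bsub>?B\<^esub> l) + vnorm ?B (l \<ominus>\<^bsub>?B\<^esub> J x)"
        by (intro J.W.vnorm_triangle J.W.M.minus_closed J.closed t(1) x l)
      also have "vnorm ?B (l \<ominus>\<^bsub>?B\<^esub> J x) = vnorm ?B (J x \<ominus>\<^bsub>?B\<^esub> l)"
        by (intro J.W.minus_commute_vnorm J.closed x l)
      finally show ?thesis by (simp only: t(2))
    qed
    have "\<exists>N. \<forall>m\<ge>N. \<forall>n\<ge>N. vnorm Y (\<tau> m \<ominus>\<^bsub>Y\<^esub> \<tau> n) < e" if e: "e > 0" for e
    proof -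
      obtain N where N0: "\<forall>n\<ge>N. norm (vnorm ?B (\<sigma> n \<ominus>\<^bsub>?B\<^esub> l) - 0) < e / 2"
        using LIMSEQ_D[OF lim half_gt_zero[OF e]] by blast
      have N: "vnorm ?B (\<sigma> n \<ominus>\<^bsub>?B\<^esub> l) < e / 2" if "n \<ge> N" for n
        using N0[rule_format, OF that] unfolding real_norm_def by linarith
      have "vnorm Y (\<tau> m \<ominus>\<^bsub>Y\<^esub> \<tau> n) < e" if "m \<ge> N" "n \<ge> N" for m n
        using tri[OF t(1)[of n], of m] N[OF that(1)] N[OF that(2)] unfolding t(2) by linarith
      then show ?thesis by blast
    qed
    moreover have "Y.mcomplete" using Y by (simp add: banach_space_def banach_space_axioms_def)
    ultimately obtain y where y: "y \<in> carrier Y" "(\<lambda>n. vnorm Y (\<tau> n \<ominus>\<^bsub>Y\<^esub> y)) \<longlonglongrightarrow> 0"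
      using t(1) unfolding Y.mcomplete_vnorm by blast
    have "vnorm ?B (J y \<ominus>\<^bsub>?B\<^esub> l) \<le> 0"
    proof (rule LIMSEQ_le_const)
      show "(\<lambda>n. vnorm Y (\<tau> n \<ominus>\<^bsub>Y\<^esub> y) + vnorm ?B (\<sigma> n \<ominus>\<^bsub>?B\<^esub> l)) \<longlonglongrightarrow> 0"
        using tendsto_add[OF y(2) lim] by (simp only: add_0)
      have "vnorm ?B (J y \<ominus>\<^bsub>?B\<^esub> l) \<le> vnorm Y (\<tau> n \<ominus>\<^bsub>Y\<^esub> y) + vnorm ?B (\<sigma> n \<ominus>\<^bsub>?B\<^esub> l)" for n
      proof -
        have "vnorm ?B (J y \<ominus>\<^bsub>?B\<^esub> l)
            = vnorm ?B ((J y \<ominus>\<^bsub>?B\<^esub> J (\<tau> n)) \<oplus>\<^bsub>?B\<^esub> (J (\<tau> n) \<ominus>\<^bsub>?B\<^esub> l))"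
          by (subst J.W.minus_cancel_mid) (use t(1) y l J.closed in blast)+
        also have "\<dots> \<le> vnorm ?B (J y \<ominus>\<^bsub>?B\<^esub> J (\<tau> n)) + vnorm ?B (J (\<tau> n) \<ominus>\<^bsub>?B\<^esub> l)"
          by (intro J.W.vnorm_triangle J.W.M.minus_closed J.closed t(1) y(1) l)
        also have "vnorm ?B (J y \<ominus>\<^bsub>?B\<^esub> J (\<tau> n)) = vnorm Y (\<tau> n \<ominus>\<^bsub>Y\<^esub> y)"
          using t(1)[of n] y(1)
          by (simp only: Jnorm J.diff[symmetric] Y.M.minus_closed Y.minus_commute_vnorm[of y])
        finally show ?thesis by (simp only: t(2))
      qed
      then show "\<exists>N. \<forall>n\<ge>N. vnorm ?B (J y \<ominus>\<^bsub>?B\<^esub> l)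
          \<le> vnorm Y (\<tau> n \<ominus>\<^bsub>Y\<^esub> y) + vnorm ?B (\<sigma> n \<ominus>\<^bsub>?B\<^esub> l)" by blast
    qed
    moreover have Jy: "J y \<in> carrier ?B" by (rule J.closed[OF y(1)])
    ultimately have "vnorm ?B (J y \<ominus>\<^bsub>?B\<^esub> l) = 0"
      using J.W.vnorm_nonneg[OF J.W.M.minus_closed[OF Jy l]] by linarith
    then have "J y = l"
      using J.W.vnorm_eq_0_iff[OF J.W.M.minus_closed[OF Jy l]] J.W.minus_eq_zero_iff[OF Jy l] by blast
    then show "l \<in> M" unfolding M_def using y(1) by blast
  qed
  define R where "R = restrict (inv_into (carrier Y) J) M"
  have R: "R (J y) = y" if "y \<in> carrier Y" for y
  proof -
    have "inj_on J (carrier Y)" using inj by (intro inj_onI)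
    then show ?thesis using that by (simp add: R_def M_def)
  qed
  have bd: "R \<in> bounded_operators (?B\<lparr>carrier := M\<rparr>) Y"
  proof (rule bounded_operatorsI[where B = 1])
    show "R \<in> extensional (carrier (?B\<lparr>carrier := M\<rparr>))" unfolding R_def by simp
    fix u assume "u \<in> carrier (?B\<lparr>carrier := M\<rparr>)"
    then obtain x where x: "x \<in> carrier Y" "u = J x" by (auto simp: M_def)
    show "R u \<in> carrier Y" using x by (simp add: R)
    show "vnorm Y (R u) \<le> 1 * vnorm (?B\<lparr>carrier := M\<rparr>) u"
      using x Jnorm[OF x(1)] by (simp add: R)
    have "R (a \<odot>\<^bsub>?B\<^esub> u) = a \<odot>\<^bsub>Y\<^esub> R u" for a
      unfolding x(2) J.smult[OF x(1), symmetric] using x by (simp only: R Y.smult_in)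
    then show "R (a \<odot>\<^bsub>?B\<lparr>carrier := M\<rparr>\<^esub> u) = a \<odot>\<^bsub>Y\<^esub> R u" for a by simp
    fix v assume "v \<in> carrier (?B\<lparr>carrier := M\<rparr>)"
    then obtain y where y: "y \<in> carrier Y" "v = J y" by (auto simp: M_def)
    have "R (u \<oplus>\<^bsub>?B\<^esub> v) = R u \<oplus>\<^bsub>Y\<^esub> R v"
      unfolding x(2) y(2) J.add[OF x(1) y(1), symmetric] using x y by (simp only: R Y.M.add.m_closed)
    then show "R (u \<oplus>\<^bsub>?B\<lparr>carrier := M\<rparr>\<^esub> v) = R u \<oplus>\<^bsub>Y\<^esub> R v" by simp
  qed
  have le: "vnorm Y (R u) \<le> 1 * vnorm ?B u" if u: "u \<in> M" for u
  proof -
    obtain x where x: "x \<in> carrier Y" "u = J x" using u unfolding M_def by blast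
    show ?thesis using Jnorm[OF x(1)] R[OF x(1)] x(2) by simp
  qed
  obtain P where P: "P \<in> bounded_operators ?B Y" "\<And>u. u \<in> M \<Longrightarrow> P u = R u"
    "\<And>u. u \<in> carrier ?B \<Longrightarrow> vnorm Y (P u) \<le> 1 * vnorm ?B u"
    by (rule metric_extension_propertyD[OF ext Y.normed_space_axioms
          normed_space.banach_space_dual[OF Y.normed_space_dual] h M bd zero_le_one le])
      (assumption | rule that)+
  show ?thesis
  proof (rule that[OF P(1)])
    fix y assume y: "y \<in> carrier Y"
    have "evaluation Y y = J y" using y by (simp add: J_def)
    moreover have "J y \<in> M" using y unfolding M_def by blast
    ultimately show "P (evaluation Y y) = y" using P(2)[of "J y"] R[OF y] by simp
  next
    show "vnorm Y (P \<phi>) \<le> vnorm ?B \<phi>" if "\<phi> \<in> carrier ?B" for \<phi>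
      using P(3)[OF that] by simp
  qed
qed

text \<open>The \<open>\<phi> i\<close> are projected to vectors \<open>P (\<phi> i)\<close> of \<open>Y\<close>. Their span is described as the
  annihilator \<open>N\<close> of its annihilator, which makes it obvious that it is closed.\<close>

lemma bound_of_adjoint_bound:
  fixes X :: "('k::real_or_complex, 'x) normed_module" and Y :: "('k, 'y) normed_module"
    and h :: "'y \<Rightarrow> 'u"
  assumes X: "normed_space X" and Y: "banach_space Y" and T: "T \<in> bounded_operators X Y"
    and lift: "metric_lifting_property TYPE('u) X" and h: "inj_on h (carrier Y)"
    and P: "P \<in> bounded_operators (dual_space (dual_space Y)) Y"
      "\<And>y. y \<in> carrier Y \<Longrightarrow> P (evaluation Y y) = y"
      "\<And>\<phi>. \<phi> \<in> carrier (dual_space (dual_space Y)) \<Longrightarrow>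
        vnorm Y (P \<phi>) \<le> vnorm (dual_space (dual_space Y)) \<phi>"
    and phi: "\<And>i. i \<in> {1..k} \<Longrightarrow> \<phi> i \<in> bounded_operators (dual_space Y) scalar_space"
    and \<epsilon>: "0 \<le> \<epsilon>" "\<And>b. b \<in> common_kernel (dual_space Y) k \<phi> \<Longrightarrow>
      vnorm (dual_space X) (adjoint_op X Y T b) \<le> \<epsilon> * vnorm (dual_space Y) b"
    and \<delta>: "0 < \<delta>"
  shows "\<exists>a. (\<forall>i\<in>{1..k}. a i \<in> bounded_operators X scalar_space) \<and>
    (\<forall>x\<in>common_kernel X k a. vnorm Y (T x) \<le> (1 + \<delta>) * \<epsilon> * vnorm X x)"
proof -
  interpret X: normed_space X by (rule X)
  interpret Y: banach_space Y by (rule Y)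
  interpret T: bounded_op X Y T by (rule bounded_opI[OF X Y.normed_space_axioms T])
  interpret D: normed_space "dual_space Y" by (rule Y.normed_space_dual)
  let ?B = "dual_space (dual_space Y)"
  have B: "normed_space ?B" by (rule D.normed_space_dual)
  interpret P: bounded_op ?B Y P by (rule bounded_opI[OF B Y.normed_space_axioms P(1)])
  define y where "y i = P (\<phi> i)" for i
  have y: "y i \<in> carrier Y" if "i \<in> {1..k}" for i
    using P.closed[of "\<phi> i"] phi[OF that] by (simp add: y_def)
  have ev: "evaluation Y z \<in> carrier ?B" if "z \<in> carrier Y" for z
    using Y.evaluation_bounded[OF that] by simp
  define N where "N = {z \<in> carrier Y. \<forall>b\<in>common_kernel (dual_space Y) k (\<lambda>i. evaluation Y (y i)). b z = 0}"
  have ker: "b \<in> common_kernel (dual_space Y) k (\<lambda>i. evaluation Y (y i)) \<longleftrightarrow>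
      b \<in> bounded_operators Y scalar_space \<and> (\<forall>i\<in>{1..k}. b (y i) = 0)" for b
    by (auto simp: common_kernel_def evaluation_def)
  have N: "closed_subspace N Y"
  proof (rule Y.closed_subspaceI)
    note fb = functional.linear[OF functionalI[OF Y.normed_space_axioms]]
    show "\<zero>\<^bsub>Y\<^esub> \<in> N" by (auto simp: N_def ker fb)
    show "x \<oplus>\<^bsub>Y\<^esub> z \<in> N" if "x \<in> N" "z \<in> N" for x z using that by (auto simp: N_def ker fb)
    show "c \<odot>\<^bsub>Y\<^esub> x \<in> N" if "x \<in> N" for c x using that by (auto simp: N_def ker fb)
    fix \<sigma> l assume s: "\<And>n. \<sigma> n \<in> N" and l: "l \<in> carrier Y"
      and lim: "(\<lambda>n. vnorm Y (\<sigma> n \<ominus>\<^bsub>Y\<^esub> l)) \<longlonglongrightarrow> 0"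
    have "b l = 0" if b: "b \<in> common_kernel (dual_space Y) k (\<lambda>i. evaluation Y (y i))" for b
    proof -
      \<comment> \<open>A family with the single index 1 reduces the closedness of the kernel of
        \<open>b\<close> to that of common kernels.\<close>
      define b' where "b' i = b" for i :: nat
      have "closed_subspace (common_kernel Y 1 b') Y"
        using b ker by (intro Y.closed_subspace_common_kernel) (simp add: b'_def)
      moreover have "\<sigma> n \<in> common_kernel Y 1 b'" for n
        using s[of n] b by (simp add: N_def common_kernel_def b'_def)
      ultimately have "l \<in> common_kernel Y 1 b'" using Y.closed_subspaceD(6) l lim by blast
      then show ?thesis by (simp add: common_kernel_def b'_def)
    qed
    then show "l \<in> N" using l by (simp add: N_def)
  qed (auto simp: N_def)
  \<comment> \<open>On the common kernel \<open>M\<close> of the \<open>\<phi> i\<close>, the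
    evaluation at \<open>T x\<close> sends \<open>b\<close> to \<open>(T\<^sup>* b) x\<close> and
    has norm at most \<open>\<epsilon> \<parallel>x\<parallel>\<close>. A Hahn--Banach extension
    \<open>\<psi>\<close> of this restriction keeps the bound, and with \<open>\<xi>\<close> the
    difference of the evaluation and \<open>\<psi>\<close>, the required point of \<open>N\<close>
    is \<open>P \<xi>\<close>.\<close>
  have dist: "\<exists>z\<in>N. vnorm Y (T x \<ominus>\<^bsub>Y\<^esub> z) \<le> \<epsilon> * vnorm X x" if x: "x \<in> carrier X" for x
  proof -
    have Tx: "T x \<in> carrier Y" using x by simp
    define M where "M = common_kernel (dual_space Y) k \<phi>"
    have M: "closed_subspace M (dual_space Y)"
      unfolding M_def by (rule D.closed_subspace_common_kernel[OF phi])
    note MD = D.closed_subspaceD[OF M]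
    interpret e: functional "dual_space Y" "evaluation Y (T x)"
      by (rule functionalI[OF D.normed_space_axioms Y.evaluation_bounded[OF Tx]])
    have eadd: "evaluation Y (T x) (b \<oplus>\<^bsub>dual_space Y\<^esub> b') = evaluation Y (T x) b + evaluation Y (T x) b'"
      if "b \<in> M" "b' \<in> M" for b b'
      using e.add[of b b'] MD(1) that by (simp only: scalar_space_simps subset_iff)
    have esmult: "evaluation Y (T x) (c \<odot>\<^bsub>dual_space Y\<^esub> b) = c * evaluation Y (T x) b"
      if "b \<in> M" for b c
      using e.smult[of b c] MD(1) that by (simp only: scalar_space_simps subset_iff)
    have ele: "norm (evaluation Y (T x) b) \<le> \<epsilon> * vnorm X x * vnorm (dual_space Y) b" if bM: "b \<in> M" for b
    proof -
      have b: "b \<in> bounded_operators Y scalar_space" using bM by (simp add: M_def common_kernel_def)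
      have ad: "adjoint_op X Y T b = (\<lambda>x\<in>carrier X. b (T x))"
        by (rule adjoint_bounded(2)[OF X Y.normed_space_axioms T b])
      have "adjoint_op X Y T b \<in> bounded_operators X scalar_space"
        using bounded_operatorsD(1)[OF adjoint_bounded(1)[OF X Y.normed_space_axioms T], of b] b by simp
      then interpret t: functional X "adjoint_op X Y T b" by (intro functionalI[OF X])
      have "norm (b (T x)) \<le> op_norm X scalar_space (adjoint_op X Y T b) * vnorm X x"
        using t.bound[OF x] x by (simp add: ad)
      also have "\<dots> \<le> (\<epsilon> * vnorm (dual_space Y) b) * vnorm X x"
        using \<epsilon>(2)[OF bM[unfolded M_def]] x by (intro mult_right_mono) auto
      finally show ?thesis using b by (simp add: evaluation_def algebra_simps)
    qed
    obtain \<psi> where psi: "\<psi> \<in> bounded_operators (dual_space Y) scalar_space"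
      "\<And>b. b \<in> M \<Longrightarrow> \<psi> b = evaluation Y (T x) b"
      "\<And>b. b \<in> carrier (dual_space Y) \<Longrightarrow> norm (\<psi> b) \<le> \<epsilon> * vnorm X x * vnorm (dual_space Y) b"
      by (rule D.hahn_banach[OF MD(1,2,3,4) eadd esmult ele mult_nonneg_nonneg[OF \<epsilon>(1) X.vnorm_nonneg[OF x]]])
        (assumption | rule that)+
    interpret psi: functional "dual_space Y" \<psi> by (rule functionalI[OF D.normed_space_axioms psi(1)])
    have psiB: "\<psi> \<in> carrier ?B" using psi(1) by simp
    define \<xi> where "\<xi> = evaluation Y (T x) \<ominus>\<^bsub>?B\<^esub> \<psi>"
    have xi: "\<xi> \<in> carrier ?B"
      unfolding \<xi>_def by (rule P.V.M.minus_closed[OF ev[OF Tx] psiB])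
    have xi_eq: "\<xi> b = evaluation Y (T x) b - \<psi> b" if "b \<in> carrier (dual_space Y)" for b
      unfolding \<xi>_def D.dual_minus[OF Y.evaluation_bounded[OF Tx] psi(1)] using that by simp
    have Pxi: "P \<xi> = T x \<ominus>\<^bsub>Y\<^esub> P \<psi>"
      unfolding \<xi>_def P.diff[OF ev[OF Tx] psiB] P(2)[OF Tx] ..
    have "P \<xi> \<in> N"
      unfolding N_def
    proof (intro CollectI conjI ballI P.closed[OF xi])
      fix b assume "b \<in> common_kernel (dual_space Y) k (\<lambda>i. evaluation Y (y i))"
      then have b: "b \<in> bounded_operators Y scalar_space" "\<And>i. i \<in> {1..k} \<Longrightarrow> b (y i) = 0"
        using ker by blast+
      \<comment> \<open>\<open>F = b \<circ> P\<close> vanishes at each \<open>\<phi> i\<close>,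
        since \<open>b\<close> vanishes at \<open>y i = P (\<phi> i)\<close>. As
        \<open>\<xi>\<close> vanishes on \<open>M\<close>, it is a combination of the
        \<open>\<phi> i\<close>, and so \<open>F \<xi> = 0\<close>.\<close>
      define F where "F = adjoint_op ?B Y P b"
      have F: "F \<in> bounded_operators ?B scalar_space"
        using bounded_operatorsD(1)[OF adjoint_bounded(1)[OF B Y.normed_space_axioms P(1)], of b] b(1)
        by (simp add: F_def)
      have Feq: "F \<theta> = b (P \<theta>)" if "\<theta> \<in> carrier ?B" for \<theta>
        using that adjoint_bounded(2)[OF B Y.normed_space_axioms P(1) b(1)] by (simp add: F_def)
      interpret xi: functional "dual_space Y" \<xi>
        using xi by (intro functionalI[OF D.normed_space_axioms]) simp
      obtain u where span: "\<And>f c. D.linear_functional f \<Longrightarrow> \<forall>b\<in>common_kernel (dual_space Y) k \<phi>. f b = 0 \<Longrightarrow>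
          c \<in> carrier (dual_space Y) \<Longrightarrow> f c = (\<Sum>i\<in>{1..k}. f (u i) * \<phi> i c)"
        by (rule D.common_kernel_span[OF phi]) (assumption | rule that)+
      have "F \<xi> = 0"
      proof (rule D.dual_functional_vanishes_on_span[OF F])
        show "\<phi> i \<in> bounded_operators (dual_space Y) scalar_space \<and> F (\<phi> i) = 0" if "i \<in> {1..k}" for i
          using phi[OF that] b(2)[OF that] Feq[of "\<phi> i"] by (simp add: y_def)
        show "\<xi> \<in> bounded_operators (dual_space Y) scalar_space" using xi by simp
        show "\<xi> c = (\<Sum>i\<in>{1..k}. \<xi> (u i) * \<phi> i c)" if "c \<in> carrier (dual_space Y)" for c
        proof (rule span[OF _ _ that])
          show "\<forall>b\<in>common_kernel (dual_space Y) k \<phi>. \<xi> b = 0"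
            using psi(2) xi_eq by (simp add: M_def common_kernel_def)
          show "D.linear_functional \<xi>" by (rule xi.linear_functional)
        qed
      qed
      then show "b (P \<xi>) = 0" using Feq[OF xi] by simp
    qed
    \<comment> \<open>\<open>P\<close> fixes \<open>T x\<close>, so the error of the approximation
      is \<open>P \<psi>\<close>, and \<open>P\<close> does not increase norms.\<close>
    moreover have "T x \<ominus>\<^bsub>Y\<^esub> P \<xi> = P \<psi>"
      unfolding Pxi using Tx P.closed[OF psiB]
      by (simp add: Y.M.minus_eq Y.M.minus_add Y.M.a_ac Y.M.r_neg Y.M.r_neg1 Y.M.r_neg2)
    moreover have "vnorm Y (P \<psi>) \<le> \<epsilon> * vnorm X x"
    proof -
      have "vnorm Y (P \<psi>) \<le> op_norm (dual_space Y) scalar_space \<psi>" using P(3)[OF psiB] by simp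
      also have "\<dots> \<le> \<epsilon> * vnorm X x"
        using psi(3) \<epsilon>(1) x by (intro psi.leI) auto
      finally show ?thesis .
    qed
    ultimately show ?thesis by (intro bexI[of _ "P \<xi>"]) simp_all
  qed
  obtain S where S: "S \<in> bounded_operators X Y" "\<And>x. x \<in> carrier X \<Longrightarrow> T x \<ominus>\<^bsub>Y\<^esub> S x \<in> N"
    "\<And>x. x \<in> carrier X \<Longrightarrow> vnorm Y (S x) \<le> (1 + \<delta>) * \<epsilon> * vnorm X x"
    by (rule metric_lifting_propertyD[OF lift X Y h N T \<epsilon>(1) dist \<delta>]) (assumption | rule that)+
  interpret S: bounded_op X Y S by (rule bounded_opI[OF X Y.normed_space_axioms S(1)])
  have evy: "evaluation Y (y i) \<in> bounded_operators (dual_space Y) scalar_space" if "i \<in> {1..k}" for i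
    by (rule Y.evaluation_bounded[OF y[OF that]])
  obtain b where b: "\<And>i. i \<in> {1..k} \<Longrightarrow> b i \<in> carrier (dual_space Y)"
    and span: "\<And>f c. D.linear_functional f \<Longrightarrow> \<forall>b\<in>common_kernel (dual_space Y) k (\<lambda>i. evaluation Y (y i)). f b = 0 \<Longrightarrow>
          c \<in> carrier (dual_space Y) \<Longrightarrow> f c = (\<Sum>i\<in>{1..k}. f (b i) * evaluation Y (y i) c)"
        by (rule D.common_kernel_span[OF evy]) (assumption | rule that)+
  \<comment> \<open>On \<open>N\<close> the \<open>k\<close> functionals \<open>b i\<close> separate
    points: the evaluation at \<open>z \<in> N\<close> vanishes on the common kernel of the
    evaluations at the \<open>y i\<close>, hence is the combination of these with coefficients
    \<open>b i z\<close>.\<close>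
  have zero: "z = \<zero>\<^bsub>Y\<^esub>" if z: "z \<in> N" "\<And>i. i \<in> {1..k} \<Longrightarrow> b i z = 0" for z
  proof (rule Y.evaluation_inj)
    show zc: "z \<in> carrier Y" using z(1) by (simp add: N_def)
    interpret e: functional "dual_space Y" "evaluation Y z"
      by (rule functionalI[OF D.normed_space_axioms Y.evaluation_bounded[OF zc]])
    fix c assume c: "c \<in> bounded_operators Y scalar_space"
    then have cc: "c \<in> carrier (dual_space Y)" by simp
    have "evaluation Y z c = (\<Sum>i\<in>{1..k}. evaluation Y z (b i) * evaluation Y (y i) c)"
    proof (rule span[OF _ _ cc])
      show "\<forall>x\<in>common_kernel (dual_space Y) k (\<lambda>i. evaluation Y (y i)). evaluation Y z x = 0"
        using z(1) ker by (auto simp: N_def evaluation_def)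
      show "D.linear_functional (evaluation Y z)" by (rule e.linear_functional)
    qed
    also have "\<dots> = 0"
      using z(2) b by (intro sum.neutral) (simp add: evaluation_def)
    finally show "c z = 0" using c by (simp add: evaluation_def)
  qed
  define A where "A = (\<lambda>x\<in>carrier X. T x \<ominus>\<^bsub>Y\<^esub> S x)"
  have A: "A \<in> bounded_operators X Y"
  proof (rule bounded_operatorsI[where B = "op_norm X Y T + op_norm X Y S"])
    show "A \<in> extensional (carrier X)" unfolding A_def by (rule restrict_extensional)
    fix x assume x: "x \<in> carrier X"
    show "A x \<in> carrier Y" using x by (simp add: A_def)
    show "vnorm Y (A x) \<le> (op_norm X Y T + op_norm X Y S) * vnorm X x"
      using Y.vnorm_minus_le[of "T x" "S x"] T.norm_bound[OF x] S.norm_bound[OF x] x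
      by (simp add: A_def distrib_right)
    show "A (c \<odot>\<^bsub>X\<^esub> x) = c \<odot>\<^bsub>Y\<^esub> A x" for c
      using x by (simp add: A_def T.smult S.smult Y.M.minus_eq Y.smult_add_right Y.smult_minus_right)
    fix x' assume x': "x' \<in> carrier X"
    show "A (x \<oplus>\<^bsub>X\<^esub> x') = A x \<oplus>\<^bsub>Y\<^esub> A x'"
      using x x' by (simp add: A_def T.add S.add Y.M.minus_eq Y.M.minus_add Y.M.a_ac)
  qed
  \<comment> \<open>\<open>a i = b i \<circ> (T - S)\<close> on \<open>X\<close>. On their common
    kernel the value of \<open>T - S\<close>, which lies in \<open>N\<close>, is zero, so that
    \<open>T\<close> agrees there with \<open>S\<close>.\<close>
  define a where "a i = adjoint_op X Y A (b i)" for i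
  have a_eq: "a i = (\<lambda>x\<in>carrier X. b i (A x))" if "i \<in> {1..k}" for i
    using adjoint_bounded(2)[OF X Y.normed_space_axioms A, of "b i"] b that by (simp add: a_def)
  have "a i \<in> bounded_operators X scalar_space" if "i \<in> {1..k}" for i
    using bounded_operatorsD(1)[OF adjoint_bounded(1)[OF X Y.normed_space_axioms A], of "b i"] b that
    by (simp add: a_def)
  moreover have "vnorm Y (T x) \<le> (1 + \<delta>) * \<epsilon> * vnorm X x" if xk: "x \<in> common_kernel X k a" for x
  proof -
    have x: "x \<in> carrier X" using xk by (simp add: common_kernel_def)
    have "A x = \<zero>\<^bsub>Y\<^esub>"
    proof (rule zero)
      show "A x \<in> N" using S(2)[OF x] x by (simp add: A_def)
      show "b i (A x) = 0" if "i \<in> {1..k}" for i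
      proof -
        have "a i x = 0" using xk that by (simp add: common_kernel_def)
        then show ?thesis using a_eq[OF that] x by simp
      qed
    qed
    then have "T x = S x" using x by (simp add: A_def Y.minus_eq_zero_iff)
    then show ?thesis using S(3)[OF x] by simp
  qed
  ultimately show ?thesis by blast
qed

theorem theorem4p12:
  fixes X :: "('k::real_or_complex, 'x) normed_module"
    and Y :: "('k, 'y) normed_module"
    and T :: "'x \<Rightarrow> 'y"
    and n :: nat
  assumes "banach_space X"
    and "banach_space Y"
    and "metric_lifting_property TYPE(('k, 'x, 'y) test_type) X"
    and "metric_extension_property TYPE(('k, 'x, 'y) test_type) Y"
    and "compact_operator X Y T"
    and "1 \<le> n"
  shows "gelfand_number (dual_space Y) (dual_space X) n (adjoint_op X Y T)
       = gelfand_number X Y n T"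
proof -
  interpret X: banach_space X by (rule assms)
  interpret Y: banach_space Y by (rule assms)
  have T: "T \<in> bounded_operators X Y" using assms(5) by (simp add: compact_operator_def)
  interpret T: bounded_op X Y T
    by (rule bounded_opI[OF X.normed_space_axioms Y.normed_space_axioms T])
  \<comment> \<open>Evaluations separate the points of the sum type because
    \<open>0 \<noteq> 1\<close> among the scalars, and \<open>hB\<close> is injective because each
    function on \<open>'y\<close> extends to the sum. \<open>hX\<close> and \<open>hB\<close> serve
    the extension property, \<open>hY\<close> the lifting property.\<close>
  define hX :: "'x \<Rightarrow> ('k, 'x, 'y) test_type" where "hX x = (\<lambda>f. f (Inl x))" for x
  define hY :: "'y \<Rightarrow> ('k, 'x, 'y) test_type" where "hY y = (\<lambda>f. f (Inr y))" for y
  define hB :: "(('y \<Rightarrow> 'k) \<Rightarrow> 'k) \<Rightarrow> ('k, 'x, 'y) test_type" where "hB \<phi> = (\<lambda>f. \<phi> (f \<circ> Inr))" for \<phi>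
  have hX: "inj hX"
  proof (rule injI)
    fix x x' assume "hX x = hX x'"
    from fun_cong[OF this, of "\<lambda>z. of_bool (z = Inl x)"] show "x = x'"
      by (simp add: hX_def split: if_splits)
  qed
  have hY: "inj hY"
  proof (rule injI)
    fix y y' assume "hY y = hY y'"
    from fun_cong[OF this, of "\<lambda>z. of_bool (z = Inr y)"] show "y = y'"
      by (simp add: hY_def split: if_splits)
  qed
  have hB: "inj hB"
  proof (rule injI, rule ext)
    fix \<phi> \<psi> g assume "hB \<phi> = hB \<psi>"
    from fun_cong[OF this, of "case_sum (\<lambda>_. 0) g"] show "\<phi> g = \<psi> g"
      by (simp add: hB_def comp_def)
  qed
  obtain P where P: "P \<in> bounded_operators (dual_space (dual_space Y)) Y"
    "\<And>y. y \<in> carrier Y \<Longrightarrow> P (evaluation Y y) = y"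
    "\<And>\<phi>. \<phi> \<in> carrier (dual_space (dual_space Y)) \<Longrightarrow>
      vnorm Y (P \<phi>) \<le> vnorm (dual_space (dual_space Y)) \<phi>"
    by (rule bidual_projection[OF assms(2,4) inj_on_subset[OF hB subset_UNIV]]) (assumption | rule that)+
  define G where "G = {\<epsilon>. \<epsilon> > 0 \<and> (\<exists>k<n. \<exists>a. (\<forall>i\<in>{1..k}. a i \<in> bounded_operators X scalar_space) \<and>
      (\<forall>x\<in>common_kernel X k a. vnorm Y (T x) \<le> \<epsilon> * vnorm X x))}"
  define G' where "G' = {\<epsilon>. \<epsilon> > 0 \<and> (\<exists>k<n. \<exists>\<phi>.
      (\<forall>i\<in>{1..k}. \<phi> i \<in> bounded_operators (dual_space Y) scalar_space) \<and>
      (\<forall>b\<in>common_kernel (dual_space Y) k \<phi>.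
        vnorm (dual_space X) (adjoint_op X Y T b) \<le> \<epsilon> * vnorm (dual_space Y) b))}"
  have sub: "G \<subseteq> G'"
  proof
    fix \<epsilon> assume "\<epsilon> \<in> G"
    then obtain k a where "\<epsilon> > 0" "k < n" "\<And>i. i \<in> {1..k} \<Longrightarrow> a i \<in> bounded_operators X scalar_space"
      "\<And>x. x \<in> common_kernel X k a \<Longrightarrow> vnorm Y (T x) \<le> \<epsilon> * vnorm X x"
      unfolding G_def by blast
    note ka = this
    have "\<exists>\<phi>. (\<forall>i\<in>{1..k}. \<phi> i \<in> bounded_operators (dual_space Y) scalar_space) \<and>
        (\<forall>b\<in>common_kernel (dual_space Y) k \<phi>.
          vnorm (dual_space X) (adjoint_op X Y T b) \<le> \<epsilon> * vnorm (dual_space Y) b)"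
      by (rule adjoint_bound_of_extension[OF assms(1) Y.normed_space_axioms T assms(4)
            inj_on_subset[OF hX subset_UNIV] ka(3) less_imp_le[OF ka(1)] ka(4)])
    then show "\<epsilon> \<in> G'"
      using ka(1,2) unfolding G'_def by blast
  qed
  have up: "(1 + \<delta>) * \<epsilon> \<in> G" if e: "\<epsilon> \<in> G'" and \<delta>: "\<delta> > 0" for \<epsilon> \<delta>
  proof -
    obtain k \<phi> where k: "\<epsilon> > 0" "k < n"
      "\<And>i. i \<in> {1..k} \<Longrightarrow> \<phi> i \<in> bounded_operators (dual_space Y) scalar_space"
      "\<And>b. b \<in> common_kernel (dual_space Y) k \<phi> \<Longrightarrow>
        vnorm (dual_space X) (adjoint_op X Y T b) \<le> \<epsilon> * vnorm (dual_space Y) b"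
      using e unfolding G'_def by blast
    have "\<exists>a. (\<forall>i\<in>{1..k}. a i \<in> bounded_operators X scalar_space) \<and>
        (\<forall>x\<in>common_kernel X k a. vnorm Y (T x) \<le> (1 + \<delta>) * \<epsilon> * vnorm X x)"
      by (rule bound_of_adjoint_bound[OF X.normed_space_axioms assms(2) T assms(3)
            inj_on_subset[OF hY subset_UNIV] P k(3) less_imp_le[OF k(1)] k(4) \<delta>])
    then show ?thesis using k(1,2) \<delta> unfolding G_def by auto
  qed
  \<comment> \<open>This uses no functionals, that is \<open>k = 0 < n\<close>; the summand 1 makes
    the number positive also for \<open>T = 0\<close>.\<close>
  have "op_norm X Y T + 1 \<in> G"
  proof -
    have "vnorm Y (T x) \<le> (op_norm X Y T + 1) * vnorm X x" if "x \<in> carrier X" for x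
      using T.norm_bound[OF that] X.vnorm_nonneg[OF that] by (simp add: distrib_right)
    then show ?thesis
      using assms(6) T.op_norm_nonneg unfolding G_def
      by (intro CollectI conjI exI[of _ 0]) (auto simp: common_kernel_def)
  qed
  then have ne: "G \<noteq> {}" by blast
  have bdd: "bdd_below G'" "bdd_below G"
    by (rule bdd_belowI[of _ 0]; simp add: G_def G'_def)+
  have "Inf G' = Inf G"
  proof (rule antisym)
    show "Inf G' \<le> Inf G" by (rule cInf_superset_mono[OF ne bdd(1) sub])
    show "Inf G \<le> Inf G'"
    proof (rule cInf_greatest)
      show "G' \<noteq> {}" using ne sub by blast
      fix \<epsilon> assume e: "\<epsilon> \<in> G'"
      then have pos: "\<epsilon> > 0" by (simp add: G'_def)
      show "Inf G \<le> \<epsilon>"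
      proof (rule field_le_epsilon)
        fix r :: real assume r: "r > 0"
        \<comment> \<open>The choice \<open>\<delta> = r / \<epsilon>\<close> turns the factor lost
          in the lifting into the additive error \<open>r\<close>.\<close>
        have "Inf G \<le> (1 + r / \<epsilon>) * \<epsilon>"
          using up[OF e, of "r / \<epsilon>"] r pos by (intro cInf_lower bdd) auto
        also have "(1 + r / \<epsilon>) * \<epsilon> = \<epsilon> + r" using pos by (simp add: field_simps)
        finally show "Inf G \<le> \<epsilon> + r" .
      qed
    qed
  qed
  then show ?thesis
    unfolding gelfand_number_common_kernel[OF X.normed_space_axioms Y.normed_space_axioms T]
      gelfand_number_common_kernel[OF Y.normed_space_dual X.normed_space_dual
        adjoint_bounded(1)[OF X.normed_space_axioms Y.normed_space_axioms T]]
      G_def G'_def .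
qed

end
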